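(* Let $G\leqslant\mathrm{Sym}(\Omega)$ be a semiprimitive group (with $\Omega$ possibly infinite) that has at least two plinths. Then there is a characteristically simple group $X$ such that for any two distinct plinths $L$ and $R$ of $G$, the group $G/(L\cap R)$, acting on the set of $(L\cap R)$-orbits, is a primitive group with $L/(L\cap R)\cong X\cong R/(L\cap R)$. In particular, if $G$ is finite, then there is a uniquely determined non-abelian simple group $T$ and an integer $\ell$ such that, for any two distinct plinths $L$ and $R$, $G/(L\cap R)$ is primitive of type HS or HC with socle $T^\ell\times T^\ell$.
   Context: A permutation group is semiregular if all its point-stabilisers are trivial. A transitive permutation group is semiprimitive if every normal subgroup is transitive or semiregular. A plinth of a transitive group $G$ is a transitive normal subgroup $K$ of $G$ such that no proper subgroup of $K$ that is normal in $G$ is transitive. For an intransitive normal subgroup $N$ of a semiprimitive group $G$, the kernel of the action of $G$ on the set of $N$-orbits is $N$, so $G/N$ is a permutation group on this set. The socle of a group is the product of its minimal normal subgroups. Types of finite primitive groups $P\leqslant\mathrm{Sym}(\Delta)$, with $T$ a non-abelian finite simple group and $\alpha \in \Delta$: type HS means $\Delta=T$, $P\leqslant\mathrm{Hol}(T)$ contains a normal subgroup isomorphic to $T\times T$ and $\mathrm{Inn}(T)\leqslant P_\alpha\leqslant\mathrm{Aut}(T)$; type HC means that for some $k\geqslant2$, $\Delta=T^k$ and $T^k\,\mathrm{Inn}(T^k)\leqslant P\leqslant\mathrm{Hol}(T^k)$ with $P$ transitively permuting the $k$ factors of $T^k$, and there are exactly two minimal normal subgroups, each isomorphic to $T^k$,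 with $\mathrm{soc}(P)_\alpha\cong T^k$. *)

theory Defs
  imports "HOL-Algebra.SimpleGroups" "HOL-Algebra.Group_Action" "HOL-Algebra.Product_Groups"
    "HOL-Library.Disjoint_Sets"
begin

section \<open>Subgroups as groups, characteristically simple groups, socle\<close>

abbreviation subgrp :: "('a, 'b) monoid_scheme \<Rightarrow> 'a set \<Rightarrow> ('a, 'b) monoid_scheme"
  where "subgrp G H \<equiv> G\<lparr>carrier := H\<rparr>"

text \<open>As with simple groups, a characteristically simple group is required to be nontrivial.\<close>

definition char_simple_group :: "('a, 'b) monoid_scheme \<Rightarrow> bool"
  where "char_simple_group X \<longleftrightarrow>
    group X \<and> carrier X \<noteq> {\<one>\<^bsub>X\<^esub>} \<and>
    (\<forall>H. subgroup H X \<and> (\<forall>f\<in>auto X. f ` H = H) \<longrightarrow> H = {\<one>\<^bsub>X\<^esub>} \<or> H = carrier X)"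

definition minimal_normal :: "('a, 'b) monoid_scheme \<Rightarrow> 'a set \<Rightarrow> bool"
  where "minimal_normal G M \<longleftrightarrow>
    M \<lhd> G \<and> M \<noteq> {\<one>\<^bsub>G\<^esub>} \<and> (\<forall>N. N \<lhd> G \<and> N \<subseteq> M \<longrightarrow> N = {\<one>\<^bsub>G\<^esub>} \<or> N = M)"

definition socle :: "('a, 'b) monoid_scheme \<Rightarrow> 'a set"
  where "socle G = generate G (\<Union>{M. minimal_normal G M})"

abbreviation power_group :: "('a, 'b) monoid_scheme \<Rightarrow> nat \<Rightarrow> (nat \<Rightarrow> 'a) monoid"
  where "power_group T k \<equiv> product_group {..<k} (\<lambda>_. T)"

section \<open>Permutation groups\<close>

text \<open>
  A permutation group on \<open>\<Omega>\<close> is a subgroup \<open>G\<close> of \<open>BijGroup \<Omega>\<close>, acting from the left by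
  the identity map.
\<close>

abbreviation perm_group :: "'a set \<Rightarrow> ('a \<Rightarrow> 'a) set \<Rightarrow> ('a \<Rightarrow> 'a) monoid"
  where "perm_group \<Omega> G \<equiv> subgrp (BijGroup \<Omega>) G"

definition transitive :: "'a set \<Rightarrow> ('a \<Rightarrow> 'a) set \<Rightarrow> bool"
  where "transitive \<Omega> G \<longleftrightarrow> transitive_action (perm_group \<Omega> G) \<Omega> id"

definition semiregular :: "'a set \<Rightarrow> ('a \<Rightarrow> 'a) set \<Rightarrow> bool"
  where "semiregular \<Omega> G \<longleftrightarrow>
    (\<forall>\<alpha>\<in>\<Omega>. stabilizer (perm_group \<Omega> G) id \<alpha> = {\<one>\<^bsub>BijGroup \<Omega>\<^esub>})"

definition semiprimitive :: "'a set \<Rightarrow> ('a \<Rightarrow> 'a) set \<Rightarrow> bool"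
  where "semiprimitive \<Omega> G \<longleftrightarrow>
    transitive \<Omega> G \<and>
    (\<forall>N. N \<lhd> perm_group \<Omega> G \<longrightarrow> transitive \<Omega> N \<or> semiregular \<Omega> N)"

definition plinth :: "'a set \<Rightarrow> ('a \<Rightarrow> 'a) set \<Rightarrow> ('a \<Rightarrow> 'a) set \<Rightarrow> bool"
  where "plinth \<Omega> G K \<longleftrightarrow>
    K \<lhd> perm_group \<Omega> G \<and> transitive \<Omega> K \<and>
    (\<forall>M. M \<lhd> perm_group \<Omega> G \<and> M \<subset> K \<longrightarrow> \<not> transitive \<Omega> M)"

definition primitive :: "'a set \<Rightarrow> ('a \<Rightarrow> 'a) set \<Rightarrow> bool"
  where "primitive \<Delta> P \<longleftrightarrow>
    transitive \<Delta> P \<and>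
    (\<forall>\<B>. partition_on \<Delta> \<B> \<and> (\<forall>p\<in>P. \<forall>B\<in>\<B>. p ` B \<in> \<B>)
      \<longrightarrow> \<B> = {\<Delta>} \<or> \<B> = (\<lambda>x. {x}) ` \<Delta>)"

abbreviation orbit_set :: "'a set \<Rightarrow> ('a \<Rightarrow> 'a) set \<Rightarrow> 'a set set"
  where "orbit_set \<Omega> N \<equiv> orbits (perm_group \<Omega> N) \<Omega> id"

text \<open>
  The action of the quotient by a normal subgroup \<open>N\<close> on the set of \<open>N\<close>-orbits.
  If \<open>C\<close> is the coset of \<open>N\<close> containing \<open>g\<close> and \<open>B\<close> is an \<open>N\<close>-orbit, then \<open>c ` B = g ` B\<close>
  for every \<open>c \<in> C\<close>, so the union below is just \<open>g ` B\<close>.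
\<close>

definition quotient_action :: "'a set \<Rightarrow> ('a \<Rightarrow> 'a) set \<Rightarrow> ('a \<Rightarrow> 'a) set \<Rightarrow> 'a set \<Rightarrow> 'a set"
  where "quotient_action \<Omega> N C = (\<lambda>B\<in>orbit_set \<Omega> N. \<Union>c\<in>C. c ` B)"

text \<open>The permutation group on the set of \<open>N\<close>-orbits induced by \<open>G/N\<close>.\<close>

definition quotient_perms ::
    "'a set \<Rightarrow> ('a \<Rightarrow> 'a) set \<Rightarrow> ('a \<Rightarrow> 'a) set \<Rightarrow> ('a set \<Rightarrow> 'a set) set"
  where "quotient_perms \<Omega> G N = quotient_action \<Omega> N ` carrier (perm_group \<Omega> G Mod N)"

section \<open>Holomorphs and the primitive types HS and HC\<close>

definition right_translation :: "('a, 'b) monoid_scheme \<Rightarrow> 'a \<Rightarrow> 'a \<Rightarrow> 'a"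
  where "right_translation H g = (\<lambda>x\<in>carrier H. x \<otimes>\<^bsub>H\<^esub> g)"

definition inner_auts :: "('a, 'b) monoid_scheme \<Rightarrow> ('a \<Rightarrow> 'a) set"
  where "inner_auts H = (\<lambda>g. \<lambda>x\<in>carrier H. g \<otimes>\<^bsub>H\<^esub> x \<otimes>\<^bsub>H\<^esub> inv\<^bsub>H\<^esub> g) ` carrier H"

definition holomorph :: "('a, 'b) monoid_scheme \<Rightarrow> ('a \<Rightarrow> 'a) set"
  where "holomorph H =
    (right_translation H ` carrier H) <#>\<^bsub>BijGroup (carrier H)\<^esub> auto H"

text \<open>The \<open>i\<close>-th factor of \<open>T\<^sup>k\<close>, as a subgroup of the group of right translations of \<open>T\<^sup>k\<close>.\<close>

definition factor :: "('a, 'b) monoid_scheme \<Rightarrow> nat \<Rightarrow> nat \<Rightarrow> ((nat \<Rightarrow> 'a) \<Rightarrow> (nat \<Rightarrow> 'a)) set"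
  where "factor T k i = right_translation (power_group T k) `
    {f \<in> carrier (power_group T k). \<forall>j<k. j \<noteq> i \<longrightarrow> f j = \<one>\<^bsub>T\<^esub>}"

definition conj_action :: "('a, 'b) monoid_scheme \<Rightarrow> 'a set set \<Rightarrow> 'a \<Rightarrow> 'a set \<Rightarrow> 'a set"
  where "conj_action S \<F> p = (\<lambda>F\<in>\<F>. (\<lambda>n. p \<otimes>\<^bsub>S\<^esub> n \<otimes>\<^bsub>S\<^esub> inv\<^bsub>S\<^esub> p) ` F)"

text \<open>
  In type HS the point \<open>\<alpha>\<close> is the identity of \<open>T\<close>, whose stabiliser in \<open>Hol(T)\<close> is \<open>Aut(T)\<close>.
  The predicate \<open>simple_group\<close> only holds of finite groups.
\<close>

definition HS_on :: "('a, 'b) monoid_scheme \<Rightarrow> ('a \<Rightarrow> 'a) set \<Rightarrow> bool"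
  where "HS_on T P \<longleftrightarrow>
    simple_group T \<and> \<not> comm_group T \<and>
    primitive (carrier T) P \<and>
    P \<subseteq> holomorph T \<and>
    (\<exists>N. N \<lhd> perm_group (carrier T) P \<and> perm_group (carrier T) N \<cong> T \<times>\<times> T) \<and>
    inner_auts T \<subseteq> stabilizer (perm_group (carrier T) P) id \<one>\<^bsub>T\<^esub> \<and>
    stabilizer (perm_group (carrier T) P) id \<one>\<^bsub>T\<^esub> \<subseteq> auto T"

text \<open>
  In type HC the group \<open>P\<close> permutes the factors of its normal subgroup \<open>T\<^sup>k\<close> (the right
  translations) by conjugation.
\<close>

definition HC_on :: "('a, 'b) monoid_scheme \<Rightarrow> nat \<Rightarrow> ((nat \<Rightarrow> 'a) \<Rightarrow> (nat \<Rightarrow> 'a)) set \<Rightarrow> bool"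
  where "HC_on T k P \<longleftrightarrow>
    simple_group T \<and> \<not> comm_group T \<and> 2 \<le> k \<and>
    (let H = power_group T k; \<Delta> = carrier H; S = BijGroup \<Delta>; PG = perm_group \<Delta> P;
         \<F> = factor T k ` {..<k}
     in primitive \<Delta> P \<and>
        (right_translation H ` carrier H) <#>\<^bsub>S\<^esub> inner_auts H \<subseteq> P \<and>
        P \<subseteq> holomorph H \<and>
        transitive_action PG \<F> (conj_action S \<F>) \<and>
        card {M. minimal_normal PG M} = 2 \<and>
        (\<forall>M. minimal_normal PG M \<longrightarrow> subgrp PG M \<cong> H) \<and>
        (\<forall>\<alpha>\<in>\<Delta>. subgrp PG (stabilizer (subgrp PG (socle PG)) id \<alpha>) \<cong> H))"

text \<open>The permutation group on \<open>\<Gamma>\<close> obtained from \<open>P\<close> on \<open>\<Delta>\<close> along a bijection \<open>\<beta>\<close> from \<open>\<Delta>\<close> to \<open>\<Gamma>\<close>.\<close>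

definition transport_perms ::
    "'a set \<Rightarrow> 'b set \<Rightarrow> ('a \<Rightarrow> 'b) \<Rightarrow> ('a \<Rightarrow> 'a) set \<Rightarrow> ('b \<Rightarrow> 'b) set"
  where "transport_perms \<Delta> \<Gamma> \<beta> P = (\<lambda>p. \<lambda>y\<in>\<Gamma>. \<beta> (p (inv_into \<Delta> \<beta> y))) ` P"

text \<open>
  The types are properties of permutation groups up to permutation isomorphism.  Since
  \<open>\<Delta>\<close> has the cardinality of \<open>T\<close> or \<open>T\<^sup>k\<close>, an isomorphic copy of \<open>T\<close> exists on the element
  type of \<open>\<Delta>\<close>, so nothing is lost by letting \<open>T\<close> range over the groups on that type.
\<close>

definition type_HS :: "'a set \<Rightarrow> ('a \<Rightarrow> 'a) set \<Rightarrow> bool"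
  where "type_HS \<Delta> P \<longleftrightarrow>
    (\<exists>(T :: 'a monoid) \<beta>. bij_betw \<beta> \<Delta> (carrier T) \<and>
       HS_on T (transport_perms \<Delta> (carrier T) \<beta> P))"

definition type_HC :: "'a set \<Rightarrow> ('a \<Rightarrow> 'a) set \<Rightarrow> bool"
  where "type_HC \<Delta> P \<longleftrightarrow>
    (\<exists>(T :: 'a monoid) k \<beta>. bij_betw \<beta> \<Delta> (carrier (power_group T k)) \<and>
       HC_on T k (transport_perms \<Delta> (carrier (power_group T k)) \<beta> P))"

text \<open>
  For any two distinct plinths \<open>L\<close> and \<open>R\<close>, \<open>G/(L \<inter> R)\<close> is primitive of type HS or HC
  with socle isomorphic to \<open>T\<^sup>l \<times> T\<^sup>l\<close>.
\<close>

definition plinth_quotients_HS_HC ::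
    "'a set \<Rightarrow> ('a \<Rightarrow> 'a) set \<Rightarrow> ('t, 'b) monoid_scheme \<Rightarrow> nat \<Rightarrow> bool"
  where "plinth_quotients_HS_HC \<Omega> G T l \<longleftrightarrow>
    (\<forall>L R. plinth \<Omega> G L \<and> plinth \<Omega> G R \<and> L \<noteq> R \<longrightarrow>
      (let \<Delta> = orbit_set \<Omega> (L \<inter> R); P = quotient_perms \<Omega> G (L \<inter> R)
       in primitive \<Delta> P \<and> (type_HS \<Delta> P \<or> type_HC \<Delta> P) \<and>
          perm_group \<Delta> (socle (perm_group \<Delta> P)) \<cong> power_group T l \<times>\<times> power_group T l))"

end

(*
  Let N be the intersection of two distinct plinths L and R. It is intransitive, hence it is the
  kernel of the action of G on the N-orbits, and the images A of L and B of R in the induced group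
  P commute. Since the kernel of G on a non-trivial block system would be semiregular, P is
  primitive.

  In P the groups A and B are regular and centralise each other, so P acts on A as a subgroup of
  the holomorph containing all left and right translations; A and B are the only minimal normal
  subgroups, and both are characteristically simple. They are isomorphic since a point stabiliser
  in AB is a complement to each of them. For a third plinth S, either the intersections of L
  with R and S agree, or the second isomorphism theorem compares all quotients with the
  intersection of R and S modulo that of L, R and S.

  For finite G, A is a power of a non-abelian simple group T, and T and the exponent are recovered
  from the minimal normal subgroups of the power.
*)
theory Submission
  imports Defs "HOL-Algebra.SndIsomorphismGrp" "HOL-Algebra.Weak_Morphisms"
begin

section \<open>Subgroups, direct products and characteristic simplicity\<close>

text \<open>The analysis of P rests on one fact: a permutation that commutes with a transitive group
  and fixes a point is trivial. It makes A and B regular and makes B the full centraliser of A in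
  the symmetric group on the orbit set. This rules out an abelian A, which would lie in B, and also
  a third minimal normal subgroup. Regularity explains the holomorph too: the point set becomes A
  itself with A acting by left translations, and the centraliser B can then only consist of the
  right translations. Finiteness enters only to find minimal normal subgroups inside A and to make
  them simple groups.

  The obstacle in comparing plinth pairs is that their quotients have different kernels. It is
  overcome because L/(L \<inter> R) is a chief factor of G, so two different intersections with
  other plinths already generate L.

  Uniqueness is read off the socle, a power of T with exponent 2l: it has exactly 2l minimal normal
  subgroups, all of them copies of T.\<close>

lemma (in group) inv_mult_cancel:
  assumes "x \<in> carrier G" "y \<in> carrier G"
  shows "inv x \<otimes> (x \<otimes> y) = y" "x \<otimes> (inv x \<otimes> y) = y"
  using assms by (simp_all flip: m_assoc)

text \<open>Products and inverses are those of the ambient group. Permutation groups on one set are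
  all subgroups of the same \<open>BijGroup\<close>, and this form keeps computations there.\<close>

lemma (in group) normal_subgrp_iff:
  assumes "subgroup H G"
  shows "N \<lhd> subgrp G H \<longleftrightarrow>
    subgroup N G \<and> N \<subseteq> H \<and> (\<forall>h\<in>H. \<forall>n\<in>N. h \<otimes> n \<otimes> inv h \<in> N)"
proof -
  interpret H: group "subgrp G H"
    using assms by (rule subgroup_imp_group)
  show ?thesis
    unfolding H.normal_inv_iff
    using assms incl_subgroup[OF assms] subgroup_incl[of N H] subgroup.subset[of N "subgrp G H"]
    by (auto simp: m_inv_consistent)
qed

lemma (in group) generate_commute:
  assumes "S \<subseteq> carrier G" "x \<in> carrier G" "\<And>s. s \<in> S \<Longrightarrow> x \<otimes> s = s \<otimes> x"
    and "g \<in> generate G S"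
  shows "x \<otimes> g = g \<otimes> x"
  using assms(4)
proof (induction rule: generate.induct)
  case one
  then show ?case using assms(2) by simp
next
  case (incl h)
  then show ?case by (rule assms(3))
next
  case (inv h)
  then have h: "h \<in> carrier G" "x \<otimes> h = h \<otimes> x"
    using assms by auto
  have "x \<otimes> inv h = inv h \<otimes> (h \<otimes> x) \<otimes> inv h"
    using h(1) assms(2) by (simp flip: m_assoc)
  also have "\<dots> = inv h \<otimes> (x \<otimes> h) \<otimes> inv h"
    using h by simp
  also have "\<dots> = inv h \<otimes> x"
    using h(1) assms(2) by (simp add: m_assoc)
  finally show ?case .
next
  case (eng h1 h2)
  then have "h1 \<in> carrier G" "h2 \<in> carrier G"
    using assms(1) generate_in_carrier by auto
  then show ?case
    using eng assms(2) by (metis m_assoc)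
qed

lemma (in group) set_mult_eq_generate:
  assumes "A \<lhd> G" "subgroup B G"
  shows "A <#> B = generate G (A \<union> B)"
proof (rule generateI)
  interpret second_isomorphism_grp A G B
    using assms by (simp add: second_isomorphism_grp_def second_isomorphism_grp_axioms_def)
  show "subgroup (A <#> B) G" "A \<union> B \<subseteq> A <#> B"
    using normal_set_mult_subgroup H_contained_in_set_mult S_contained_in_set_mult by auto
  show "A <#> B \<subseteq> K" if "subgroup K G" "A \<union> B \<subseteq> K" for K
    using that by (auto simp: set_mult_def subset_iff subgroup.m_closed)
qed

text \<open>Multiplication of the two components is a homomorphism because they commute elementwise,
  and it is injective because \<open>U\<close> and \<open>V\<close> meet trivially.\<close>

lemma (in group) commuting_set_mult_iso:
  assumes U: "subgroup U G" and V: "subgroup V G" and triv: "U \<inter> V = {\<one>}"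
    and comm: "\<And>u v. u \<in> U \<Longrightarrow> v \<in> V \<Longrightarrow> u \<otimes> v = v \<otimes> u"
  shows "subgrp G U \<times>\<times> subgrp G V \<cong> subgrp G (U <#> V)"
proof (rule is_isoI, rule isoI, rule homI)
  interpret U: subgroup U G by (rule U)
  interpret V: subgroup V G by (rule V)
  show "(case x of (u, v) \<Rightarrow> u \<otimes> v) \<in> carrier (subgrp G (U <#> V))"
    if "x \<in> carrier (subgrp G U \<times>\<times> subgrp G V)" for x
    using that by (auto simp: set_mult_def)
  fix x y
  assume "x \<in> carrier (subgrp G U \<times>\<times> subgrp G V)" "y \<in> carrier (subgrp G U \<times>\<times> subgrp G V)"
  then obtain u v u' v' where uv: "x = (u, v)" "y = (u', v')" "u \<in> U" "v \<in> V" "u' \<in> U" "v' \<in> V"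
    by auto
  have "u \<otimes> u' \<otimes> (v \<otimes> v') = u \<otimes> (u' \<otimes> v) \<otimes> v'"
    using uv by (simp add: m_assoc)
  also have "\<dots> = u \<otimes> v \<otimes> (u' \<otimes> v')"
    using uv comm[of u' v] by (simp add: m_assoc)
  finally show "(case x \<otimes>\<^bsub>subgrp G U \<times>\<times> subgrp G V\<^esub> y of (u, v) \<Rightarrow> u \<otimes> v)
      = (case x of (u, v) \<Rightarrow> u \<otimes> v) \<otimes>\<^bsub>subgrp G (U <#> V)\<^esub> (case y of (u, v) \<Rightarrow> u \<otimes> v)"
    using uv by simp
next
  interpret U: subgroup U G by (rule U)
  interpret V: subgroup V G by (rule V)
  interpret D: group_disjoint_sum G U V by unfold_locales
  have "\<forall>x\<in>U. \<forall>y\<in>V. \<forall>x'\<in>U. \<forall>y'\<in>V. x \<otimes> y = x' \<otimes> y' \<longrightarrow> x = x' \<and> y = y'"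
    using D.cancel triv by blast
  then have "inj_on (\<lambda>(u, v). u \<otimes> v) (U \<times> V)"
    unfolding inj_on_def by auto
  then show "bij_betw (\<lambda>(u, v). u \<otimes> v) (carrier (subgrp G U \<times>\<times> subgrp G V))
      (carrier (subgrp G (U <#> V)))"
    by (auto simp: bij_betw_def set_mult_def image_def)
qed

lemma (in group) second_iso:
  assumes "K \<lhd> G" "subgroup U G"
  shows "subgrp G U Mod (K \<inter> U) \<cong> subgrp G (K <#> U) Mod K"
proof -
  interpret second_isomorphism_grp K G U
    using assms by (simp add: second_isomorphism_grp_def second_isomorphism_grp_axioms_def)
  show ?thesis
    using normal_intersection_quotient_isom by (rule is_isoI)
qed

text \<open>By the second isomorphism theorem \<open>U\<close> and \<open>V\<close> both map
  isomorphically onto the quotient of \<open>KU = KV\<close> by \<open>K\<close>. The intended case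
  is the socle, where \<open>B\<close> and a point stabiliser both complement
  \<open>A\<close>.\<close>

lemma (in group) complement_iso:
  assumes K: "K \<lhd> G" and U: "subgroup U G" and V: "subgroup V G"
    and "K \<inter> U = {\<one>}" "K \<inter> V = {\<one>}" "K <#> U = K <#> V"
  shows "subgrp G U \<cong> subgrp G V"
proof -
  have *: "subgrp G W \<cong> subgrp G (K <#> W) Mod K" if "subgroup W G" "K \<inter> W = {\<one>}" for W
  proof -
    interpret W: group "subgrp G W"
      using that(1) by (rule subgroup_imp_group)
    have "subgrp G W Mod {\<one>} \<cong> subgrp G W"
      using W.trivial_factor_iso by (auto intro: is_isoI)
    moreover have "group (subgrp G W Mod {\<one>})"
      using W.one_is_normal normal.factorgroup_is_group by fastforce
    ultimately have "subgrp G W \<cong> subgrp G W Mod {\<one>}"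
      by (simp add: group.iso_sym)
    then show ?thesis
      using second_iso[OF K that(1)] that(2) iso_trans by fastforce
  qed
  have "subgrp G U \<cong> subgrp G (K <#> V) Mod K" "subgrp G V \<cong> subgrp G (K <#> V) Mod K"
    using *[OF U] *[OF V] assms by auto
  then show ?thesis
    using group.iso_sym[OF subgroup_imp_group[OF V]] iso_trans by blast
qed

section \<open>Automorphisms and characteristic simplicity under isomorphism\<close>

lemma auto_conj_iso:
  assumes G: "group G" and \<phi>: "\<phi> \<in> iso G H" and f: "f \<in> auto H"
  shows "(\<lambda>x\<in>carrier G. inv_into (carrier G) \<phi> (f (\<phi> x))) \<in> auto G"
proof -
  let ?g = "\<lambda>x\<in>carrier G. inv_into (carrier G) \<phi> (f (\<phi> x))"
  have inv: "inv_into (carrier G) \<phi> \<in> iso H G"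
    using group.iso_set_sym[OF G \<phi>] .
  have "f \<in> iso H H"
    using f by (auto simp: auto_def iso_def Bij_def)
  then have "(inv_into (carrier G) \<phi> \<circ> f) \<circ> \<phi> \<in> iso G G"
    using iso_set_trans[OF \<phi> iso_set_trans[OF _ inv]] by (simp add: comp_def)
  \<comment> \<open>Members of \<open>auto\<close> are extensional, hence the restriction to the
    carrier.\<close>
  then have "?g \<in> iso G G"
    by (rule group.iso_eq[OF G]) simp
  then show ?thesis
    by (auto simp: auto_def iso_def Bij_def)
qed

text \<open>Each automorphism of \<open>H\<close> is a conjugate of one of \<open>G\<close> under
  \<open>\<phi>\<close>, so an automorphism-invariant subgroup of \<open>G\<close> has an
  automorphism-invariant image in \<open>H\<close>.\<close>

lemma char_simple_group_iso:
  assumes "char_simple_group H" and iso: "G \<cong> H" and G: "group G"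
  shows "char_simple_group G"
proof -
  obtain \<phi> where \<phi>: "\<phi> \<in> iso G H"
    using iso by (auto simp: is_iso_def)
  have H: "group H" "carrier H \<noteq> {\<one>\<^bsub>H\<^esub>}"
    and char: "\<And>K. subgroup K H \<Longrightarrow> (\<And>f. f \<in> auto H \<Longrightarrow> f ` K = K) \<Longrightarrow>
      K = {\<one>\<^bsub>H\<^esub>} \<or> K = carrier H"
    using assms(1) by (auto simp: char_simple_group_def)
  interpret \<phi>: group_hom G H \<phi>
    using \<phi> G H(1) by (simp add: group_hom_def group_hom_axioms_def iso_def)
  have bij: "bij_betw \<phi> (carrier G) (carrier H)"
    using \<phi> by (simp add: iso_def)
  have "carrier G \<noteq> {\<one>\<^bsub>G\<^esub>}"
    using bij H(2) by (auto simp: bij_betw_def)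
  moreover have "K = {\<one>\<^bsub>G\<^esub>} \<or> K = carrier G"
    if K: "subgroup K G" and inv: "\<And>f. f \<in> auto G \<Longrightarrow> f ` K = K" for K
  proof -
    have sub: "K \<subseteq> carrier G"
      using K by (rule subgroup.subset)
    have "f ` \<phi> ` K = \<phi> ` K" if f: "f \<in> auto H" for f
    proof -
      let ?g = "\<lambda>x\<in>carrier G. inv_into (carrier G) \<phi> (f (\<phi> x))"
      have "\<phi> (?g x) = f (\<phi> x)" if "x \<in> K" for x
      proof -
        have "f (\<phi> x) \<in> carrier H"
          using f that sub by (auto simp: auto_def hom_in_carrier subset_iff)
        then show ?thesis
          using bij that sub by (auto simp: bij_betw_def f_inv_into_f)
      qed
      then have "f ` \<phi> ` K = \<phi> ` ?g ` K"
        unfolding image_image by (rule image_cong[OF refl, symmetric])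
      then show ?thesis
        using inv[OF auto_conj_iso[OF G \<phi> f]] by simp
    qed
    then have "\<phi> ` K = {\<one>\<^bsub>H\<^esub>} \<or> \<phi> ` K = carrier H"
      using char[OF \<phi>.subgroup_img_is_subgroup[OF K]] by blast
    moreover have "\<phi> ` {\<one>\<^bsub>G\<^esub>} = {\<one>\<^bsub>H\<^esub>}" "\<phi> ` carrier G = carrier H"
      using bij by (auto simp: bij_betw_def)
    ultimately show ?thesis
      using inj_on_image_eq_iff[OF bij_betw_imp_inj_on[OF bij] sub] G
      by (metis \<phi>.G.triv_subgroup subgroup.subset order_refl)
  qed
  ultimately show ?thesis
    using G by (simp add: char_simple_group_def)
qed

section \<open>Powers of a group\<close>

lemma power_group_Suc: "power_group T (Suc k) \<cong> power_group T k \<times>\<times> T"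
proof (rule is_isoI, rule isoI, rule homI)
  let ?h = "\<lambda>f. (restrict f {..<k}, f k)"
  show "?h f \<in> carrier (power_group T k \<times>\<times> T)" if "f \<in> carrier (power_group T (Suc k))" for f
    using that by (auto simp: PiE_iff)
  show "?h (f \<otimes>\<^bsub>power_group T (Suc k)\<^esub> g) = ?h f \<otimes>\<^bsub>power_group T k \<times>\<times> T\<^esub> ?h g"
    if "f \<in> carrier (power_group T (Suc k))" "g \<in> carrier (power_group T (Suc k))" for f g
    using that by (auto simp: fun_eq_iff)
  show "bij_betw ?h (carrier (power_group T (Suc k))) (carrier (power_group T k \<times>\<times> T))"
  proof (rule bij_betw_byWitness[where f' = "\<lambda>(f, t). f(k := t)"])
    show "\<forall>f\<in>carrier (power_group T (Suc k)). (case ?h f of (f, t) \<Rightarrow> f(k := t)) = f"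
      by (auto simp: fun_eq_iff PiE_iff extensional_def less_Suc_eq)
    show "\<forall>p\<in>carrier (power_group T k \<times>\<times> T). ?h (case p of (f, t) \<Rightarrow> f(k := t)) = p"
      by (auto simp: fun_eq_iff PiE_iff extensional_def)
    show "?h ` carrier (power_group T (Suc k)) \<subseteq> carrier (power_group T k \<times>\<times> T)"
      by (rule image_subsetI) (simp add: PiE_iff)
    show "(\<lambda>(f, t). f(k := t)) ` carrier (power_group T k \<times>\<times> T) \<subseteq> carrier (power_group T (Suc k))"
    proof (rule image_subsetI)
      fix p assume "p \<in> carrier (power_group T k \<times>\<times> T)"
      then have "(fst p)(k := snd p) \<in> carrier (power_group T (Suc k))"
        by (simp add: PiE_iff extensional_def mem_Times_iff)
      then show "(case p of (f, t) \<Rightarrow> f(k := t)) \<in> carrier (power_group T (Suc k))"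
        by (simp add: case_prod_beta)
    qed
  qed
qed

lemma DirProd_assoc_iso: "(G \<times>\<times> H) \<times>\<times> K \<cong> G \<times>\<times> (H \<times>\<times> K)"
  by (rule is_isoI, rule isoI[where h = "\<lambda>((x, y), z). (x, y, z)"], rule homI)
    (auto simp: bij_betw_def inj_on_def image_def)

context group
begin

lemma power_group_group: "group (power_group G k)"
  by simp

lemma power_group_0: "power_group G 0 \<times>\<times> H \<cong> H"
  by (rule is_isoI, rule isoI[where h = snd], rule homI) (auto simp: bij_betw_def inj_on_def image_def)

lemma power_group_1: "power_group G 1 \<cong> G"
  using power_group_Suc[of 0 G] power_group_0[of G] iso_trans by fastforce

text \<open>Turns a socle of the form \<open>T^l x T^l\<close> into a single power with exponent
  \<open>l + l\<close>, whose exponent and factor are determined.\<close>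

lemma power_group_add: "power_group G (m + n) \<cong> power_group G m \<times>\<times> power_group G n"
proof (induction n)
  case 0
  have grp: "group (power_group G 0 \<times>\<times> power_group G m)"
    by (intro DirProd_group power_group_group)
  have "power_group G 0 \<times>\<times> power_group G m \<cong> power_group G m"
    by (rule power_group_0)
  then have "power_group G m \<cong> power_group G 0 \<times>\<times> power_group G m"
    by (rule group.iso_sym[OF grp])
  then show ?case
    using DirProd_commute_iso iso_trans by (metis add.right_neutral)
next
  case (Suc n)
  let ?P = "power_group G"
  have "?P (m + Suc n) \<cong> ?P (m + n) \<times>\<times> G"
    using power_group_Suc[of "m + n" G] by simp
  also have "\<dots> \<cong> (?P m \<times>\<times> ?P n) \<times>\<times> G"
    using group.DirProd_iso_trans[OF power_group_group Suc iso_refl] .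
  also have "\<dots> \<cong> ?P m \<times>\<times> (?P n \<times>\<times> G)"
    by (rule DirProd_assoc_iso)
  also have "\<dots> \<cong> ?P m \<times>\<times> ?P (Suc n)"
    using group.DirProd_iso_trans[OF power_group_group iso_refl]
      group.iso_sym[OF power_group_group power_group_Suc] by blast
  finally show ?case .
qed

end

section \<open>Minimal normal subgroups\<close>

lemma iso_subgrp:
  assumes "\<phi> \<in> iso G H" "M \<subseteq> carrier G"
  shows "\<phi> \<in> iso (subgrp G M) (subgrp H (\<phi> ` M))"
  using assms by (auto simp: iso_def hom_def bij_betw_def subset_iff intro: inj_on_subset)

lemma (in group) conj_iso:
  assumes p: "p \<in> carrier G"
  shows "(\<lambda>n. p \<otimes> n \<otimes> inv p) \<in> iso G G"
proof (rule isoI, rule homI)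
  show "p \<otimes> (x \<otimes> y) \<otimes> inv p = p \<otimes> x \<otimes> inv p \<otimes> (p \<otimes> y \<otimes> inv p)"
    if "x \<in> carrier G" "y \<in> carrier G" for x y
    using p that by (simp add: m_assoc inv_mult_cancel)
  show "bij_betw (\<lambda>n. p \<otimes> n \<otimes> inv p) (carrier G) (carrier G)"
    by (rule bij_betw_byWitness[where f' = "\<lambda>n. inv p \<otimes> n \<otimes> p"])
      (use p in \<open>auto simp: m_assoc inv_mult_cancel\<close>)
qed (use p in auto)

lemma (in group) normal_conj_image:
  assumes A: "A \<lhd> G" and p: "p \<in> carrier G"
  shows "(\<lambda>n. p \<otimes> n \<otimes> inv p) ` A = A"
proof
  show "(\<lambda>n. p \<otimes> n \<otimes> inv p) ` A \<subseteq> A"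
    using A p by (auto simp: normal_inv_iff)
  show "A \<subseteq> (\<lambda>n. p \<otimes> n \<otimes> inv p) ` A"
  proof
    fix a assume a: "a \<in> A"
    then have "a \<in> carrier G"
      using A by (meson normal_imp_subgroup subgroup.mem_carrier)
    then have "a = p \<otimes> (inv p \<otimes> a \<otimes> p) \<otimes> inv p"
      using p by (simp add: m_assoc inv_mult_cancel)
    then show "a \<in> (\<lambda>n. p \<otimes> n \<otimes> inv p) ` A"
      using normal.inv_op_closed1[OF A p a] by blast
  qed
qed

text \<open>The centre of \<open>A\<close> is characteristic in \<open>A\<close>: conjugation by
  \<open>p\<close> is a homomorphism that maps \<open>A\<close> onto itself, so it takes central
  elements to central elements.\<close>

lemma (in group) normal_center:
  assumes A: "A \<lhd> G"
  shows "{z \<in> A. \<forall>a\<in>A. z \<otimes> a = a \<otimes> z} \<lhd> G" (is "?Z \<lhd> G")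
proof (rule normal_invI)
  interpret A: normal A G by (rule A)
  show "subgroup ?Z G"
  proof (rule subgroupI)
    show "inv z \<in> ?Z" if "z \<in> ?Z" for z
    proof -
      have "inv z \<otimes> a = a \<otimes> inv z" if "a \<in> A" for a
      proof -
        have za: "z \<otimes> a = a \<otimes> z" "z \<in> carrier G" "a \<in> carrier G"
          using \<open>z \<in> ?Z\<close> that by auto
        then have "inv z \<otimes> a = inv z \<otimes> (a \<otimes> z) \<otimes> inv z"
          by (simp add: m_assoc)
        also have "\<dots> = a \<otimes> inv z"
          using za(2,3) by (simp flip: za(1)) (simp add: m_assoc inv_mult_cancel)
        finally show ?thesis .
      qed
      then show ?thesis
        using that by auto
    qed
    show "y \<otimes> z \<in> ?Z" if "y \<in> ?Z" "z \<in> ?Z" for y z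
    proof -
      have "y \<otimes> z \<otimes> a = a \<otimes> (y \<otimes> z)" if "a \<in> A" for a
      proof -
        have 1: "y \<otimes> a = a \<otimes> y" "z \<otimes> a = a \<otimes> z" "y \<in> carrier G" "z \<in> carrier G" "a \<in> carrier G"
          using \<open>y \<in> ?Z\<close> \<open>z \<in> ?Z\<close> that by auto
        then have "y \<otimes> z \<otimes> a = y \<otimes> (a \<otimes> z)"
          by (simp only: m_assoc)
        also have "\<dots> = a \<otimes> y \<otimes> z"
          using 1 by (simp only: flip: m_assoc)
        finally show ?thesis
          using 1(3-5) by (simp add: m_assoc)
      qed
      then show ?thesis
        using that A.m_closed by blast
    qed
  qed (auto intro!: exI[of _ \<one>])
  fix p z assume p: "p \<in> carrier G" and z: "z \<in> ?Z"
  interpret c: group_hom G G "\<lambda>n. p \<otimes> n \<otimes> inv p"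
    using conj_iso[OF p] by (simp add: group_hom_def group_hom_axioms_def iso_def)
  have "p \<otimes> z \<otimes> inv p \<otimes> (p \<otimes> a \<otimes> inv p) = p \<otimes> a \<otimes> inv p \<otimes> (p \<otimes> z \<otimes> inv p)" if "a \<in> A" for a
  proof -
    have "z \<in> carrier G" "a \<in> carrier G" "z \<otimes> a = a \<otimes> z"
      using z that A.subset by blast+
    then show ?thesis
      using c.hom_mult[of z a] c.hom_mult[of a z] by simp
  qed
  then have "\<forall>a\<in>(\<lambda>n. p \<otimes> n \<otimes> inv p) ` A. p \<otimes> z \<otimes> inv p \<otimes> a = a \<otimes> (p \<otimes> z \<otimes> inv p)"
    by blast
  then show "p \<otimes> z \<otimes> inv p \<in> ?Z"
    unfolding normal_conj_image[OF A p] using A.inv_op_closed2[OF p] z by blast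
qed

lemma minimal_normal_Int:
  assumes "group G" "minimal_normal G M" "minimal_normal G N" "M \<noteq> N"
  shows "M \<inter> N = {\<one>\<^bsub>G\<^esub>}"
proof -
  have "M \<inter> N \<lhd> G"
    using assms by (auto simp: minimal_normal_def intro: group.normal_subgroup_intersect)
  then have "M \<inter> N = {\<one>\<^bsub>G\<^esub>} \<or> M \<inter> N = M" "M \<inter> N = {\<one>\<^bsub>G\<^esub>} \<or> M \<inter> N = N"
    using assms(2,3) unfolding minimal_normal_def by blast+
  then show ?thesis
    using assms(4) by blast
qed

lemma minimal_normal_commute:
  assumes "group G" "minimal_normal G M" "minimal_normal G N" "M \<noteq> N" "x \<in> M" "y \<in> N"
  shows "x \<otimes>\<^bsub>G\<^esub> y = y \<otimes>\<^bsub>G\<^esub> x"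
  using group.normal_imp_commuting[OF assms(1), of M N] minimal_normal_Int[OF assms(1-4)] assms
  by (simp add: minimal_normal_def)

text \<open>The centre of \<open>A\<close> is normal in \<open>G\<close> and, \<open>A\<close> being
  non-abelian, different from \<open>A\<close>; minimality makes it trivial.\<close>

lemma minimal_normal_center:
  assumes G: "group G" and A: "minimal_normal G A"
    and nonab: "\<exists>x\<in>A. \<exists>y\<in>A. x \<otimes>\<^bsub>G\<^esub> y \<noteq> y \<otimes>\<^bsub>G\<^esub> x"
    and z: "z \<in> A" "\<And>a. a \<in> A \<Longrightarrow> z \<otimes>\<^bsub>G\<^esub> a = a \<otimes>\<^bsub>G\<^esub> z"
  shows "z = \<one>\<^bsub>G\<^esub>"
proof -
  let ?Z = "{z \<in> A. \<forall>a\<in>A. z \<otimes>\<^bsub>G\<^esub> a = a \<otimes>\<^bsub>G\<^esub> z}"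
  have "?Z \<lhd> G"
    using A by (auto simp: minimal_normal_def intro: group.normal_center[OF G])
  then have "?Z = {\<one>\<^bsub>G\<^esub>} \<or> ?Z = A"
    using A unfolding minimal_normal_def by (metis (no_types, lifting) mem_Collect_eq subsetI)
  moreover have "?Z \<noteq> A"
    using nonab by blast
  ultimately show ?thesis
    using z by blast
qed

lemma minimal_normal_iso:
  assumes \<phi>: "\<phi> \<in> iso G H" and G: "group G" and H: "group H" and M: "minimal_normal G M"
  shows "minimal_normal H (\<phi> ` M)"
  unfolding minimal_normal_def
proof (intro conjI allI impI)
  let ?\<psi> = "inv_into (carrier G) \<phi>"
  interpret \<phi>: group_hom G H \<phi>
    using \<phi> G H by (simp add: group_hom_def group_hom_axioms_def iso_def)
  have \<psi>: "?\<psi> \<in> iso H G"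
    using group.iso_set_sym[OF G \<phi>] .
  have bij: "bij_betw \<phi> (carrier G) (carrier H)"
    using \<phi> by (simp add: iso_def)
  have sub: "M \<subseteq> carrier G" and one: "\<one>\<^bsub>G\<^esub> \<in> M"
    using M by (auto simp: minimal_normal_def dest!: normal_imp_subgroup
        intro: subgroup.mem_carrier subgroup.one_closed)
  show "\<phi> ` M \<lhd> H"
    using M iso_normal_subgroup[OF \<phi> G H] by (simp add: minimal_normal_def)
  show "\<phi> ` M \<noteq> {\<one>\<^bsub>H\<^esub>}"
  proof
    assume *: "\<phi> ` M = {\<one>\<^bsub>H\<^esub>}"
    have "m = \<one>\<^bsub>G\<^esub>" if "m \<in> M" for m
    proof (rule inj_onD[OF bij_betw_imp_inj_on[OF bij]])
      show "\<phi> m = \<phi> \<one>\<^bsub>G\<^esub>" using * that by auto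
    qed (use that sub in auto)
    then show False
      using M one unfolding minimal_normal_def by blast
  qed
  fix N assume N: "N \<lhd> H \<and> N \<subseteq> \<phi> ` M"
  then have "?\<psi> ` N \<lhd> G"
    using iso_normal_subgroup[OF \<psi> H G] by simp
  moreover have "?\<psi> ` N \<subseteq> M"
  proof -
    have "?\<psi> ` N \<subseteq> ?\<psi> ` \<phi> ` M"
      using N by blast
    then show ?thesis
      using inv_into_image_cancel[OF bij_betw_imp_inj_on[OF bij] sub] by simp
  qed
  ultimately have "?\<psi> ` N = {\<one>\<^bsub>G\<^esub>} \<or> ?\<psi> ` N = M"
    using M by (simp add: minimal_normal_def)
  moreover have "\<phi> ` ?\<psi> ` N = N"
  proof (rule image_inv_into_cancel)
    show "\<phi> ` carrier G = carrier H" using bij by (simp add: bij_betw_def)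
    show "N \<subseteq> carrier H" using N by (meson normal_imp_subgroup subgroup.subset)
  qed
  ultimately show "N = {\<one>\<^bsub>H\<^esub>} \<or> N = \<phi> ` M"
    by (metis image_empty image_insert \<phi>.hom_one)
qed

lemma minimal_normals_iso:
  assumes \<phi>: "\<phi> \<in> iso G H" and G: "group G" and H: "group H"
  shows "{M. minimal_normal H M} = image \<phi> ` {M. minimal_normal G M}"
proof
  have bij: "bij_betw \<phi> (carrier G) (carrier H)"
    using \<phi> by (simp add: iso_def)
  show "image \<phi> ` {M. minimal_normal G M} \<subseteq> {M. minimal_normal H M}"
    using minimal_normal_iso[OF \<phi> G H] by blast
  show "{M. minimal_normal H M} \<subseteq> image \<phi> ` {M. minimal_normal G M}"
  proof clarify
    fix M assume M: "minimal_normal H M"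
    have "minimal_normal G (inv_into (carrier G) \<phi> ` M)"
      using minimal_normal_iso[OF group.iso_set_sym[OF G \<phi>] H G M] .
    moreover have "M = \<phi> ` inv_into (carrier G) \<phi> ` M"
    proof (rule image_inv_into_cancel[symmetric])
      show "\<phi> ` carrier G = carrier H" using bij by (simp add: bij_betw_def)
      show "M \<subseteq> carrier H"
        using M by (meson minimal_normal_def normal_imp_subgroup subgroup.subset)
    qed
    ultimately show "M \<in> image \<phi> ` {M. minimal_normal G M}" by blast
  qed
qed

lemma finite_minimal_normal_exists:
  assumes G: "group G" and "finite (carrier G)" and "carrier G \<noteq> {\<one>\<^bsub>G\<^esub>}"
  obtains M where "minimal_normal G M"
proof -
  let ?S = "{N. N \<lhd> G \<and> N \<noteq> {\<one>\<^bsub>G\<^esub>}}"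
  have "?S \<subseteq> Pow (carrier G)"
    by (auto dest!: normal_imp_subgroup dest: subgroup.mem_carrier)
  then have "finite ?S"
    using assms(2) by (meson finite_Pow_iff finite_subset)
  moreover have "carrier G \<in> ?S"
    using group.normal_self[OF G] assms(3) by simp
  ultimately obtain M where "M \<in> ?S" and min: "\<And>N. N \<in> ?S \<Longrightarrow> N \<subseteq> M \<Longrightarrow> N = M"
    using finite_has_minimal[of ?S] by blast
  then have "minimal_normal G M"
    unfolding minimal_normal_def by blast
  then show ?thesis
    by (rule that)
qed

lemma simple_group_minimal_normal: "simple_group T \<Longrightarrow> minimal_normal T (carrier T)"
  using simple_group.simple_not_triv[of T] simple_group.no_real_normal_subgroup[of T]
    group.normal_self[of T] by (auto simp: minimal_normal_def simple_group_def)

lemma comm_group_iso: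
  assumes "comm_group G" "G \<cong> H" "group H"
  shows "comm_group H"
proof (rule group.group_comm_groupI[OF assms(3)])
  obtain \<phi> where \<phi>: "\<phi> \<in> iso G H"
    using assms(2) by (auto simp: is_iso_def)
  fix x y assume "x \<in> carrier H" "y \<in> carrier H"
  then obtain a b where ab: "a \<in> carrier G" "b \<in> carrier G" "x = \<phi> a" "y = \<phi> b"
    using \<phi> unfolding iso_def bij_betw_def by blast
  then have "x \<otimes>\<^bsub>H\<^esub> y = \<phi> (a \<otimes>\<^bsub>G\<^esub> b)" "y \<otimes>\<^bsub>H\<^esub> x = \<phi> (b \<otimes>\<^bsub>G\<^esub> a)"
    using \<phi> by (auto simp: iso_def hom_mult)
  then show "x \<otimes>\<^bsub>H\<^esub> y = y \<otimes>\<^bsub>H\<^esub> x"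
    using comm_monoid.m_comm[OF comm_group.axioms(1)[OF assms(1)]] ab by simp
qed

text \<open>
  The minimal normal subgroups of \<open>A\<close> commute pairwise, so an element of one of them lying in
  the product of the others is central in \<open>A\<close>; as \<open>A\<close> has trivial centre, their product is direct.
\<close>

locale nonabelian_minimal_normal = group P for P :: "('a, 'b) monoid_scheme" (structure) +
  fixes A :: "'a set"
  assumes minimal: "minimal_normal P A"
    and nonabelian: "\<exists>x\<in>A. \<exists>y\<in>A. x \<otimes> y \<noteq> y \<otimes> x"
begin

abbreviation "factors \<equiv> {M. minimal_normal (subgrp P A) M}"

lemma normal_A: "A \<lhd> P" and subgroup_A: "subgroup A P"
  using minimal by (auto simp: minimal_normal_def dest: normal_imp_subgroup)

lemma group_A: "group (subgrp P A)"
  using subgroup_A by (rule subgroup_imp_group)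

lemma A_carrier: "A \<subseteq> carrier P"
  using subgroup_A by (rule subgroup.subset)

lemma center_trivial:
  "z \<in> A \<Longrightarrow> (\<And>a. a \<in> A \<Longrightarrow> z \<otimes> a = a \<otimes> z) \<Longrightarrow> z = \<one>"
  using minimal_normal_center[OF group_axioms minimal nonabelian] by blast

lemma factor_subgroup: "M \<in> factors \<Longrightarrow> subgroup M P \<and> M \<subseteq> A"
  by (auto simp: minimal_normal_def normal_subgrp_iff[OF subgroup_A])

lemma factors_commute: "M \<in> factors \<Longrightarrow> N \<in> factors \<Longrightarrow> M \<noteq> N \<Longrightarrow> x \<in> M \<Longrightarrow> y \<in> N \<Longrightarrow> x \<otimes> y = y \<otimes> x"
  using minimal_normal_commute[OF group_A] by simp

lemma conj_factor:
  assumes p: "p \<in> carrier P" and M: "M \<in> factors"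
  shows "(\<lambda>n. p \<otimes> n \<otimes> inv p) ` M \<in> factors"
proof -
  have "(\<lambda>n. p \<otimes> n \<otimes> inv p) \<in> iso (subgrp P A) (subgrp P A)"
    using iso_subgrp[OF conj_iso[OF p] A_carrier] normal_conj_image[OF normal_A p] by simp
  then show ?thesis
    using minimal_normal_iso[OF _ group_A group_A] M by blast
qed

text \<open>Closure under conjugation makes the generated subgroup normal in \<open>P\<close>, the
  element \<open>s\<close> makes it non-trivial, and minimality of \<open>A\<close> does the rest.
  It is applied to the union of all factors and to the union of the conjugates of one
  factor.\<close>

lemma normal_generated:
  assumes "S \<subseteq> A" and "\<And>s p. s \<in> S \<Longrightarrow> p \<in> carrier P \<Longrightarrow> p \<otimes> s \<otimes> inv p \<in> S"
    and "s \<in> S" "s \<noteq> \<one>"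
  shows "generate P S = A"
proof -
  have "generate P S \<lhd> P"
    using assms A_carrier by (intro normal_generateI) auto
  moreover have "generate P S \<subseteq> A"
    using assms(1) subgroup_A by (rule generate_subgroup_incl)
  moreover have "generate P S \<noteq> {\<one>}"
    using assms(3,4) generate.incl by fastforce
  ultimately show ?thesis
    using minimal by (auto simp: minimal_normal_def)
qed

lemma factor_nontrivial:
  assumes "M \<in> factors"
  obtains m where "m \<in> M" "m \<noteq> \<one>"
proof -
  have "\<one> \<in> M" "M \<noteq> {\<one>}"
    using assms factor_subgroup[OF assms] by (auto simp: minimal_normal_def subgroup.one_closed)
  then show ?thesis
    using that by blast
qed

lemma generate_factors:
  assumes "M \<in> factors"
  shows "generate P (\<Union>factors) = A"
proof -
  obtain m where "m \<in> M" "m \<noteq> \<one>"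
    using factor_nontrivial[OF assms] .
  show ?thesis
  proof (rule normal_generated)
    show "\<Union>factors \<subseteq> A" using factor_subgroup by blast
    show "p \<otimes> s \<otimes> inv p \<in> \<Union>factors" if "s \<in> \<Union>factors" "p \<in> carrier P" for s p
      using that conj_factor[OF that(2)] by blast
    show "m \<in> \<Union>factors" using \<open>m \<in> M\<close> assms by blast
    show "m \<noteq> \<one>" by fact
  qed
qed

text \<open>The conjugates of \<open>M\<close> are again factors and together generate
  \<open>A\<close>. If \<open>N\<close> were not among them it would commute with all of them, hence
  be central in \<open>A\<close>, which has trivial centre.\<close>

lemma factor_conjugate:
  assumes M: "M \<in> factors" and N: "N \<in> factors"
  obtains p where "p \<in> carrier P" "(\<lambda>n. p \<otimes> n \<otimes> inv p) ` M = N"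
proof -
  let ?c = "\<lambda>p n. p \<otimes> n \<otimes> inv p"
  let ?S = "\<Union>p\<in>carrier P. ?c p ` M"
  obtain m where m: "m \<in> M" "m \<noteq> \<one>"
    using factor_nontrivial[OF M] .
  have gen: "generate P ?S = A"
  proof (rule normal_generated)
    show "?S \<subseteq> A"
      using conj_factor[OF _ M] factor_subgroup by blast
    show "?c p s \<in> ?S" if s: "s \<in> ?S" and p: "p \<in> carrier P" for s p
    proof -
      obtain q n where q: "q \<in> carrier P" "n \<in> M" "s = ?c q n"
        using s by blast
      have "n \<in> carrier P"
        using q factor_subgroup[OF M] A_carrier by blast
      then have "?c p s = ?c (p \<otimes> q) n"
        using p q by (simp add: inv_mult_group m_assoc)
      then show ?thesis
        using p q by blast
    qed
    have "m \<in> carrier P"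
      using m factor_subgroup[OF M] A_carrier by blast
    then have "?c \<one> m = m"
      by simp
    then show "m \<in> ?S"
      using m by force
    show "m \<noteq> \<one>" by fact
  qed
  have "\<exists>p\<in>carrier P. ?c p ` M = N"
  proof (rule ccontr)
    assume no: "\<not> (\<exists>p\<in>carrier P. ?c p ` M = N)"
    obtain x where x: "x \<in> N" "x \<noteq> \<one>"
      using factor_nontrivial[OF N] .
    have xA: "x \<in> A" using x factor_subgroup[OF N] by blast
    have "x \<otimes> s = s \<otimes> x" if "s \<in> ?S" for s
      using that no factors_commute[OF N conj_factor[OF _ M]] x by blast
    then have "x \<otimes> a = a \<otimes> x" if "a \<in> A" for a
      using generate_commute[of ?S x a] gen that xA A_carrier conj_factor[OF _ M] factor_subgroup
      by blast
    then show False
      using center_trivial[OF xA] x by blast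
  qed
  then show ?thesis
    using that by blast
qed

lemma factors_iso:
  assumes M: "M \<in> factors" and N: "N \<in> factors"
  shows "subgrp P M \<cong> subgrp P N"
proof -
  obtain p where "p \<in> carrier P" "(\<lambda>n. p \<otimes> n \<otimes> inv p) ` M = N"
    using factor_conjugate[OF M N] .
  then show ?thesis
    using iso_subgrp[OF conj_iso, of p M] factor_subgroup[OF M] A_carrier by (auto intro: is_isoI)
qed

text \<open>As soon as one factor exists, the factors generate \<open>A\<close>; the last assumption
  provides it. Commuting with all of them then means being central.\<close>

lemma central_of_factors:
  assumes x: "x \<in> A" and comm: "\<And>M y. M \<in> factors \<Longrightarrow> y \<in> M \<Longrightarrow> x \<otimes> y = y \<otimes> x"
    and "M \<in> factors"
  shows "x = \<one>"
proof (rule center_trivial[OF x])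
  fix a assume "a \<in> A"
  then have "a \<in> generate P (\<Union>factors)"
    unfolding generate_factors[OF assms(3)] .
  then show "x \<otimes> a = a \<otimes> x"
    by (rule generate_commute[rotated 3]) (use x A_carrier factor_subgroup comm in blast)+
qed

text \<open>An element of an abelian factor would commute with that factor as well as with all the
  others, so it would be trivial.\<close>

lemma factor_not_comm:
  assumes M: "M \<in> factors"
  shows "\<not> comm_group (subgrp P M)"
proof
  assume "comm_group (subgrp P M)"
  then interpret M: comm_group "subgrp P M" .
  obtain m where m: "m \<in> M" "m \<noteq> \<one>"
    using factor_nontrivial[OF M] .
  have "m \<otimes> y = y \<otimes> m" if "N \<in> factors" "y \<in> N" for N y
    using that m M.m_comm[of m y] factors_commute[OF M that(1)] by (cases "N = M") auto
  then show False
    using central_of_factors[of m, OF _ _ M] m factor_subgroup[OF M] by blast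
qed

text \<open>A normal subgroup \<open>N\<close> of the factor \<open>M\<close> is normalised by
  \<open>M\<close> and centralised by the other factors, hence normal in all of \<open>A\<close>;
  minimality of \<open>M\<close> in \<open>A\<close> applies. Finiteness is what
  \<open>simple_group\<close> asks for through the order.\<close>

lemma factor_simple:
  assumes M: "M \<in> factors" and fin: "finite A"
  shows "simple_group (subgrp P M)"
  unfolding simple_group_def simple_group_axioms_def
proof (intro conjI allI impI)
  have subM: "subgroup M P" and MA: "M \<subseteq> A"
    using factor_subgroup[OF M] by auto
  interpret M: group "subgrp P M"
    using subM by (rule subgroup_imp_group)
  show "group (subgrp P M)" by (rule M.group_axioms)
  obtain m where "m \<in> M" "m \<noteq> \<one>"
    using factor_nontrivial[OF M] .
  moreover have "\<one> \<in> M"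
    using subM by (rule subgroup.one_closed)
  moreover have "finite M"
    using fin MA by (rule finite_subset[rotated])
  ultimately have "card {\<one>, m} \<le> card M"
    by (intro card_mono) auto
  then show "1 < order (subgrp P M)"
    using \<open>m \<noteq> \<one>\<close> by (simp add: order_def)
next
  fix N assume "N \<lhd> subgrp P M"
  have subM: "subgroup M P" and MA: "M \<subseteq> A"
    using factor_subgroup[OF M] by auto
  have N: "subgroup N P" "N \<subseteq> M" and conj: "\<And>h n. h \<in> M \<Longrightarrow> n \<in> N \<Longrightarrow> h \<otimes> n \<otimes> inv h \<in> N"
    using \<open>N \<lhd> subgrp P M\<close> by (auto simp: normal_subgrp_iff[OF subM])
  have Nc: "n \<in> carrier P" if "n \<in> N" for n
    using subgroup.mem_carrier[OF N(1) that] .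
  \<comment> \<open>The normaliser of \<open>N\<close> in \<open>A\<close>. Conjugation in both
    directions is required so that closure under inverses is immediate.\<close>
  let ?E = "{a \<in> A. \<forall>n\<in>N. a \<otimes> n \<otimes> inv a \<in> N \<and> inv a \<otimes> n \<otimes> a \<in> N}"
  have "subgroup ?E P"
  proof (rule subgroupI)
    show "?E \<subseteq> carrier P" using A_carrier by blast
    show "?E \<noteq> {}"
      using subgroup.one_closed[OF subgroup_A] Nc by (auto intro!: exI[of _ \<one>])
    show "inv a \<in> ?E" if "a \<in> ?E" for a
      using that A_carrier subgroup.m_inv_closed[OF subgroup_A] by auto
    show "a \<otimes> b \<in> ?E" if ab: "a \<in> ?E" "b \<in> ?E" for a b
    proof -
      have c: "a \<in> carrier P" "b \<in> carrier P"
        using ab A_carrier by auto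
      have "a \<otimes> b \<otimes> n \<otimes> inv (a \<otimes> b) = a \<otimes> (b \<otimes> n \<otimes> inv b) \<otimes> inv a"
        "inv (a \<otimes> b) \<otimes> n \<otimes> (a \<otimes> b) = inv b \<otimes> (inv a \<otimes> n \<otimes> a) \<otimes> b" if "n \<in> N" for n
        using c Nc[OF that] by (simp_all add: inv_mult_group m_assoc)
      then show ?thesis
        using ab subgroup.m_closed[OF subgroup_A] by simp
    qed
  qed
  moreover have "\<Union>factors \<subseteq> ?E"
  proof clarify
    fix a K assume K: "minimal_normal (subgrp P A) K" "a \<in> K"
    then have aA: "a \<in> A" and iK: "inv a \<in> K"
      using factor_subgroup[of K] subgroup.m_inv_closed by auto
    have ac: "a \<in> carrier P" using aA A_carrier by blast
    have "a \<otimes> n \<otimes> inv a \<in> N \<and> inv a \<otimes> n \<otimes> a \<in> N" if n: "n \<in> N" for n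
    proof (cases "K = M")
      case True
      then show ?thesis
        using conj[of a n] conj[of "inv a" n] n K iK ac by simp
    next
      case False
      have nM: "n \<in> M" using n N by blast
      have "a \<otimes> n = n \<otimes> a" "inv a \<otimes> n = n \<otimes> inv a"
        using factors_commute[OF _ M False _ nM] K iK by auto
      then show ?thesis
        using n Nc[OF n] ac by (simp add: m_assoc)
    qed
    then show "a \<in> A \<and> (\<forall>n\<in>N. a \<otimes> n \<otimes> inv a \<in> N \<and> inv a \<otimes> n \<otimes> a \<in> N)"
      using aA by blast
  qed
  ultimately have "A \<subseteq> ?E"
    using generate_subgroup_incl[of "\<Union>factors" ?E] generate_factors[OF M] by simp
  then have "N \<lhd> subgrp P A"
    unfolding normal_subgrp_iff[OF subgroup_A] using N MA by blast
  then show "N = carrier (subgrp P M) \<or> N = {\<one>\<^bsub>subgrp P M\<^esub>}"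
    using M N(2) unfolding minimal_normal_def by fastforce
qed

text \<open>The factors are enumerated and adjoined one at a time. Each new one commutes with the
  product of the earlier ones and meets it trivially, and by conjugacy it is a copy of the fixed
  factor \<open>M\<close>.\<close>

theorem direct_power:
  assumes fin: "finite A"
  obtains M l where "M \<subseteq> A" "simple_group (subgrp P M)" "\<not> comm_group (subgrp P M)" "1 \<le> l"
    "subgrp P A \<cong> power_group (subgrp P M) l"
proof -
  interpret A: group "subgrp P A" by (rule group_A)
  have "A \<noteq> {\<one>}" using minimal by (simp add: minimal_normal_def)
  then obtain M where M: "M \<in> factors"
    using finite_minimal_normal_exists[OF group_A] fin by auto
  have "factors \<subseteq> Pow A"
    using factor_subgroup by blast
  then have "finite factors"
    using fin by (meson finite_Pow_iff finite_subset)
  then obtain F l where F: "bij_betw F {..<l::nat} factors"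
    by (metis ex_bij_betw_nat_finite lessThan_atLeast0)
  let ?T = "subgrp P M" and ?U = "\<lambda>k. generate P (\<Union>i<k. F i)"
  have TT: "group ?T" using factor_subgroup[OF M] by (simp add: subgroup_imp_group)
  have Ff: "F i \<in> factors" if "i < l" for i
    using F that by (auto simp: bij_betw_def)
  have Fn: "F i \<noteq> F j" if "i < l" "j < l" "i \<noteq> j" for i j
    using F that by (auto simp: bij_betw_def inj_on_def)
  have UA: "(\<Union>i<k. F i) \<subseteq> A" "?U k \<subseteq> A" if "k \<le> l" for k
  proof -
    show "(\<Union>i<k. F i) \<subseteq> A"
    proof (rule UN_least)
      fix i assume "i \<in> {..<k}"
      then show "F i \<subseteq> A" using factor_subgroup[OF Ff, of i] that by simp
    qed
    then show "?U k \<subseteq> A"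
      using subgroup_A by (rule generate_subgroup_incl)
  qed
  have U: "subgroup (?U k) P" if "k \<le> l" for k
    using UA(1)[OF that] A_carrier by (intro generate_is_subgroup) auto
  have "subgrp P (?U k) \<cong> power_group ?T k" if "k \<le> l" for k
    using that
  proof (induction k)
    case 0
    have "?U 0 = {\<one>}"
      by (simp add: generate_empty)
    \<comment> \<open>Both groups have one element; in the empty power it is the function that is
      \<open>undefined\<close> everywhere.\<close>
    then show ?case
      by (intro is_isoI[where h = "\<lambda>_ _. undefined"] isoI homI) (auto simp: bij_betw_def fun_eq_iff)
  next
    case (Suc k)
    then have k: "k < l" "k \<le> l" by auto
    have Fk: "subgroup (F k) P" "F k \<subseteq> A"
      using factor_subgroup[OF Ff[OF k(1)]] by auto
    have comm: "x \<otimes> u = u \<otimes> x" if "x \<in> F k" "u \<in> ?U k" for x u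
    proof (rule generate_commute[OF _ _ _ that(2)])
      show "(\<Union>i<k. F i) \<subseteq> carrier P" using UA(1)[OF k(2)] A_carrier by blast
      show "x \<in> carrier P" using that(1) Fk A_carrier by blast
      show "x \<otimes> s = s \<otimes> x" if s: "s \<in> (\<Union>i<k. F i)" for s
      proof -
        obtain i where i: "i < k" "s \<in> F i"
          using s by auto
        then show ?thesis
          using k \<open>x \<in> F k\<close> by (intro factors_commute[OF Ff[of k] Ff[of i] Fn]) auto
      qed
    qed
    \<comment> \<open>Lying in \<open>?U k\<close>, such an \<open>x\<close> commutes with
      \<open>F k\<close>; lying in \<open>F k\<close>, it commutes with every other factor. So it is
      central in \<open>A\<close>.\<close>
    have "x = \<one>" if x: "x \<in> ?U k" "x \<in> F k" for x
    proof (rule central_of_factors[OF _ _ M])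
      show "x \<in> A" using x Fk by blast
      show "x \<otimes> y = y \<otimes> x" if "N \<in> factors" "y \<in> N" for N y
        using that x comm factors_commute[OF Ff[OF k(1)] that(1)] by (cases "N = F k") auto
    qed
    then have triv: "?U k \<inter> F k = {\<one>}"
      using subgroup.one_closed[OF U[OF k(2)]] subgroup.one_closed[OF Fk(1)] by blast
    have eq: "?U k <#> F k = ?U (Suc k)"
    proof (rule generateI)
      \<comment> \<open>\<open>F k\<close> need not be normal in \<open>P\<close>, but it is in
        \<open>A\<close>, so the product is formed there. The normal factor stands on the left in
        that theory, whence the exchange of the two factors.\<close>
      interpret second_isomorphism_grp "F k" "subgrp P A" "?U k"
        using Ff[OF k(1)] subgroup_incl[OF U[OF k(2)] subgroup_A UA(2)[OF k(2)]]
        by (simp add: second_isomorphism_grp_def second_isomorphism_grp_axioms_def minimal_normal_def)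
      have "?U k <#> F k = F k <#> ?U k"
      proof (intro equalityI subsetI)
        fix z assume "z \<in> ?U k <#> F k"
        then obtain u x where "u \<in> ?U k" "x \<in> F k" "z = u \<otimes> x"
          unfolding set_mult_def by blast
        then have "z = x \<otimes> u" "u \<in> ?U k" "x \<in> F k"
          using comm by simp_all
        then show "z \<in> F k <#> ?U k"
          unfolding set_mult_def by blast
      next
        fix z assume "z \<in> F k <#> ?U k"
        then obtain u x where "u \<in> ?U k" "x \<in> F k" "z = x \<otimes> u"
          unfolding set_mult_def by blast
        then have "z = u \<otimes> x" "u \<in> ?U k" "x \<in> F k"
          using comm by simp_all
        then show "z \<in> ?U k <#> F k"
          unfolding set_mult_def by blast
      qed
      then show "subgroup (?U k <#> F k) P"
        using normal_set_mult_subgroup incl_subgroup[OF subgroup_A] by simp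
      have *: "?U k \<subseteq> ?U k <#> F k" "F k \<subseteq> ?U k <#> F k"
        using H_contained_in_set_mult S_contained_in_set_mult \<open>?U k <#> F k = F k <#> ?U k\<close> by auto
      have "(\<Union>i<k. F i) \<subseteq> ?U k"
        by (rule subsetI) (rule generate.incl)
      then show "(\<Union>i<Suc k. F i) \<subseteq> ?U k <#> F k"
        using * by (simp add: lessThan_Suc)
      fix K assume K: "subgroup K P" "(\<Union>i<Suc k. F i) \<subseteq> K"
      have "?U k \<subseteq> K"
        by (rule generate_subgroup_incl[OF _ K(1)]) (use K(2) in \<open>simp add: lessThan_Suc\<close>)
      moreover have "F k \<subseteq> K"
        using K(2) by (simp add: lessThan_Suc)
      ultimately show "?U k <#> F k \<subseteq> K"
        using K(1) by (auto simp: set_mult_def subset_iff subgroup.m_closed)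
    qed
    have "subgrp P (?U (Suc k)) \<cong> subgrp P (?U k) \<times>\<times> subgrp P (F k)"
      using commuting_set_mult_iso[OF U[OF k(2)] Fk(1) triv] comm eq
        group.iso_sym[OF DirProd_group] subgroup_imp_group[OF Fk(1)] subgroup_imp_group[OF U[OF k(2)]]
      by metis
    also have "\<dots> \<cong> power_group ?T k \<times>\<times> ?T"
      using group.DirProd_iso_trans[OF subgroup_imp_group[OF U[OF k(2)]] Suc.IH[OF k(2)]
          factors_iso[OF Ff[OF k(1)] M]] .
    also have "\<dots> \<cong> power_group ?T (Suc k)"
      using group.iso_sym[OF group.power_group_group[OF TT] power_group_Suc] .
    finally show ?case .
  qed
  moreover have "?U l = A"
    using generate_factors[OF M] F by (simp add: bij_betw_def)
  ultimately have iso: "subgrp P A \<cong> power_group ?T l"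
    by (metis order_refl)
  have "l \<noteq> 0"
    using F M by (auto simp: bij_betw_def)
  then show ?thesis
    using that[of M l] iso factor_simple[OF M fin] factor_not_comm[OF M] factor_subgroup[OF M] by simp
qed

end

section \<open>Powers of a non-abelian simple group\<close>

text \<open>The set whose right translations form \<open>factor\<close>, kept apart so that it can
  be studied inside the abstract power before any action is considered.\<close>

definition coord_subgroup :: "('a, 'b) monoid_scheme \<Rightarrow> nat \<Rightarrow> nat \<Rightarrow> (nat \<Rightarrow> 'a) set"
  where "coord_subgroup T k i =
    {f \<in> carrier (power_group T k). \<forall>j<k. j \<noteq> i \<longrightarrow> f j = \<one>\<^bsub>T\<^esub>}"

definition coord_embed :: "('a, 'b) monoid_scheme \<Rightarrow> nat \<Rightarrow> nat \<Rightarrow> 'a \<Rightarrow> nat \<Rightarrow> 'a"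
  where "coord_embed T k i t = (\<lambda>j\<in>{..<k}. if j = i then t else \<one>\<^bsub>T\<^esub>)"

lemma coord_embed_iso:
  assumes T: "group T" and i: "i < k"
  shows "coord_embed T k i \<in> iso T (subgrp (power_group T k) (coord_subgroup T k i))"
proof (rule isoI, rule homI)
  interpret group T by (rule T)
  show "coord_embed T k i t \<in> carrier (subgrp (power_group T k) (coord_subgroup T k i))"
    if "t \<in> carrier T" for t
    using that i by (auto simp: coord_embed_def coord_subgroup_def)
  show "coord_embed T k i (s \<otimes>\<^bsub>T\<^esub> t) =
      coord_embed T k i s \<otimes>\<^bsub>subgrp (power_group T k) (coord_subgroup T k i)\<^esub> coord_embed T k i t"
    if "s \<in> carrier T" "t \<in> carrier T" for s t
    using that by (auto simp: coord_embed_def fun_eq_iff)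
  show "bij_betw (coord_embed T k i) (carrier T)
      (carrier (subgrp (power_group T k) (coord_subgroup T k i)))"
  proof (rule bij_betw_byWitness[where f' = "\<lambda>f. f i"])
    show "\<forall>t\<in>carrier T. coord_embed T k i t i = t"
      using i by (simp add: coord_embed_def)
    show "\<forall>f\<in>carrier (subgrp (power_group T k) (coord_subgroup T k i)). coord_embed T k i (f i) = f"
      by (auto simp: coord_embed_def coord_subgroup_def fun_eq_iff PiE_iff extensional_def)
    show "coord_embed T k i ` carrier T
        \<subseteq> carrier (subgrp (power_group T k) (coord_subgroup T k i))"
      using i by (auto simp: coord_embed_def coord_subgroup_def split: if_splits)
    show "(\<lambda>f. f i) ` carrier (subgrp (power_group T k) (coord_subgroup T k i)) \<subseteq> carrier T"
      using i by (auto simp: coord_subgroup_def)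
  qed
qed

lemma coord_subgroup_normal:
  assumes T: "group T"
  shows "coord_subgroup T k i \<lhd> power_group T k"
proof -
  interpret group T by (rule T)
  interpret P: group "power_group T k" by simp
  show ?thesis
  proof (rule P.normal_invI)
    show "subgroup (coord_subgroup T k i) (power_group T k)"
    proof (rule P.subgroupI)
      show "coord_subgroup T k i \<noteq> {}"
        by (auto simp: coord_subgroup_def split: if_splits intro!: exI[of _ "\<lambda>j\<in>{..<k}. \<one>\<^bsub>T\<^esub>"])
    qed (auto simp: coord_subgroup_def PiE_iff extensional_def)
    show "f \<otimes>\<^bsub>power_group T k\<^esub> g \<otimes>\<^bsub>power_group T k\<^esub> inv\<^bsub>power_group T k\<^esub> f \<in> coord_subgroup T k i"
      if "f \<in> carrier (power_group T k)" "g \<in> coord_subgroup T k i" for f g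
      using that by (auto simp: coord_subgroup_def PiE_iff)
  qed
qed

text \<open>A normal subgroup of the power lying in the coordinate subgroup is normal in the latter,
  which is simple as a copy of \<open>T\<close>.\<close>

lemma coord_subgroup_minimal_normal:
  assumes T: "simple_group T" and i: "i < k"
  shows "minimal_normal (power_group T k) (coord_subgroup T k i)"
proof -
  interpret T: simple_group T by (rule T)
  interpret P: group "power_group T k" by simp
  let ?C = "coord_subgroup T k i"
  have C: "?C \<lhd> power_group T k"
    using T.group_axioms by (rule coord_subgroup_normal)
  then have sub: "subgroup ?C (power_group T k)"
    by (rule normal_imp_subgroup)
  have "simple_group (subgrp (power_group T k) ?C)"
    using T.iso_simple[OF P.subgroup_imp_group[OF sub] coord_embed_iso[OF T.group_axioms i]] .
  then interpret C: simple_group "subgrp (power_group T k) ?C" .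
  have "N = {\<one>\<^bsub>power_group T k\<^esub>} \<or> N = ?C" if "N \<lhd> power_group T k" "N \<subseteq> ?C" for N
    using C.no_real_normal_subgroup[OF P.normal_restrict_supergroup[OF sub that]] by auto
  then show ?thesis
    using C C.simple_not_triv unfolding minimal_normal_def by auto
qed

text \<open>Distinct minimal normal subgroups commute. If \<open>M\<close> were none of the
  coordinate subgroups, every coordinate of every element of \<open>M\<close> would be central in
  \<open>T\<close>, and \<open>M\<close> would be trivial.\<close>

lemma minimal_normal_power_group:
  assumes T: "simple_group T" "\<not> comm_group T" and M: "minimal_normal (power_group T k) M"
  shows "\<exists>i<k. M = coord_subgroup T k i"
proof (rule ccontr)
  interpret T: simple_group T by (rule T)
  interpret P: group "power_group T k" by simp
  assume "\<not> ?thesis"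
  then have no: "M \<noteq> coord_subgroup T k i" if "i < k" for i
    using that by blast
  have sub: "subgroup M (power_group T k)"
    using M by (simp add: minimal_normal_def normal_imp_subgroup)
  have "f = \<one>\<^bsub>power_group T k\<^esub>" if f: "f \<in> M" for f
  proof -
    have fc: "f \<in> carrier (power_group T k)"
      using subgroup.mem_carrier[OF sub f] .
    have "f i = \<one>\<^bsub>T\<^esub>" if i: "i < k" for i
    \<comment> \<open>\<open>T\<close> is a minimal normal subgroup of itself, so the result on
      centres shows that \<open>T\<close> has trivial centre.\<close>
    proof (rule minimal_normal_center[OF T.group_axioms simple_group_minimal_normal[OF T(1)]])
      show "\<exists>x\<in>carrier T. \<exists>y\<in>carrier T. x \<otimes>\<^bsub>T\<^esub> y \<noteq> y \<otimes>\<^bsub>T\<^esub> x"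
        using T.group_comm_groupI T(2) by blast
      show "f i \<in> carrier T"
        using fc i by auto
      fix t assume t: "t \<in> carrier T"
      have "coord_embed T k i t \<in> coord_subgroup T k i"
        using coord_embed_iso[OF T.group_axioms i] t by (auto simp: iso_def hom_def)
      then have "f \<otimes>\<^bsub>power_group T k\<^esub> coord_embed T k i t = coord_embed T k i t \<otimes>\<^bsub>power_group T k\<^esub> f"
        using minimal_normal_commute[OF P.group_axioms M coord_subgroup_minimal_normal[OF T(1) i]
            no[OF i] f] by blast
      then have "(f \<otimes>\<^bsub>power_group T k\<^esub> coord_embed T k i t) i =
          (coord_embed T k i t \<otimes>\<^bsub>power_group T k\<^esub> f) i"
        by (rule arg_cong)
      then show "f i \<otimes>\<^bsub>T\<^esub> t = t \<otimes>\<^bsub>T\<^esub> f i"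
        using i by (simp add: coord_embed_def)
    qed
    then show ?thesis
      using fc by (auto simp: fun_eq_iff PiE_iff extensional_def)
  qed
  then have "M = {\<one>\<^bsub>power_group T k\<^esub>}"
    using subgroup.one_closed[OF sub] by blast
  then show False
    using M by (simp add: minimal_normal_def)
qed

lemma minimal_normals_power_group:
  assumes "simple_group T" "\<not> comm_group T"
  shows "{M. minimal_normal (power_group T k) M} = coord_subgroup T k ` {..<k}"
  using minimal_normal_power_group[OF assms] coord_subgroup_minimal_normal[OF assms(1)] by auto

lemma card_minimal_normals_power_group:
  assumes T: "simple_group T" "\<not> comm_group T"
  shows "card {M. minimal_normal (power_group T k) M} = k"
proof -
  interpret T: simple_group T by (rule T)
  obtain t where t: "t \<in> carrier T" "t \<noteq> \<one>\<^bsub>T\<^esub>"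
    using T.simple_not_triv T.one_closed by blast
  have "inj_on (coord_subgroup T k) {..<k}"
  proof (rule inj_onI, rule ccontr)
    fix i j assume ij: "i \<in> {..<k}" "j \<in> {..<k}" "coord_subgroup T k i = coord_subgroup T k j" "i \<noteq> j"
    have "coord_embed T k i t \<in> coord_subgroup T k i" "coord_embed T k i t \<notin> coord_subgroup T k j"
      using ij(1,4) t by (auto simp: coord_subgroup_def coord_embed_def)
    then show False
      using ij(3) by blast
  qed
  then show ?thesis
    by (simp add: minimal_normals_power_group[OF T] card_image)
qed

text \<open>The exponent is the number of minimal normal subgroups, and any one of them is a copy of
  the base group; \<open>0 < k\<close> guarantees that there is one to compare.\<close>

lemma power_group_iso_unique:
  assumes T: "simple_group T" "\<not> comm_group T" and T': "simple_group T'" "\<not> comm_group T'"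
    and iso: "power_group T k \<cong> power_group T' k'" and k: "0 < k"
  shows "k = k'" "T \<cong> T'"
proof -
  interpret T: simple_group T by (rule T)
  interpret T': simple_group T' by (rule T')
  interpret P: group "power_group T k" by simp
  interpret P': group "power_group T' k'" by simp
  obtain \<phi> where \<phi>: "\<phi> \<in> iso (power_group T k) (power_group T' k')"
    using iso by (auto simp: is_iso_def)
  \<comment> \<open>Taking images under \<open>\<phi>\<close> must be injective on subgroups for
    their number to be preserved.\<close>
  have "inj_on (image \<phi>) {M. minimal_normal (power_group T k) M}"
  proof (rule inj_on_subset)
    show "inj_on (image \<phi>) (Pow (carrier (power_group T k)))"
      using \<phi> by (intro inj_on_image_Pow) (auto simp: iso_def bij_betw_def)
    show "{M. minimal_normal (power_group T k) M} \<subseteq> Pow (carrier (power_group T k))"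
      using minimal_normals_power_group[OF T] by (auto simp: coord_subgroup_def)
  qed
  then show "k = k'"
    using card_image minimal_normals_iso[OF \<phi> P.group_axioms P'.group_axioms]
      card_minimal_normals_power_group[OF T] card_minimal_normals_power_group[OF T'] by metis
  let ?C = "coord_subgroup T k 0"
  have C: "minimal_normal (power_group T k) ?C"
    using coord_subgroup_minimal_normal[OF T(1) k] .
  then obtain j where j: "j < k'" "\<phi> ` ?C = coord_subgroup T' k' j"
    using minimal_normal_iso[OF \<phi> P.group_axioms P'.group_axioms]
      minimal_normal_power_group[OF T'] by blast
  have "T \<cong> subgrp (power_group T k) ?C"
    using coord_embed_iso[OF T.group_axioms k] by (rule is_isoI)
  also have "\<dots> \<cong> subgrp (power_group T' k') (coord_subgroup T' k' j)"
    using iso_subgrp[OF \<phi>, of ?C] j(2) by (auto simp: coord_subgroup_def intro: is_isoI)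
  also have "\<dots> \<cong> T'"
    using T'.iso_sym[OF is_isoI[OF coord_embed_iso[OF T'.group_axioms j(1)]]] .
  finally show "T \<cong> T'" .
qed

section \<open>Permutation groups\<close>

lemma carrier_BijGroup [simp]: "carrier (BijGroup S) = Bij S"
  by (simp add: BijGroup_def)

lemma one_BijGroup_apply [simp]: "x \<in> S \<Longrightarrow> \<one>\<^bsub>BijGroup S\<^esub> x = x"
  by (simp add: BijGroup_def)

lemma Bij_closed: "f \<in> Bij S \<Longrightarrow> x \<in> S \<Longrightarrow> f x \<in> S"
  using Bij_imp_funcset by fastforce

lemma mult_BijGroup_apply:
  "f \<in> Bij S \<Longrightarrow> g \<in> Bij S \<Longrightarrow> x \<in> S \<Longrightarrow> (f \<otimes>\<^bsub>BijGroup S\<^esub> g) x = f (g x)"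
  by (simp add: BijGroup_def compose_eq)

lemma inv_BijGroup_closed: "f \<in> Bij S \<Longrightarrow> inv\<^bsub>BijGroup S\<^esub> f \<in> Bij S"
  using group.inv_closed[OF group_BijGroup] by (metis carrier_BijGroup)

lemma mult_BijGroup_closed: "f \<in> Bij S \<Longrightarrow> g \<in> Bij S \<Longrightarrow> f \<otimes>\<^bsub>BijGroup S\<^esub> g \<in> Bij S"
  using monoid.m_closed[OF group.is_monoid[OF group_BijGroup]] by (metis carrier_BijGroup)

lemma inv_BijGroup_apply:
  assumes "f \<in> Bij S" "x \<in> S"
  shows "(inv\<^bsub>BijGroup S\<^esub> f) (f x) = x" "f ((inv\<^bsub>BijGroup S\<^esub> f) x) = x"
  using group.l_inv[OF group_BijGroup, of f S] group.r_inv[OF group_BijGroup, of f S]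
    mult_BijGroup_apply[of f S "inv\<^bsub>BijGroup S\<^esub> f" x]
    mult_BijGroup_apply[of "inv\<^bsub>BijGroup S\<^esub> f" S f x] inv_BijGroup_closed[of f S] assms
  by simp_all

lemma Bij_eqI:
  assumes "f \<in> Bij S" "g \<in> Bij S" "\<And>x. x \<in> S \<Longrightarrow> f x = g x"
  shows "f = g"
  using assms by (intro extensionalityI[of f S g]) (auto simp: Bij_def)

lemma subgroup_Bij: "subgroup N (BijGroup S) \<Longrightarrow> g \<in> N \<Longrightarrow> g \<in> Bij S"
  using subgroup.mem_carrier by fastforce

lemma group_action_perm_group:
  assumes "subgroup N (BijGroup S)"
  shows "group_action (perm_group S N) S id"
  using group.subgroup_imp_group[OF group_BijGroup assms] group_BijGroup[of S] subgroup.subset[OF assms]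
  by (auto simp: group_action_def group_hom_def group_hom_axioms_def hom_def)

text \<open>The subgroup condition is part of \<open>transitive\<close>, because an action
  presupposes that \<open>perm_group S N\<close> is a group mapped into
  \<open>BijGroup S\<close>.\<close>

lemma transitive_iff:
  "transitive S N \<longleftrightarrow> subgroup N (BijGroup S) \<and> (\<forall>x\<in>S. \<forall>y\<in>S. \<exists>g\<in>N. g x = y)"
proof
  assume "transitive S N"
  then interpret transitive_action "perm_group S N" S id
    by (simp add: transitive_def)
  have "N \<subseteq> Bij S"
    using bij_prop0 by auto
  moreover have "group (perm_group S N)"
    using group_hom by (simp add: group_hom_def)
  ultimately have "subgroup N (BijGroup S)"
    using group.group_incl_imp_subgroup[OF group_BijGroup] by simp
  then show "subgroup N (BijGroup S) \<and> (\<forall>x\<in>S. \<forall>y\<in>S. \<exists>g\<in>N. g x = y)"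
    using unique_orbit by simp
next
  assume *: "subgroup N (BijGroup S) \<and> (\<forall>x\<in>S. \<forall>y\<in>S. \<exists>g\<in>N. g x = y)"
  then show "transitive S N"
    unfolding transitive_def transitive_action_def transitive_action_axioms_def
    using group_action_perm_group[of N S] by simp
qed

lemma semiregularD:
  "semiregular S N \<Longrightarrow> g \<in> N \<Longrightarrow> x \<in> S \<Longrightarrow> g x = x \<Longrightarrow> g = \<one>\<^bsub>BijGroup S\<^esub>"
  by (auto simp: semiregular_def stabilizer_def)

lemma semiregular_eqI:
  assumes "semiregular S N" and N: "subgroup N (BijGroup S)" and gh: "g \<in> N" "h \<in> N"
    and x: "x \<in> S" "g x = h x"
  shows "g = h"
proof -
  interpret group "BijGroup S" by (rule group_BijGroup)
  have B: "g \<in> Bij S" "h \<in> Bij S"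
    using subgroup_Bij[OF N] gh by auto
  have "(inv\<^bsub>BijGroup S\<^esub> h \<otimes>\<^bsub>BijGroup S\<^esub> g) x = x"
    using B x by (simp add: mult_BijGroup_apply inv_BijGroup_closed inv_BijGroup_apply)
  moreover have "inv\<^bsub>BijGroup S\<^esub> h \<otimes>\<^bsub>BijGroup S\<^esub> g \<in> N"
    using N gh by (simp add: subgroup.m_closed subgroup.m_inv_closed)
  ultimately have "inv\<^bsub>BijGroup S\<^esub> h \<otimes>\<^bsub>BijGroup S\<^esub> g = \<one>\<^bsub>BijGroup S\<^esub>"
    using assms(1) x(1) by (auto intro: semiregularD)
  then show ?thesis
    using B inv_solve_left'[of "\<one>\<^bsub>BijGroup S\<^esub>" h g] one_closed by simp
qed

text \<open>If \<open>a\<close> in \<open>N\<close> takes \<open>x\<close> to \<open>y\<close>, then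
  \<open>p y = p (a x) = a (p x) = a x = y\<close>. In other words, the centraliser of a transitive
  group is semiregular.\<close>

lemma commuting_transitive_fixes:
  assumes N: "transitive S N" and p: "p \<in> Bij S"
    and comm: "\<And>a. a \<in> N \<Longrightarrow> p \<otimes>\<^bsub>BijGroup S\<^esub> a = a \<otimes>\<^bsub>BijGroup S\<^esub> p"
    and x: "x \<in> S" "p x = x"
  shows "p = \<one>\<^bsub>BijGroup S\<^esub>"
proof (rule Bij_eqI[OF p])
  interpret group "BijGroup S" by (rule group_BijGroup)
  show "\<one>\<^bsub>BijGroup S\<^esub> \<in> Bij S"
    using one_closed by simp
  fix y assume y: "y \<in> S"
  then obtain a where a: "a \<in> N" "a x = y"
    using N x(1) by (auto simp: transitive_iff)
  then have "a \<in> Bij S"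
    using N subgroup_Bij by (auto simp: transitive_iff)
  then have "p (a x) = a (p x)"
    using fun_cong[OF comm[OF a(1)], of x] x(1) p by (simp add: mult_BijGroup_apply)
  then show "p y = \<one>\<^bsub>BijGroup S\<^esub> y"
    using a x y by simp
qed

section \<open>Orbits of a subgroup, and of a normal subgroup as a system of blocks\<close>

definition orb :: "('a \<Rightarrow> 'a) set \<Rightarrow> 'a \<Rightarrow> 'a set"
  where "orb N x = (\<lambda>n. n x) ` N"

lemma orbit_set_eq: "orbit_set S N = orb N ` S"
  by (auto simp: orbits_def orbit_def orb_def)

lemma orbI: "n \<in> N \<Longrightarrow> n x \<in> orb N x"
  by (simp add: orb_def)

context
  fixes S :: "'a set" and N :: "('a \<Rightarrow> 'a) set"
  assumes N: "subgroup N (BijGroup S)"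
begin

interpretation group "BijGroup S" by (rule group_BijGroup)

lemma orb_self: "x \<in> S \<Longrightarrow> x \<in> orb N x"
  using orbI[OF subgroup.one_closed[OF N], of x] by simp

lemma orb_subset: "x \<in> S \<Longrightarrow> orb N x \<subseteq> S"
  by (auto simp: orb_def intro: Bij_closed subgroup_Bij[OF N])

lemma orb_eq:
  assumes m: "m \<in> N" and x: "x \<in> S"
  shows "orb N (m x) = orb N x"
proof
  have mB: "m \<in> Bij S" using subgroup_Bij[OF N m] .
  show "orb N (m x) \<subseteq> orb N x"
  proof
    fix y assume "y \<in> orb N (m x)"
    then obtain n where n: "n \<in> N" "y = n (m x)" by (auto simp: orb_def)
    then have "y = (n \<otimes>\<^bsub>BijGroup S\<^esub> m) x"
      using x mB subgroup_Bij[OF N n(1)] by (simp add: mult_BijGroup_apply)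
    then show "y \<in> orb N x"
      using orbI[OF subgroup.m_closed[OF N n(1) m]] by simp
  qed
  show "orb N x \<subseteq> orb N (m x)"
  proof
    fix y assume "y \<in> orb N x"
    then obtain n where n: "n \<in> N" "y = n x" by (auto simp: orb_def)
    have "(n \<otimes>\<^bsub>BijGroup S\<^esub> inv\<^bsub>BijGroup S\<^esub> m) (m x) = n x"
      using x mB subgroup_Bij[OF N n(1)]
      by (simp add: mult_BijGroup_apply inv_BijGroup_closed inv_BijGroup_apply Bij_closed)
    then show "y \<in> orb N (m x)"
      using orbI[OF subgroup.m_closed[OF N n(1) subgroup.m_inv_closed[OF N m]], of "m x"] n(2) by simp
  qed
qed

lemma orb_eq_iff: "x \<in> S \<Longrightarrow> y \<in> S \<Longrightarrow> orb N x = orb N y \<longleftrightarrow> y \<in> orb N x"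
  using orb_self[of y] orb_eq[of _ x] by (auto simp: orb_def[of N x])

lemma orb_partition: "partition_on S (orb N ` S)"
proof (rule partition_onI)
  show "\<Union>(orb N ` S) = S" using orb_self orb_subset by blast
  show "{} \<notin> orb N ` S" using orb_self by blast
  show "disjnt X Y" if XY: "X \<in> orb N ` S" "Y \<in> orb N ` S" "X \<noteq> Y" for X Y
  proof (rule ccontr)
    obtain x y where xy: "x \<in> S" "X = orb N x" "y \<in> S" "Y = orb N y" using XY by blast
    assume "\<not> disjnt X Y"
    then obtain z where "z \<in> X" "z \<in> Y" by (auto simp: disjnt_def)
    then have "X = Y"
      using xy orb_eq_iff[of x z] orb_eq_iff[of y z] orb_subset[of x] by blast
    then show False using XY(3) by simp
  qed
qed

end

text \<open>The point \<open>p (n x)\<close> is the image of \<open>p x\<close> under the conjugate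
  of \<open>n\<close> by \<open>p\<close>, and \<open>N\<close> is closed under such
  conjugation.\<close>

lemma orb_image:
  assumes P: "subgroup P (BijGroup S)" and N: "N \<lhd> perm_group S P" and p: "p \<in> P" and x: "x \<in> S"
  shows "p ` orb N x = orb N (p x)"
proof
  interpret group "BijGroup S" by (rule group_BijGroup)
  have sub: "subgroup N (BijGroup S)"
    and conj: "\<And>p m. p \<in> P \<Longrightarrow> m \<in> N \<Longrightarrow> p \<otimes>\<^bsub>BijGroup S\<^esub> m \<otimes>\<^bsub>BijGroup S\<^esub> inv\<^bsub>BijGroup S\<^esub> p \<in> N"
    using N by (auto simp: normal_subgrp_iff[OF P])
  have pB: "p \<in> Bij S" and ip: "inv\<^bsub>BijGroup S\<^esub> p \<in> P"
    using subgroup_Bij[OF P p] subgroup.m_inv_closed[OF P p] by auto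
  show "p ` orb N x \<subseteq> orb N (p x)"
  proof
    fix y assume "y \<in> p ` orb N x"
    then obtain m where m: "m \<in> N" "y = p (m x)" by (auto simp: orb_def)
    have "(p \<otimes>\<^bsub>BijGroup S\<^esub> m \<otimes>\<^bsub>BijGroup S\<^esub> inv\<^bsub>BijGroup S\<^esub> p) (p x) = p (m x)"
      using pB subgroup_Bij[OF sub m(1)] x
      by (simp add: mult_BijGroup_apply inv_BijGroup_closed inv_BijGroup_apply mult_BijGroup_closed Bij_closed)
    then show "y \<in> orb N (p x)"
      using orbI[OF conj[OF p m(1)], of "p x"] m(2) by simp
  qed
  show "orb N (p x) \<subseteq> p ` orb N x"
  proof
    fix y assume "y \<in> orb N (p x)"
    then obtain m where m: "m \<in> N" "y = m (p x)" by (auto simp: orb_def)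
    have "inv\<^bsub>BijGroup S\<^esub> p \<otimes>\<^bsub>BijGroup S\<^esub> m \<otimes>\<^bsub>BijGroup S\<^esub> p \<in> N"
      using conj[OF ip m(1)] pB by simp
    then have "p ((inv\<^bsub>BijGroup S\<^esub> p \<otimes>\<^bsub>BijGroup S\<^esub> m \<otimes>\<^bsub>BijGroup S\<^esub> p) x) \<in> p ` orb N x"
      by (intro imageI orbI)
    moreover have "p ((inv\<^bsub>BijGroup S\<^esub> p \<otimes>\<^bsub>BijGroup S\<^esub> m \<otimes>\<^bsub>BijGroup S\<^esub> p) x) = m (p x)"
      using pB subgroup_Bij[OF sub m(1)] x
      by (simp add: mult_BijGroup_apply inv_BijGroup_closed inv_BijGroup_apply mult_BijGroup_closed Bij_closed)
    ultimately show "y \<in> p ` orb N x"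
      using m(2) by simp
  qed
qed

text \<open>The orbits of \<open>M\<close> form an invariant partition. If they were all singletons,
  every element of \<open>M\<close> would fix every point, so primitivity leaves a single
  orbit.\<close>

lemma primitive_normal_transitive:
  assumes P: "subgroup P (BijGroup S)" and prim: "primitive S P"
    and M: "M \<lhd> perm_group S P" and nontriv: "M \<noteq> {\<one>\<^bsub>BijGroup S\<^esub>}"
  shows "transitive S M"
proof -
  interpret group "BijGroup S" by (rule group_BijGroup)
  have sub: "subgroup M (BijGroup S)"
    using M by (simp add: normal_subgrp_iff[OF P])
  have "p ` X \<in> orb M ` S" if p: "p \<in> P" and X: "X \<in> orb M ` S" for p X
  proof -
    obtain x where x: "x \<in> S" "X = orb M x" using X by blast
    then show ?thesis
      using orb_image[OF P M p] Bij_closed[OF subgroup_Bij[OF P p]] by simp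
  qed
  then have *: "orb M ` S = {S} \<or> orb M ` S = (\<lambda>x. {x}) ` S"
    using prim orb_partition[OF sub] by (simp add: primitive_def)
  have "orb M ` S \<noteq> (\<lambda>x. {x}) ` S"
  proof
    assume **: "orb M ` S = (\<lambda>x. {x}) ` S"
    have "m = \<one>\<^bsub>BijGroup S\<^esub>" if m: "m \<in> M" for m
    proof (rule Bij_eqI[OF subgroup_Bij[OF sub m]])
      show "\<one>\<^bsub>BijGroup S\<^esub> \<in> Bij S" using one_closed by simp
      fix x assume x: "x \<in> S"
      have "orb M x \<in> (\<lambda>x. {x}) ` S"
        unfolding **[symmetric] using x by (rule imageI)
      then obtain y where "orb M x = {y}"
        by (rule imageE)
      then have "m x = x"
        using orb_self[OF sub x] orbI[OF m, of x] by simp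
      then show "m x = \<one>\<^bsub>BijGroup S\<^esub> x" using x by simp
    qed
    then show False
      using nontriv subgroup.one_closed[OF sub] by blast
  qed
  then have single: "orb M ` S = {S}"
    using * by simp
  have "orb M x = S" if x: "x \<in> S" for x
    using imageI[OF x, of "orb M"] unfolding single by simp
  then show ?thesis
    using sub by (auto simp: transitive_iff orb_def)
qed

text \<open>Transitivity is the conjugacy of the factors. The map \<open>\<phi>\<close> is
  prescribed on the carrier only, so that \<open>conj_action\<close>, whose inverses are taken in
  the full symmetric group, can be substituted.\<close>

lemma (in nonabelian_minimal_normal) conj_transitive_action:
  assumes \<phi>: "\<And>p. p \<in> carrier P \<Longrightarrow> \<phi> p = (\<lambda>F\<in>factors. (\<lambda>n. p \<otimes> n \<otimes> inv p) ` F)"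
  shows "transitive_action P factors \<phi>"
proof -
  let ?c = "\<lambda>p n. p \<otimes> n \<otimes> inv p"
  have Fc: "n \<in> carrier P" if "F \<in> factors" "n \<in> F" for F n
    using factor_subgroup[OF that(1)] that(2) A_carrier by blast
  have comp: "?c p ` ?c q ` F = ?c (p \<otimes> q) ` F"
    if "p \<in> carrier P" "q \<in> carrier P" "F \<in> factors" for p q F
    unfolding image_image
    by (rule image_cong[OF refl]) (use that Fc[OF that(3)] in \<open>simp add: inv_mult_group m_assoc\<close>)
  have one: "?c \<one> ` F = F" if "F \<in> factors" for F
    using Fc[OF that] by simp
  have closed: "?c p ` F \<in> factors" if "p \<in> carrier P" "F \<in> factors" for p F
    using conj_factor[OF that] .
  have Bij: "\<phi> p \<in> Bij factors" if p: "p \<in> carrier P" for p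
  proof -
    have "bij_betw (\<phi> p) factors factors"
    proof (rule bij_betw_byWitness[where f' = "\<phi> (inv p)"])
      show "\<forall>F\<in>factors. \<phi> (inv p) (\<phi> p F) = F"
      proof
        fix F assume F: "F \<in> factors"
        have "\<phi> (inv p) (\<phi> p F) = ?c (inv p) ` ?c p ` F"
          unfolding \<phi>[OF p] \<phi>[OF inv_closed[OF p]]
          using F closed[OF p F] by (simp only: restrict_apply if_True)
        then show "\<phi> (inv p) (\<phi> p F) = F"
          using comp[OF inv_closed[OF p] p F] one[OF F] p by simp
      qed
      show "\<forall>F\<in>factors. \<phi> p (\<phi> (inv p) F) = F"
      proof
        fix F assume F: "F \<in> factors"
        have "\<phi> p (\<phi> (inv p) F) = ?c p ` ?c (inv p) ` F"
          unfolding \<phi>[OF p] \<phi>[OF inv_closed[OF p]]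
          using F closed[OF inv_closed[OF p] F] by (simp only: restrict_apply if_True)
        then show "\<phi> p (\<phi> (inv p) F) = F"
          using comp[OF p inv_closed[OF p] F] one[OF F] p by simp
      qed
      show "\<phi> p ` factors \<subseteq> factors" "\<phi> (inv p) ` factors \<subseteq> factors"
        unfolding \<phi>[OF p] \<phi>[OF inv_closed[OF p]]
        using closed[OF p] closed[OF inv_closed[OF p]] by (simp_all add: image_subset_iff)
    qed
    then show ?thesis
      by (simp add: Bij_def \<phi>[OF p])
  qed
  have mult: "\<phi> (p \<otimes> q) = \<phi> p \<otimes>\<^bsub>BijGroup factors\<^esub> \<phi> q"
    if p: "p \<in> carrier P" and q: "q \<in> carrier P" for p q
  proof (rule Bij_eqI)
    show "\<phi> (p \<otimes> q) \<in> Bij factors" "\<phi> p \<otimes>\<^bsub>BijGroup factors\<^esub> \<phi> q \<in> Bij factors"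
      using p q by (simp_all add: Bij mult_BijGroup_closed)
    fix F assume F: "F \<in> factors"
    have "(\<phi> p \<otimes>\<^bsub>BijGroup factors\<^esub> \<phi> q) F = \<phi> p (\<phi> q F)"
      using Bij p q F by (intro mult_BijGroup_apply)
    also have "\<dots> = ?c p ` ?c q ` F"
      unfolding \<phi>[OF p] \<phi>[OF q] using F closed[OF q F] by (simp only: restrict_apply if_True)
    also have "\<dots> = \<phi> (p \<otimes> q) F"
      unfolding \<phi>[OF m_closed[OF p q]] comp[OF p q F] using F by (simp only: restrict_apply if_True)
    finally show "\<phi> (p \<otimes> q) F = (\<phi> p \<otimes>\<^bsub>BijGroup factors\<^esub> \<phi> q) F" ..
  qed
  show ?thesis
    unfolding transitive_action_def transitive_action_axioms_def group_action_def group_hom_def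
      group_hom_axioms_def
  proof (intro conjI allI impI group_BijGroup group_axioms)
    show "\<phi> \<in> hom P (BijGroup factors)"
      using Bij mult by (intro homI) simp_all
    fix M N assume MN: "M \<in> factors" "N \<in> factors"
    then obtain p where "p \<in> carrier P" "?c p ` M = N"
      using factor_conjugate by blast
    then show "\<exists>p\<in>carrier P. \<phi> p M = N"
      using MN \<phi> by (intro bexI[of _ p]) (simp_all only: restrict_apply if_True)
  qed
qed

section \<open>Primitive groups with two transitive normal subgroups meeting trivially\<close>

text \<open>The setting reached by the images of \<open>L\<close> and \<open>R\<close> on the orbits
  of their intersection. Only \<open>nontrivial\<close> is asymmetric, and \<open>swapped\<close>
  supplies it for \<open>B\<close>.\<close>

locale regular_pair =
  fixes \<Delta> :: "'a set" and P A B :: "('a \<Rightarrow> 'a) set"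
  assumes subgroup_P: "subgroup P (BijGroup \<Delta>)" and primitive: "primitive \<Delta> P"
    and normal_A: "A \<lhd> perm_group \<Delta> P" and normal_B: "B \<lhd> perm_group \<Delta> P"
    and transitive_A: "transitive \<Delta> A" and transitive_B: "transitive \<Delta> B"
    and disjoint: "A \<inter> B = {\<one>\<^bsub>BijGroup \<Delta>\<^esub>}" and nontrivial: "A \<noteq> {\<one>\<^bsub>BijGroup \<Delta>\<^esub>}"
begin

abbreviation mul (infixl "\<cdot>" 70) where "f \<cdot> g \<equiv> f \<otimes>\<^bsub>BijGroup \<Delta>\<^esub> g"
abbreviation binv where "binv f \<equiv> inv\<^bsub>BijGroup \<Delta>\<^esub> f"
abbreviation unit ("\<e>") where "\<e> \<equiv> \<one>\<^bsub>BijGroup \<Delta>\<^esub>"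

sublocale S: group "BijGroup \<Delta>"
  by (rule group_BijGroup)

sublocale PG: group "perm_group \<Delta> P"
  using subgroup_P by (rule S.subgroup_imp_group)

lemmas apply_simps = mult_BijGroup_apply inv_BijGroup_closed mult_BijGroup_closed
  inv_BijGroup_apply Bij_closed

lemma subgroup_A: "subgroup A (BijGroup \<Delta>)" and A_P: "A \<subseteq> P"
  and conj_A: "\<And>p a. p \<in> P \<Longrightarrow> a \<in> A \<Longrightarrow> p \<cdot> a \<cdot> binv p \<in> A"
  using normal_A by (auto simp: S.normal_subgrp_iff[OF subgroup_P])

lemma subgroup_B: "subgroup B (BijGroup \<Delta>)" and B_P: "B \<subseteq> P"
  using normal_B by (auto simp: S.normal_subgrp_iff[OF subgroup_P])

lemma P_Bij: "p \<in> P \<Longrightarrow> p \<in> Bij \<Delta>"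
  using subgroup_P by (rule subgroup_Bij)

lemma A_Bij: "a \<in> A \<Longrightarrow> a \<in> Bij \<Delta>" and B_Bij: "b \<in> B \<Longrightarrow> b \<in> Bij \<Delta>"
  using A_P B_P P_Bij by auto

lemma e_Bij: "\<e> \<in> Bij \<Delta>"
  using S.one_closed by simp

lemma commute: "a \<in> A \<Longrightarrow> b \<in> B \<Longrightarrow> a \<cdot> b = b \<cdot> a"
  using PG.normal_imp_commuting[OF normal_A normal_B] disjoint by simp

text \<open>\<open>A\<close> centralises the transitive group \<open>B\<close>.\<close>

lemma regular_A: "a \<in> A \<Longrightarrow> x \<in> \<Delta> \<Longrightarrow> a x = x \<Longrightarrow> a = \<e>"
  using commuting_transitive_fixes[OF transitive_B A_Bij] commute by blast

lemma A_move:
  assumes "x \<in> \<Delta>" "y \<in> \<Delta>" obtains a where "a \<in> A" "a x = y"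
  using transitive_A assms unfolding transitive_iff by blast

lemma B_move:
  assumes "x \<in> \<Delta>" "y \<in> \<Delta>" obtains b where "b \<in> B" "b x = y"
  using transitive_B assms unfolding transitive_iff by blast

lemma A_eqI:
  assumes a: "a \<in> A" "a' \<in> A" and x: "x \<in> \<Delta>" "a x = a' x"
  shows "a = a'"
proof -
  have "binv a' \<cdot> a = \<e>"
  proof (rule regular_A[OF _ x(1)])
    show "binv a' \<cdot> a \<in> A"
      using a subgroup_A by (simp add: subgroup.m_closed subgroup.m_inv_closed)
    show "(binv a' \<cdot> a) x = x"
      using a x A_Bij by (simp add: apply_simps)
  qed
  then show ?thesis
    using a A_Bij S.inv_solve_left'[of \<e> a' a] S.one_closed by simp
qed

lemma nonempty: "\<exists>x. x \<in> \<Delta>"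
proof (rule ccontr)
  assume "\<not> ?thesis"
  then have "a = \<e>" if "a \<in> A" for a
    using Bij_eqI[OF A_Bij[OF that] e_Bij] by blast
  then show False
    using nontrivial subgroup.one_closed[OF subgroup_A] by blast
qed

text \<open>Choose \<open>b\<close> in \<open>B\<close> agreeing with \<open>p\<close> at
  \<open>x\<close>. Then \<open>binv b \<cdot> p\<close> fixes \<open>x\<close> and still commutes
  with the transitive group \<open>A\<close>, so it is trivial. The element \<open>p\<close> ranges
  over all permutations of \<Delta>, not only those in \<open>P\<close>.\<close>

lemma centralizer_A:
  assumes p: "p \<in> Bij \<Delta>" and comm: "\<And>a. a \<in> A \<Longrightarrow> p \<cdot> a = a \<cdot> p"
  shows "p \<in> B"
proof -
  obtain x where x: "x \<in> \<Delta>" using nonempty by blast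
  obtain b where b: "b \<in> B" "b x = p x"
    using B_move[OF x Bij_closed[OF p x]] .
  have bB: "b \<in> Bij \<Delta>" "binv b \<in> B" "binv b \<in> Bij \<Delta>"
    using b B_Bij subgroup.m_inv_closed[OF subgroup_B] by auto
  have "binv b \<cdot> p = \<e>"
  proof (rule commuting_transitive_fixes[OF transitive_A _ _ x])
    show "binv b \<cdot> p \<in> Bij \<Delta>"
      using bB p by (simp add: apply_simps)
    show "(binv b \<cdot> p) x = x"
      using bB p x by (simp add: apply_simps flip: b(2))
    fix a assume a: "a \<in> A"
    have c: "a \<in> carrier (BijGroup \<Delta>)" "p \<in> carrier (BijGroup \<Delta>)" "binv b \<in> carrier (BijGroup \<Delta>)"
      using a A_Bij p bB by auto
    have "binv b \<cdot> p \<cdot> a = binv b \<cdot> a \<cdot> p"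
      using comm[OF a] c by (simp only: S.m_assoc)
    also have "\<dots> = a \<cdot> binv b \<cdot> p"
      by (simp only: commute[OF a bB(2)])
    also have "\<dots> = a \<cdot> (binv b \<cdot> p)"
      using c by (simp only: S.m_assoc)
    finally show "binv b \<cdot> p \<cdot> a = a \<cdot> (binv b \<cdot> p)" .
  qed
  then have "p = b"
    using p bB S.inv_solve_left'[of \<e> b p] S.one_closed by simp
  then show ?thesis using b by simp
qed

text \<open>An abelian \<open>A\<close> centralises itself and would lie in \<open>B\<close>, which
  it meets trivially.\<close>

lemma nonabelian: "\<exists>x\<in>A. \<exists>y\<in>A. x \<cdot> y \<noteq> y \<cdot> x"
proof (rule ccontr)
  assume "\<not> ?thesis"
  then have "A \<subseteq> B"
    using centralizer_A A_Bij by blast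
  then show False
    using disjoint nontrivial by blast
qed

lemma swapped: "regular_pair \<Delta> P B A"
proof (rule regular_pair.intro)
  show "B \<inter> A = {\<e>}"
    using disjoint by (simp only: Int_commute)
  show "B \<noteq> {\<e>}"
  proof
    assume B: "B = {\<e>}"
    obtain x where x: "x \<in> \<Delta>" using nonempty by blast
    have "a = \<e>" if a: "a \<in> A" for a
    proof (rule regular_A[OF a x])
      obtain b where "b \<in> B" "b x = a x"
        using B_move[OF x Bij_closed[OF A_Bij[OF a] x]] .
      then show "a x = x" using B x by simp
    qed
    then show False
      using nontrivial subgroup.one_closed[OF subgroup_A] by blast
  qed
qed (rule subgroup_P primitive normal_A normal_B transitive_A transitive_B)+

text \<open>A non-trivial normal subgroup of the primitive group \<open>P\<close> is transitive.
  Inside the regular group \<open>A\<close> it must therefore contain the unique element taking one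
  given point to another, which is to say every element of \<open>A\<close>.\<close>

lemma minimal_A: "minimal_normal (perm_group \<Delta> P) A"
  unfolding minimal_normal_def
proof (intro conjI allI impI)
  show "A \<lhd> perm_group \<Delta> P" by (rule normal_A)
  show "A \<noteq> {\<one>\<^bsub>perm_group \<Delta> P\<^esub>}" using nontrivial by simp
  fix N assume N: "N \<lhd> perm_group \<Delta> P \<and> N \<subseteq> A"
  have "A \<subseteq> N" if "N \<noteq> {\<e>}"
  proof
    have tr: "transitive \<Delta> N"
      using primitive_normal_transitive[OF subgroup_P primitive] N that by blast
    obtain x where x: "x \<in> \<Delta>" using nonempty by blast
    fix a assume a: "a \<in> A"
    have "a x \<in> \<Delta>" using a A_Bij x by (simp add: Bij_closed)
    then obtain n where "n \<in> N" "n x = a x"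
      using tr x by (auto simp: transitive_iff)
    then show "a \<in> N"
      using A_eqI[OF _ a x] N by blast
  qed
  then show "N = {\<one>\<^bsub>perm_group \<Delta> P\<^esub>} \<or> N = A"
    using N by auto
qed

sublocale A: nonabelian_minimal_normal "perm_group \<Delta> P" A
  using minimal_A nonabelian by unfold_locales auto

lemma minimal_B: "minimal_normal (perm_group \<Delta> P) B"
  using regular_pair.minimal_A[OF swapped] .

lemma A_neq_B: "A \<noteq> B"
  using disjoint nontrivial by blast

text \<open>A third minimal normal subgroup would commute with \<open>A\<close>, hence lie in its
  centraliser \<open>B\<close>, while also meeting \<open>B\<close> trivially.\<close>

lemma minimal_normals: "{M. minimal_normal (perm_group \<Delta> P) M} = {A, B}"
proof -
  have "M = A \<or> M = B" if M: "minimal_normal (perm_group \<Delta> P) M" for M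
  proof (rule ccontr)
    assume no: "\<not> ?thesis"
    have MP: "M \<subseteq> P" "\<e> \<in> M" "M \<noteq> {\<e>}"
      using M subgroup.one_closed[of M "BijGroup \<Delta>"]
      by (auto simp: minimal_normal_def S.normal_subgrp_iff[OF subgroup_P])
    have "M \<subseteq> B"
    proof
      fix m assume m: "m \<in> M"
      have "m \<cdot> a = a \<cdot> m" if "a \<in> A" for a
        using minimal_normal_commute[OF PG.group_axioms M minimal_A _ m that] no by auto
      then show "m \<in> B"
        using centralizer_A m MP P_Bij by blast
    qed
    then show False
      using minimal_normal_Int[OF PG.group_axioms M minimal_B] no MP by auto
  qed
  then show ?thesis
    using minimal_A minimal_B by blast
qed

lemma socle_eq: "socle (perm_group \<Delta> P) = A <#>\<^bsub>BijGroup \<Delta>\<^esub> B"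
  using PG.set_mult_eq_generate[OF normal_A normal_imp_subgroup[OF normal_B]]
  by (simp add: socle_def minimal_normals)

lemma socle_iso:
  "subgrp (perm_group \<Delta> P) A \<times>\<times> subgrp (perm_group \<Delta> P) B
    \<cong> subgrp (perm_group \<Delta> P) (socle (perm_group \<Delta> P))"
  unfolding socle_eq
  using S.commuting_set_mult_iso[OF subgroup_A subgroup_B disjoint commute] by simp

text \<open>A Frattini argument: \<open>A\<close> is already transitive, so each element of
  \<open>AB\<close> is an element of \<open>A\<close> times one that fixes \<open>x\<close>.
  Regularity of \<open>A\<close> gives the trivial intersection.\<close>

lemma socle_stabilizer_complements:
  assumes x: "x \<in> \<Delta>"
  defines "T \<equiv> stabilizer (subgrp (perm_group \<Delta> P) (socle (perm_group \<Delta> P))) id x"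
  shows "subgroup T (perm_group \<Delta> P)" "A \<inter> T = {\<e>}"
    "A <#>\<^bsub>perm_group \<Delta> P\<^esub> T = A <#>\<^bsub>perm_group \<Delta> P\<^esub> B"
proof -
  let ?AB = "A <#>\<^bsub>BijGroup \<Delta>\<^esub> B"
  have T: "T = {g \<in> ?AB. g x = x}"
    unfolding T_def socle_eq by (simp add: stabilizer_def)
  have AB: "subgroup ?AB (BijGroup \<Delta>)"
    using PG.set_mult_eq_generate[OF normal_A normal_imp_subgroup[OF normal_B]]
      PG.generate_is_subgroup[of "A \<union> B"] A_P B_P S.incl_subgroup[OF subgroup_P] by simp
  have ABP: "?AB \<subseteq> P"
    using A_P B_P subgroup.m_closed[OF subgroup_P] by (auto simp: set_mult_def)
  have T_Bij: "g \<in> Bij \<Delta>" if "g \<in> T" for g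
    using that T AB by (auto intro: subgroup_Bij)
  have "subgroup T (BijGroup \<Delta>)"
  proof (rule S.subgroupI)
    show "T \<subseteq> carrier (BijGroup \<Delta>)" using T_Bij by auto
    show "T \<noteq> {}" using T subgroup.one_closed[OF AB] x by auto
    show "binv g \<in> T" if g: "g \<in> T" for g
    proof -
      have "(binv g) x = (binv g) (g x)" using g T by simp
      also have "\<dots> = x" using T_Bij[OF g] x by (simp add: apply_simps)
      finally show ?thesis using g T subgroup.m_inv_closed[OF AB] by simp
    qed
    show "g \<cdot> h \<in> T" if "g \<in> T" "h \<in> T" for g h
      using that T subgroup.m_closed[OF AB] T_Bij x by (simp add: apply_simps)
  qed
  then show "subgroup T (perm_group \<Delta> P)"
    using S.subgroup_incl[OF _ subgroup_P] T ABP by blast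
  show "A \<inter> T = {\<e>}"
  proof -
    have "\<e> \<in> T"
      using T subgroup.one_closed[OF AB] x by simp
    moreover have "a = \<e>" if "a \<in> A" "a \<in> T" for a
      using regular_A[OF that(1) x] that(2) T by simp
    ultimately show ?thesis
      using subgroup.one_closed[OF subgroup_A] by blast
  qed
  have "?AB \<subseteq> A <#>\<^bsub>BijGroup \<Delta>\<^esub> T"
  proof
    fix g assume g: "g \<in> ?AB"
    have gB: "g \<in> Bij \<Delta>" using subgroup_Bij[OF AB g] .
    obtain a where a: "a \<in> A" "a x = g x"
      using A_move[OF x Bij_closed[OF gB x]] .
    have aB: "a \<in> Bij \<Delta>" using a A_Bij by blast
    have "a \<in> ?AB"
      using PG.set_mult_eq_generate[OF normal_A normal_imp_subgroup[OF normal_B]] a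
      by (auto intro: generate.incl)
    then have "binv a \<cdot> g \<in> ?AB"
      using g AB by (simp add: subgroup.m_closed subgroup.m_inv_closed)
    moreover have "(binv a \<cdot> g) x = x"
      using aB gB x by (simp add: apply_simps flip: a(2))
    moreover have "g = a \<cdot> (binv a \<cdot> g)"
      using aB gB by (simp add: S.inv_mult_cancel)
    ultimately show "g \<in> A <#>\<^bsub>BijGroup \<Delta>\<^esub> T"
      using T a(1) unfolding set_mult_def by blast
  qed
  moreover have "A <#>\<^bsub>BijGroup \<Delta>\<^esub> T \<subseteq> ?AB"
  proof -
    have "a \<in> ?AB" if "a \<in> A" for a
      using PG.set_mult_eq_generate[OF normal_A normal_imp_subgroup[OF normal_B]] that
      by (auto intro: generate.incl)
    then have "a \<cdot> t \<in> ?AB" if "a \<in> A" "t \<in> T" for a t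
      using that T subgroup.m_closed[OF AB] by simp
    then show ?thesis
      unfolding set_mult_def[of "BijGroup \<Delta>" A T] by blast
  qed
  ultimately show "A <#>\<^bsub>perm_group \<Delta> P\<^esub> T = A <#>\<^bsub>perm_group \<Delta> P\<^esub> B"
    by simp
qed

lemma socle_stabilizer_iso:
  assumes x: "x \<in> \<Delta>"
  shows "subgrp (perm_group \<Delta> P) B
    \<cong> subgrp (perm_group \<Delta> P) (stabilizer (subgrp (perm_group \<Delta> P) (socle (perm_group \<Delta> P))) id x)"
proof (rule PG.complement_iso[OF normal_A normal_imp_subgroup[OF normal_B]
        socle_stabilizer_complements(1)[OF x] _ _ socle_stabilizer_complements(3)[OF x, symmetric]])
  have one: "\<one>\<^bsub>perm_group \<Delta> P\<^esub> = \<e>"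
    by simp
  show "A \<inter> B = {\<one>\<^bsub>perm_group \<Delta> P\<^esub>}"
    unfolding one by (rule disjoint)
  show "A \<inter> stabilizer (subgrp (perm_group \<Delta> P) (socle (perm_group \<Delta> P))) id x
      = {\<one>\<^bsub>perm_group \<Delta> P\<^esub>}"
    unfolding one by (rule socle_stabilizer_complements(2)[OF x])
qed

text \<open>The socle depends on \<open>P\<close> alone, so the pair and its swapped version yield
  the same point stabiliser, to which \<open>B\<close> and \<open>A\<close> are respectively
  isomorphic.\<close>

lemma A_iso_B: "subgrp (perm_group \<Delta> P) A \<cong> subgrp (perm_group \<Delta> P) B"
proof -
  obtain x where x: "x \<in> \<Delta>" using nonempty by blast
  show ?thesis
    using regular_pair.socle_stabilizer_iso[OF swapped x]
      group.iso_sym[OF PG.subgroup_imp_group[OF normal_imp_subgroup[OF normal_B]] socle_stabilizer_iso[OF x]]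
    by (rule iso_trans)
qed

text \<open>Conjugation by elements of \<open>P\<close> induces automorphisms of \<open>A\<close>,
  so an automorphism-invariant subgroup of \<open>A\<close> is normal in \<open>P\<close> and
  minimality decides.\<close>

lemma char_simple_A: "char_simple_group (perm_group \<Delta> A)"
  unfolding char_simple_group_def
proof (intro conjI allI impI)
  let ?G = "perm_group \<Delta> A"
  show "group ?G" using subgroup_A by (rule S.subgroup_imp_group)
  show "carrier ?G \<noteq> {\<one>\<^bsub>?G\<^esub>}" using nontrivial by simp
  fix C assume C: "subgroup C ?G \<and> (\<forall>f\<in>auto ?G. f ` C = C)"
  have CS: "subgroup C (BijGroup \<Delta>)" and CA: "C \<subseteq> A"
    using S.incl_subgroup[OF subgroup_A] C subgroup.subset[of C ?G] by auto
  have "p \<cdot> c \<cdot> binv p \<in> C" if p: "p \<in> P" and c: "c \<in> C" for p c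
  proof -
    let ?f = "\<lambda>n\<in>A. p \<cdot> n \<cdot> binv p"
    have inv: "inv\<^bsub>perm_group \<Delta> P\<^esub> p = binv p"
      using subgroup_P p by simp
    have "(\<lambda>n. p \<cdot> n \<cdot> binv p) \<in> iso ?G ?G"
      using iso_subgrp[OF PG.conj_iso A.A_carrier, of p] PG.normal_conj_image[OF normal_A, of p] p inv
      by simp
    then have "?f \<in> iso ?G ?G"
      by (rule group.iso_eq[OF \<open>group ?G\<close>]) simp
    then have "?f \<in> auto ?G"
      by (auto simp: auto_def iso_def Bij_def)
    then have "?f ` C = C"
      using conjunct2[OF C] by (rule bspec[rotated])
    then have "?f c \<in> C"
      using c by (metis imageI)
    then show ?thesis using c CA by auto
  qed
  then have "C \<lhd> perm_group \<Delta> P"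
    using CS CA A_P by (auto simp: S.normal_subgrp_iff[OF subgroup_P])
  then show "C = {\<one>\<^bsub>?G\<^esub>} \<or> C = carrier ?G"
    using minimal_A CA by (simp add: minimal_normal_def)
qed

end

section \<open>Transport along a bijection\<close>

definition transport :: "'a set \<Rightarrow> 'b set \<Rightarrow> ('a \<Rightarrow> 'b) \<Rightarrow> ('a \<Rightarrow> 'a) \<Rightarrow> 'b \<Rightarrow> 'b"
  where "transport \<Delta> \<Gamma> \<beta> p = (\<lambda>y\<in>\<Gamma>. \<beta> (p (inv_into \<Delta> \<beta> y)))"

lemma transport_perms_eq: "transport_perms \<Delta> \<Gamma> \<beta> P = transport \<Delta> \<Gamma> \<beta> ` P"
  by (simp add: transport_perms_def transport_def)

context
  fixes \<Delta> :: "'a set" and \<Gamma> :: "'b set" and \<beta> :: "'a \<Rightarrow> 'b"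
  assumes \<beta>: "bij_betw \<beta> \<Delta> \<Gamma>"
begin

lemma transport_inv_into: "x \<in> \<Delta> \<Longrightarrow> inv_into \<Delta> \<beta> (\<beta> x) = x" "y \<in> \<Gamma> \<Longrightarrow> \<beta> (inv_into \<Delta> \<beta> y) = y"
  "x \<in> \<Delta> \<Longrightarrow> \<beta> x \<in> \<Gamma>" "y \<in> \<Gamma> \<Longrightarrow> inv_into \<Delta> \<beta> y \<in> \<Delta>"
  using \<beta> by (auto simp: bij_betw_def f_inv_into_f inv_into_into)

lemma transport_apply: "x \<in> \<Delta> \<Longrightarrow> transport \<Delta> \<Gamma> \<beta> p (\<beta> x) = \<beta> (p x)"
  by (simp add: transport_def transport_inv_into)

lemma transport_iso: "transport \<Delta> \<Gamma> \<beta> \<in> iso (BijGroup \<Delta>) (BijGroup \<Gamma>)"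
proof (rule isoI, rule homI)
  have inv: "bij_betw (inv_into \<Delta> \<beta>) \<Gamma> \<Delta>"
    using \<beta> by (rule bij_betw_inv_into)
  have closed: "transport \<Delta> \<Gamma> \<beta> p \<in> Bij \<Gamma>" if "p \<in> Bij \<Delta>" for p
  proof -
    have "bij_betw (\<beta> \<circ> (p \<circ> inv_into \<Delta> \<beta>)) \<Gamma> \<Gamma>"
      using that inv \<beta> by (auto simp: Bij_def intro: bij_betw_trans)
    then have "bij_betw (transport \<Delta> \<Gamma> \<beta> p) \<Gamma> \<Gamma>"
      by (subst bij_betw_cong[where g = "\<beta> \<circ> (p \<circ> inv_into \<Delta> \<beta>)"]) (simp_all add: transport_def)
    then show ?thesis
      by (simp add: Bij_def transport_def)
  qed
  then show "transport \<Delta> \<Gamma> \<beta> p \<in> carrier (BijGroup \<Gamma>)" if "p \<in> carrier (BijGroup \<Delta>)" for p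
    using that by simp
  show "transport \<Delta> \<Gamma> \<beta> (p \<otimes>\<^bsub>BijGroup \<Delta>\<^esub> q) = transport \<Delta> \<Gamma> \<beta> p \<otimes>\<^bsub>BijGroup \<Gamma>\<^esub> transport \<Delta> \<Gamma> \<beta> q"
    if "p \<in> carrier (BijGroup \<Delta>)" "q \<in> carrier (BijGroup \<Delta>)" for p q
  proof (rule Bij_eqI[where S = \<Gamma>])
    have pq: "p \<in> Bij \<Delta>" "q \<in> Bij \<Delta>" using that by auto
    show "transport \<Delta> \<Gamma> \<beta> (p \<otimes>\<^bsub>BijGroup \<Delta>\<^esub> q) \<in> Bij \<Gamma>"
      "transport \<Delta> \<Gamma> \<beta> p \<otimes>\<^bsub>BijGroup \<Gamma>\<^esub> transport \<Delta> \<Gamma> \<beta> q \<in> Bij \<Gamma>"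
      using pq closed by (simp_all add: mult_BijGroup_closed)
    show "transport \<Delta> \<Gamma> \<beta> (p \<otimes>\<^bsub>BijGroup \<Delta>\<^esub> q) y =
        (transport \<Delta> \<Gamma> \<beta> p \<otimes>\<^bsub>BijGroup \<Gamma>\<^esub> transport \<Delta> \<Gamma> \<beta> q) y" if y: "y \<in> \<Gamma>" for y
    proof -
      have *: "q (inv_into \<Delta> \<beta> y) \<in> \<Delta>"
        using pq y by (simp add: Bij_closed transport_inv_into)
      then have "(transport \<Delta> \<Gamma> \<beta> p \<otimes>\<^bsub>BijGroup \<Gamma>\<^esub> transport \<Delta> \<Gamma> \<beta> q) y
          = transport \<Delta> \<Gamma> \<beta> p (\<beta> (q (inv_into \<Delta> \<beta> y)))"
        using pq closed y by (simp add: mult_BijGroup_apply transport_def)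
      then show ?thesis
        using pq y * by (simp add: transport_apply) (simp add: transport_def mult_BijGroup_apply transport_inv_into)
    qed
  qed
  show "bij_betw (transport \<Delta> \<Gamma> \<beta>) (carrier (BijGroup \<Delta>)) (carrier (BijGroup \<Gamma>))"
    unfolding carrier_BijGroup
  proof (rule bij_betwI')
    show "transport \<Delta> \<Gamma> \<beta> p \<in> Bij \<Gamma>" if "p \<in> Bij \<Delta>" for p
      using closed that .
    show "(transport \<Delta> \<Gamma> \<beta> p = transport \<Delta> \<Gamma> \<beta> q) = (p = q)" if pq: "p \<in> Bij \<Delta>" "q \<in> Bij \<Delta>" for p q
    proof
      assume eq: "transport \<Delta> \<Gamma> \<beta> p = transport \<Delta> \<Gamma> \<beta> q"
      show "p = q"
      proof (rule Bij_eqI[OF pq])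
        fix x assume x: "x \<in> \<Delta>"
        have "\<beta> (p x) = \<beta> (q x)"
          using fun_cong[OF eq, of "\<beta> x"] x by (simp add: transport_apply)
        then show "p x = q x"
          using pq x by (metis Bij_closed transport_inv_into(1))
      qed
    qed simp
    show "\<exists>p\<in>Bij \<Delta>. r = transport \<Delta> \<Gamma> \<beta> p" if r: "r \<in> Bij \<Gamma>" for r
    proof
      let ?p = "\<lambda>x\<in>\<Delta>. inv_into \<Delta> \<beta> (r (\<beta> x))"
      have "bij_betw (inv_into \<Delta> \<beta> \<circ> (r \<circ> \<beta>)) \<Delta> \<Delta>"
        using r inv \<beta> by (auto simp: Bij_def intro: bij_betw_trans)
      then have "bij_betw ?p \<Delta> \<Delta>"
        by (subst bij_betw_cong[where g = "inv_into \<Delta> \<beta> \<circ> (r \<circ> \<beta>)"]) simp_all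
      then show p: "?p \<in> Bij \<Delta>"
        by (simp add: Bij_def)
      show "r = transport \<Delta> \<Gamma> \<beta> ?p"
        by (rule Bij_eqI[OF r closed[OF p]])
          (simp add: transport_def transport_inv_into Bij_closed[OF r])
    qed
  qed
qed

lemma transport_group_hom: "group_hom (BijGroup \<Delta>) (BijGroup \<Gamma>) (transport \<Delta> \<Gamma> \<beta>)"
  using transport_iso by (simp add: group_hom_def group_hom_axioms_def iso_def group_BijGroup)

lemma transport_transitive:
  assumes "transitive \<Delta> N"
  shows "transitive \<Gamma> (transport \<Delta> \<Gamma> \<beta> ` N)"
proof -
  interpret group_hom "BijGroup \<Delta>" "BijGroup \<Gamma>" "transport \<Delta> \<Gamma> \<beta>"
    by (rule transport_group_hom)
  have "subgroup (transport \<Delta> \<Gamma> \<beta> ` N) (BijGroup \<Gamma>)"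
    using assms subgroup_img_is_subgroup by (simp add: transitive_iff)
  moreover have "\<exists>g\<in>transport \<Delta> \<Gamma> \<beta> ` N. g x = y" if xy: "x \<in> \<Gamma>" "y \<in> \<Gamma>" for x y
  proof -
    obtain n where "n \<in> N" "n (inv_into \<Delta> \<beta> x) = inv_into \<Delta> \<beta> y"
      using assms xy transport_inv_into(4) unfolding transitive_iff by blast
    then have "n \<in> N" "transport \<Delta> \<Gamma> \<beta> n x = y"
      using xy by (simp_all add: transport_def transport_inv_into)
    then show ?thesis by blast
  qed
  ultimately show ?thesis
    by (simp add: transitive_iff)
qed

lemma transport_primitive:
  assumes "primitive \<Delta> P"
  shows "primitive \<Gamma> (transport \<Delta> \<Gamma> \<beta> ` P)"
  unfolding primitive_def
proof (intro conjI allI impI)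
  let ?\<beta>' = "inv_into \<Delta> \<beta>"
  have tr: "transitive \<Delta> P" using assms by (simp add: primitive_def)
  show "transitive \<Gamma> (transport \<Delta> \<Gamma> \<beta> ` P)" using tr by (rule transport_transitive)
  have prim: "\<C> = {\<Delta>} \<or> \<C> = (\<lambda>x. {x}) ` \<Delta>"
    if "partition_on \<Delta> \<C>" "\<And>p B. p \<in> P \<Longrightarrow> B \<in> \<C> \<Longrightarrow> p ` B \<in> \<C>" for \<C>
    using assms that unfolding primitive_def by simp
  fix \<B> assume \<B>: "partition_on \<Gamma> \<B> \<and> (\<forall>p\<in>transport \<Delta> \<Gamma> \<beta> ` P. \<forall>B\<in>\<B>. p ` B \<in> \<B>)"
  have inv: "bij_betw ?\<beta>' \<Gamma> \<Delta>"
    using \<beta> by (rule bij_betw_inv_into)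
  have sub: "B \<subseteq> \<Gamma>" if "B \<in> \<B>" for B
    using that \<B> by (auto simp: partition_on_def)
  have "partition_on \<Delta> (image ?\<beta>' ` \<B>)"
  proof (rule partition_onI)
    show "\<Union>(image ?\<beta>' ` \<B>) = \<Delta>"
      using \<B> inv unfolding partition_on_def bij_betw_def by blast
    show "{} \<notin> image ?\<beta>' ` \<B>"
      using \<B> by (auto simp: partition_on_def)
    fix X Y assume "X \<in> image ?\<beta>' ` \<B>" "Y \<in> image ?\<beta>' ` \<B>" "X \<noteq> Y"
    then obtain B C where BC: "B \<in> \<B>" "C \<in> \<B>" "X = ?\<beta>' ` B" "Y = ?\<beta>' ` C" "B \<noteq> C"
      by blast
    then have "B \<inter> C = {}"
      using \<B> by (auto simp: partition_on_def disjoint_def)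
    then have "?\<beta>' ` B \<inter> ?\<beta>' ` C = {}"
      using inj_on_image_Int[OF bij_betw_imp_inj_on[OF inv] sub[OF BC(1)] sub[OF BC(2)]] by simp
    then show "disjnt X Y"
      using BC by (simp add: disjnt_def)
  qed
  moreover have "p ` X \<in> image ?\<beta>' ` \<B>" if p: "p \<in> P" and X: "X \<in> image ?\<beta>' ` \<B>" for p X
  proof -
    obtain B where B: "B \<in> \<B>" "X = ?\<beta>' ` B" using X by blast
    have pB: "p \<in> Bij \<Delta>" using tr p subgroup_Bij by (auto simp: transitive_iff)
    have "?\<beta>' ` transport \<Delta> \<Gamma> \<beta> p ` B = p ` X"
      unfolding B(2) image_image
    proof (rule image_cong[OF refl])
      fix y assume "y \<in> B"
      then have "y \<in> \<Gamma>" using sub[OF B(1)] by blast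
      then show "?\<beta>' (transport \<Delta> \<Gamma> \<beta> p y) = p (?\<beta>' y)"
        using pB by (simp add: transport_def transport_inv_into Bij_closed)
    qed
    moreover have "transport \<Delta> \<Gamma> \<beta> p ` B \<in> \<B>"
      using \<B> p B(1) by blast
    ultimately show ?thesis by (metis imageI)
  qed
  ultimately have *: "image ?\<beta>' ` \<B> = {\<Delta>} \<or> image ?\<beta>' ` \<B> = (\<lambda>x. {x}) ` \<Delta>"
    by (intro prim) blast+
  have cancel: "\<beta> ` ?\<beta>' ` B = B" if "B \<in> \<B>" for B
    using sub[OF that] \<beta> by (auto simp: bij_betw_def image_inv_into_cancel)
  have "image \<beta> ` image ?\<beta>' ` \<B> = (\<lambda>B. B) ` \<B>"
    unfolding image_image[of "image \<beta>"] by (rule image_cong[OF refl cancel])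
  then have eq: "\<B> = image \<beta> ` image ?\<beta>' ` \<B>" by simp
  have img: "\<beta> ` \<Delta> = \<Gamma>" using \<beta> by (simp add: bij_betw_def)
  show "\<B> = {\<Gamma>} \<or> \<B> = (\<lambda>x. {x}) ` \<Gamma>"
    using *
  proof
    assume "image ?\<beta>' ` \<B> = {\<Delta>}"
    then have "\<B> = {\<Gamma>}" using eq img by simp
    then show ?thesis ..
  next
    assume "image ?\<beta>' ` \<B> = (\<lambda>x. {x}) ` \<Delta>"
    then have "\<B> = (\<lambda>x. {\<beta> x}) ` \<Delta>" using eq by (simp add: image_image)
    also have "\<dots> = (\<lambda>x. {x}) ` \<beta> ` \<Delta>" by (simp add: image_image)
    finally show ?thesis using img by simp
  qed
qed

lemma transport_regular_pair:
  assumes "regular_pair \<Delta> P A B"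
  shows "regular_pair \<Gamma> (transport \<Delta> \<Gamma> \<beta> ` P) (transport \<Delta> \<Gamma> \<beta> ` A) (transport \<Delta> \<Gamma> \<beta> ` B)"
proof -
  interpret regular_pair \<Delta> P A B by (rule assms)
  let ?t = "transport \<Delta> \<Gamma> \<beta>"
  interpret t: group_hom "BijGroup \<Delta>" "BijGroup \<Gamma>" ?t
    by (rule transport_group_hom)
  have inj: "inj_on ?t (Bij \<Delta>)"
    using transport_iso by (simp add: iso_def bij_betw_def)
  have P': "subgroup (?t ` P) (BijGroup \<Gamma>)"
    using t.subgroup_img_is_subgroup[OF subgroup_P] .
  have iso: "?t \<in> iso (perm_group \<Delta> P) (perm_group \<Gamma> (?t ` P))"
    using iso_subgrp[OF transport_iso subgroup.subset[OF subgroup_P]] .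
  have normal: "?t ` N \<lhd> perm_group \<Gamma> (?t ` P)" if "N \<lhd> perm_group \<Delta> P" for N
    using iso_normal_subgroup[OF iso PG.group_axioms group.subgroup_imp_group[OF group_BijGroup P'] that] .
  have sub: "A \<subseteq> Bij \<Delta>" "B \<subseteq> Bij \<Delta>" using A_Bij B_Bij by auto
  show ?thesis
  proof (rule regular_pair.intro)
    show "?t ` A \<inter> ?t ` B = {\<one>\<^bsub>BijGroup \<Gamma>\<^esub>}"
      using inj_on_image_Int[OF inj sub] disjoint by simp
    show "?t ` A \<noteq> {\<one>\<^bsub>BijGroup \<Gamma>\<^esub>}"
    proof
      assume "?t ` A = {\<one>\<^bsub>BijGroup \<Gamma>\<^esub>}"
      then have "?t ` A = ?t ` {\<one>\<^bsub>BijGroup \<Delta>\<^esub>}" by simp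
      then have "A = {\<one>\<^bsub>BijGroup \<Delta>\<^esub>}"
        using inj_on_image_eq_iff[OF inj sub(1), of "{\<one>\<^bsub>BijGroup \<Delta>\<^esub>}"] e_Bij by simp
      then show False using nontrivial by simp
    qed
  qed (rule P' transport_primitive[OF primitive] normal[OF normal_A] normal[OF normal_B]
      transport_transitive[OF transitive_A] transport_transitive[OF transitive_B])+
qed

end

section \<open>Holomorphs\<close>

text \<open>\<open>A\<close> is modelled by left translations because these give a homomorphism; the
  right translations in \<open>holomorph\<close> then reappear as the centraliser
  \<open>B\<close>.\<close>

definition left_translation :: "('a, 'b) monoid_scheme \<Rightarrow> 'a \<Rightarrow> 'a \<Rightarrow> 'a"
  where "left_translation H g = (\<lambda>x\<in>carrier H. g \<otimes>\<^bsub>H\<^esub> x)"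

context group
begin

lemma left_translation_Bij: "g \<in> carrier G \<Longrightarrow> left_translation G g \<in> Bij (carrier G)"
  unfolding Bij_def left_translation_def
  by (auto intro!: bij_betw_byWitness[where f' = "\<lambda>x. inv g \<otimes> x"] simp: inv_mult_cancel)

lemma right_translation_Bij: "g \<in> carrier G \<Longrightarrow> right_translation G g \<in> Bij (carrier G)"
  unfolding Bij_def right_translation_def
  by (auto intro!: bij_betw_byWitness[where f' = "\<lambda>x. x \<otimes> inv g"] simp: m_assoc)

lemma left_translation_iso:
  "left_translation G \<in> iso G (perm_group (carrier G) (left_translation G ` carrier G))"
proof (rule isoI, rule homI)
  show "left_translation G (x \<otimes> y) =
      left_translation G x \<otimes>\<^bsub>perm_group (carrier G) (left_translation G ` carrier G)\<^esub> left_translation G y"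
    if "x \<in> carrier G" "y \<in> carrier G" for x y
    using that left_translation_Bij
    by (intro Bij_eqI[where S = "carrier G"])
      (simp_all add: mult_BijGroup_apply mult_BijGroup_closed, simp add: left_translation_def m_assoc)
  have "inj_on (left_translation G) (carrier G)"
  proof (rule inj_onI)
    fix x y assume xy: "x \<in> carrier G" "y \<in> carrier G" "left_translation G x = left_translation G y"
    have "left_translation G x \<one> = left_translation G y \<one>"
      by (simp only: xy(3))
    then show "x = y"
      using xy(1,2) by (simp add: left_translation_def)
  qed
  then show "bij_betw (left_translation G) (carrier G)
      (carrier (perm_group (carrier G) (left_translation G ` carrier G)))"
    by (simp add: bij_betw_def)
qed simp

end

text \<open>Regularity identifies \<Delta> with \<open>A\<close> through
  \<open>a -> a \<alpha>\<close>, and the given isomorphism identifies \<open>A\<close> with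
  \<open>H\<close>. As \<open>a\<close> takes \<open>b \<alpha>\<close> to
  \<open>(a \<cdot> b) \<alpha>\<close>, it becomes left multiplication by
  \<open>\<phi> a\<close>.\<close>

lemma (in regular_pair) regular_pair_translations:
  assumes H: "group H" and iso: "perm_group \<Delta> A \<cong> H"
  obtains \<beta> where "bij_betw \<beta> \<Delta> (carrier H)"
    "regular_pair (carrier H) (transport_perms \<Delta> (carrier H) \<beta> P)
      (left_translation H ` carrier H) (transport \<Delta> (carrier H) \<beta> ` B)"
proof -
  interpret H: group H by (rule H)
  obtain \<phi> where \<phi>: "\<phi> \<in> iso (perm_group \<Delta> A) H"
    using iso by (auto simp: is_iso_def)
  have \<phi>': "bij_betw \<phi> A (carrier H)" and \<phi>_mult: "\<And>a b. a \<in> A \<Longrightarrow> b \<in> A \<Longrightarrow> \<phi> (a \<cdot> b) = \<phi> a \<otimes>\<^bsub>H\<^esub> \<phi> b"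
    using \<phi> by (auto simp: iso_def hom_def)
  have \<phi>_closed: "\<phi> a \<in> carrier H" if "a \<in> A" for a
    using \<phi>' that by (auto simp: bij_betw_def)
  obtain \<alpha> where \<alpha>: "\<alpha> \<in> \<Delta>" using nonempty by blast
  have ev: "bij_betw (\<lambda>a. a \<alpha>) A \<Delta>"
  proof (rule bij_betwI')
    show "(a \<alpha> = a' \<alpha>) = (a = a')" if "a \<in> A" "a' \<in> A" for a a'
      using A_eqI[OF that \<alpha>] by blast
    show "a \<alpha> \<in> \<Delta>" if "a \<in> A" for a using that A_Bij \<alpha> by (simp add: Bij_closed)
    show "\<exists>a\<in>A. y = a \<alpha>" if "y \<in> \<Delta>" for y using A_move[OF \<alpha> that] by metis
  qed
  define \<beta> where "\<beta> = \<phi> \<circ> inv_into A (\<lambda>a. a \<alpha>)"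
  have \<beta>: "bij_betw \<beta> \<Delta> (carrier H)"
    unfolding \<beta>_def using bij_betw_trans[OF bij_betw_inv_into[OF ev] \<phi>'] .
  have \<beta>_apply: "\<beta> (a \<alpha>) = \<phi> a" if "a \<in> A" for a
    using inv_into_f_f[OF bij_betw_imp_inj_on[OF ev] that] by (simp add: \<beta>_def)
  have tr: "transport \<Delta> (carrier H) \<beta> a = left_translation H (\<phi> a)" if a: "a \<in> A" for a
  proof (rule Bij_eqI[where S = "carrier H"])
    show "transport \<Delta> (carrier H) \<beta> a \<in> Bij (carrier H)"
      using transport_iso[OF \<beta>] A_Bij[OF a] by (auto simp: iso_def hom_def)
    show "left_translation H (\<phi> a) \<in> Bij (carrier H)"
      using H.left_translation_Bij[OF \<phi>_closed[OF a]] .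
    fix h assume h: "h \<in> carrier H"
    then obtain b where b: "b \<in> A" "h = \<phi> b"
      using \<phi>' by (auto simp: bij_betw_def)
    have "transport \<Delta> (carrier H) \<beta> a h = transport \<Delta> (carrier H) \<beta> a (\<beta> (b \<alpha>))"
      using b by (simp add: \<beta>_apply)
    also have "\<dots> = \<beta> ((a \<cdot> b) \<alpha>)"
      using transport_apply[OF \<beta>] a b \<alpha> A_Bij by (simp add: apply_simps)
    also have "\<dots> = \<phi> a \<otimes>\<^bsub>H\<^esub> h"
      using a b \<beta>_apply[of "a \<cdot> b"] subgroup.m_closed[OF subgroup_A] by (simp add: \<phi>_mult)
    finally show "transport \<Delta> (carrier H) \<beta> a h = left_translation H (\<phi> a) h"
      using h by (simp add: left_translation_def)
  qed
  have "transport \<Delta> (carrier H) \<beta> ` A = left_translation H ` \<phi> ` A"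
    unfolding image_image by (rule image_cong[OF refl tr])
  then have "transport \<Delta> (carrier H) \<beta> ` A = left_translation H ` carrier H"
    using \<phi>' by (simp add: bij_betw_def)
  then show ?thesis
    using that[OF \<beta>] transport_regular_pair[OF \<beta> regular_pair_axioms] by (simp add: transport_perms_eq)
qed

section \<open>Primitive groups in which one of the pair is the group of left translations\<close>

locale translation_pair = group H + regular_pair "carrier H" P "left_translation H ` carrier H" B
  for H :: "('a, 'b) monoid_scheme" (structure) and P B
begin

notation mul (infixl "\<cdot>" 70)

abbreviation "PG \<equiv> perm_group (carrier H) P"

text \<open>Commuting with left translation by \<open>x\<close> and evaluating at
  \<open>\<one>\<close> gives \<open>b x = x \<otimes> b \<one>\<close>. Conversely, right
  translations commute with left ones and so lie in the centraliser \<open>B\<close>.\<close>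

lemma B_eq: "B = right_translation H ` carrier H"
proof
  show "B \<subseteq> right_translation H ` carrier H"
  proof
    fix b assume b: "b \<in> B"
    have "b = right_translation H (b \<one>)"
    proof (rule Bij_eqI[OF B_Bij[OF b] right_translation_Bij])
      show "b \<one> \<in> carrier H"
        using B_Bij[OF b] by (simp add: Bij_closed)
      fix x assume x: "x \<in> carrier H"
      have "b x = (b \<cdot> left_translation H x) \<one>"
        using x B_Bij[OF b] left_translation_Bij[OF x] by (simp add: mult_BijGroup_apply) (simp add: left_translation_def)
      also have "\<dots> = (left_translation H x \<cdot> b) \<one>"
        using commute[OF imageI[OF x] b] by simp
      also have "\<dots> = right_translation H (b \<one>) x"
        using x B_Bij[OF b] left_translation_Bij[OF x] \<open>b \<one> \<in> carrier H\<close>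
        by (simp add: mult_BijGroup_apply) (simp add: left_translation_def right_translation_def)
      finally show "b x = right_translation H (b \<one>) x" .
    qed
    then show "b \<in> right_translation H ` carrier H"
      using B_Bij[OF b] by (metis Bij_closed imageI one_closed)
  qed
  show "right_translation H ` carrier H \<subseteq> B"
  proof clarify
    fix g assume g: "g \<in> carrier H"
    show "right_translation H g \<in> B"
    proof (rule centralizer_A[OF right_translation_Bij[OF g]])
      fix a assume "a \<in> left_translation H ` carrier H"
      then obtain h where h: "h \<in> carrier H" "a = left_translation H h" by blast
      show "right_translation H g \<cdot> a = a \<cdot> right_translation H g"
        unfolding h(2)
        using g h(1) right_translation_Bij[OF g] left_translation_Bij[OF h(1)]
        by (intro Bij_eqI[where S = "carrier H"])
          (simp_all add: mult_BijGroup_apply mult_BijGroup_closed,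
            simp add: left_translation_def right_translation_def m_assoc)
    qed
  qed
qed

text \<open>\<open>p\<close> normalises the left translations, so conjugation takes translation by
  \<open>x\<close> to translation by some \<open>z\<close>, and
  \<open>p (x \<otimes> y) = z \<otimes> p y\<close>. Setting \<open>y = \<one>\<close> identifies
  \<open>z\<close> as \<open>p x\<close>.\<close>

lemma stabilizer_auto:
  assumes p: "p \<in> P" "p \<one> = \<one>"
  shows "p \<in> auto H"
proof -
  have pB: "p \<in> Bij (carrier H)" using P_Bij[OF p(1)] .
  have "p (x \<otimes> y) = p x \<otimes> p y" if x: "x \<in> carrier H" and y: "y \<in> carrier H" for x y
  proof -
    have "p \<cdot> left_translation H x \<cdot> binv p \<in> left_translation H ` carrier H"
      using conj_A[OF p(1) imageI[OF x]] .
    then obtain z where z: "z \<in> carrier H"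
      "p \<cdot> left_translation H x \<cdot> binv p = left_translation H z" by blast
    have *: "p (x \<otimes> y) = z \<otimes> p y" if y: "y \<in> carrier H" for y
    proof -
      have "(p \<cdot> left_translation H x \<cdot> binv p) (p y) = p (left_translation H x y)"
        using pB left_translation_Bij[OF x] y by (simp add: apply_simps)
      then show ?thesis
        using x y pB unfolding z(2) by (simp add: left_translation_def Bij_closed)
    qed
    have "p x = z"
      using *[OF one_closed] x z(1) p(2) by simp
    then show ?thesis
      using *[OF y] by simp
  qed
  then show ?thesis
    using pB by (auto simp: auto_def hom_def Bij_closed)
qed

text \<open>Dividing \<open>p\<close> by the right translation by \<open>p \<one>\<close>, which
  belongs to \<open>B\<close> and hence to \<open>P\<close>, leaves an element fixing
  \<open>\<one>\<close>, and this is an automorphism.\<close>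

lemma P_holomorph: "P \<subseteq> holomorph H"
proof
  fix p assume p: "p \<in> P"
  have pB: "p \<in> Bij (carrier H)" using P_Bij[OF p] .
  have g: "p \<one> \<in> carrier H" using pB by (simp add: Bij_closed)
  let ?r = "right_translation H (p \<one>)"
  have r: "?r \<in> P" "?r \<in> Bij (carrier H)"
    using g B_P B_eq right_translation_Bij by auto
  have q: "binv ?r \<cdot> p \<in> P"
    using r p subgroup_P by (simp add: subgroup.m_closed subgroup.m_inv_closed)
  have "?r \<one> = p \<one>"
    using g by (simp add: right_translation_def)
  then have "(binv ?r) (p \<one>) = \<one>"
    using inv_BijGroup_apply(1)[OF r(2) one_closed] by simp
  then have "(binv ?r \<cdot> p) \<one> = \<one>"
    using pB r(2) by (simp add: apply_simps)
  then have "binv ?r \<cdot> p \<in> auto H"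
    by (rule stabilizer_auto[OF q])
  moreover have "p = ?r \<cdot> (binv ?r \<cdot> p)"
    using pB r(2) by (simp add: S.inv_mult_cancel)
  ultimately show "p \<in> holomorph H"
    unfolding holomorph_def set_mult_def using g by blast
qed

text \<open>Conjugation by \<open>g\<close> is left translation by \<open>g\<close> composed with
  right translation by \<open>inv g\<close>.\<close>

lemma inner_auts_P: "inner_auts H \<subseteq> P"
proof
  fix f assume "f \<in> inner_auts H"
  then obtain g where g: "g \<in> carrier H" "f = (\<lambda>x\<in>carrier H. g \<otimes> x \<otimes> inv g)"
    by (auto simp: inner_auts_def)
  let ?l = "left_translation H g" and ?r = "right_translation H (inv g)"
  have lr: "?l \<in> P" "?r \<in> P" "?l \<in> Bij (carrier H)" "?r \<in> Bij (carrier H)"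
    using g(1) A_P B_P B_eq left_translation_Bij right_translation_Bij by auto
  have lr_P: "?l \<cdot> ?r \<in> P"
    using lr subgroup.m_closed[OF subgroup_P] by blast
  have "?l \<cdot> ?r = f"
  proof (rule extensionalityI[where A = "carrier H"])
    show "?l \<cdot> ?r \<in> extensional (carrier H)"
      using P_Bij[OF lr_P] by (simp add: Bij_def)
    show "f \<in> extensional (carrier H)" by (simp add: g(2))
    show "(?l \<cdot> ?r) x = f x" if "x \<in> carrier H" for x
      using lr(3,4) g(1) that
      by (simp add: mult_BijGroup_apply) (simp add: left_translation_def right_translation_def g m_assoc)
  qed
  then show "f \<in> P"
    using lr_P by simp
qed

lemma inner_auts_fix: "f \<in> inner_auts H \<Longrightarrow> f \<one> = \<one>"
  by (auto simp: inner_auts_def)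

lemma A_iso: "subgrp PG (left_translation H ` carrier H) \<cong> H"
  using iso_sym[OF is_isoI[OF left_translation_iso]] by simp

lemma B_iso: "subgrp PG B \<cong> H"
  using group.iso_sym[OF PG.subgroup_imp_group[OF normal_imp_subgroup[OF normal_A]] A_iso_B]
    A_iso by (rule iso_trans)

lemma HS_on:
  assumes H: "simple_group H" "\<not> comm_group H"
  shows "HS_on H P"
  unfolding HS_on_def
proof (intro conjI H primitive P_holomorph)
  show "\<exists>N. N \<lhd> PG \<and> perm_group (carrier H) N \<cong> H \<times>\<times> H"
  proof (intro exI conjI)
    show "socle PG \<lhd> PG"
      using PG.normal_subgroup_set_mult_closed[OF normal_A normal_B] by (simp add: socle_eq)
    have grp: "group (subgrp PG (left_translation H ` carrier H))" "group (subgrp PG B)"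
      using PG.subgroup_imp_group normal_imp_subgroup normal_A normal_B by blast+
    have "subgrp PG (socle PG) \<cong> subgrp PG (left_translation H ` carrier H) \<times>\<times> subgrp PG B"
      using group.iso_sym[OF DirProd_group[OF grp] socle_iso] .
    also have "\<dots> \<cong> H \<times>\<times> H"
      using group.DirProd_iso_trans[OF grp(1) A_iso B_iso] .
    finally show "perm_group (carrier H) (socle PG) \<cong> H \<times>\<times> H" by simp
  qed
  show "inner_auts H \<subseteq> stabilizer PG id \<one>"
    using inner_auts_P inner_auts_fix by (auto simp: stabilizer_def)
  show "stabilizer PG id \<one> \<subseteq> auto H"
    using stabilizer_auto by (auto simp: stabilizer_def)
qed

end

text \<open>Right translations form an anti-homomorphism, whence the inverse.\<close>

lemma (in translation_pair) right_translation_iso: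
  "(\<lambda>g. right_translation H (inv g)) \<in> iso H (subgrp PG B)"
proof (rule isoI, rule homI)
  show "right_translation H (inv g) \<in> carrier (subgrp PG B)" if "g \<in> carrier H" for g
    using that B_eq by simp
  show "right_translation H (inv (x \<otimes> y)) =
      right_translation H (inv x) \<otimes>\<^bsub>subgrp PG B\<^esub> right_translation H (inv y)"
    if "x \<in> carrier H" "y \<in> carrier H" for x y
    using that right_translation_Bij
    by (intro Bij_eqI[where S = "carrier H"])
      (simp_all add: mult_BijGroup_apply mult_BijGroup_closed,
        simp add: right_translation_def m_assoc inv_mult_group)
  have "inj_on (\<lambda>g. right_translation H (inv g)) (carrier H)"
  proof (rule inj_onI)
    fix x y assume xy: "x \<in> carrier H" "y \<in> carrier H"
      "right_translation H (inv x) = right_translation H (inv y)"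
    have "right_translation H (inv x) \<one> = right_translation H (inv y) \<one>"
      by (simp only: xy(3))
    then show "x = y"
      using xy(1,2) by (simp add: right_translation_def inv_inj inj_on_eq_iff[OF inv_inj])
  qed
  moreover have "(\<lambda>g. right_translation H (inv g)) ` carrier H = B"
  proof -
    have "m_inv H ` carrier H = carrier H"
    proof
      show "carrier H \<subseteq> m_inv H ` carrier H"
      proof
        fix x assume "x \<in> carrier H"
        then have "x = inv (inv x)" "inv x \<in> carrier H" by simp_all
        then show "x \<in> m_inv H ` carrier H" by blast
      qed
    qed auto
    then show ?thesis
      unfolding B_eq by (metis image_image)
  qed
  ultimately show "bij_betw (\<lambda>g. right_translation H (inv g)) (carrier H) (carrier (subgrp PG B))"
    by (simp add: bij_betw_def)
qed

lemma factor_eq: "factor T k i = right_translation (power_group T k) ` coord_subgroup T k i"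
  by (simp add: factor_def coord_subgroup_def)

text \<open>The members of \<open>factor\<close> are exactly the minimal normal subgroups of
  \<open>B\<close>, which \<open>P\<close> permutes transitively by conjugation. The conditions on
  minimal normal subgroups and on the socle come from the regular pair.\<close>

lemma HC_on:
  assumes pair: "translation_pair (power_group T k) P B"
    and T: "simple_group T" "\<not> comm_group T" and k: "2 \<le> k"
  shows "HC_on T k P"
proof -
  interpret T: simple_group T by (rule T)
  let ?H = "power_group T k"
  interpret translation_pair ?H P B by (rule pair)
  \<comment> \<open>The theory of factors is attached to the first group of a pair, whereas
    \<open>factor\<close> consists of right translations, so \<open>B\<close> is put first.\<close>
  interpret swap: regular_pair "carrier ?H" P B "left_translation ?H ` carrier ?H"
    by (rule swapped)
  have factors: "factor T k ` {..<k} = {M. minimal_normal (subgrp PG B) M}"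
  proof -
    have "group (subgrp PG B)"
      using PG.subgroup_imp_group[OF normal_imp_subgroup[OF normal_B]] .
    then have "{M. minimal_normal (subgrp PG B) M}
        = image (\<lambda>g. right_translation ?H (inv\<^bsub>?H\<^esub> g)) ` coord_subgroup T k ` {..<k}"
      using minimal_normals_iso[OF right_translation_iso T.power_group_group]
        minimal_normals_power_group[OF T] by simp
    also have "\<dots> = factor T k ` {..<k}"
      unfolding image_image[of "image _"]
    proof (rule image_cong[OF refl])
      fix i assume "i \<in> {..<k}"
      have sub: "subgroup (coord_subgroup T k i) ?H"
        using coord_subgroup_normal[OF T.group_axioms] by (rule normal_imp_subgroup)
      \<comment> \<open>The inverse in \<open>right_translation_iso\<close> does no harm, as
        subgroups are mapped onto themselves by inversion.\<close>
      have "m_inv ?H ` coord_subgroup T k i = coord_subgroup T k i"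
      proof
        show "m_inv ?H ` coord_subgroup T k i \<subseteq> coord_subgroup T k i"
          using subgroup.m_inv_closed[OF sub] by blast
        show "coord_subgroup T k i \<subseteq> m_inv ?H ` coord_subgroup T k i"
        proof
          fix x assume x: "x \<in> coord_subgroup T k i"
          then have "x = inv\<^bsub>?H\<^esub> (inv\<^bsub>?H\<^esub> x)"
            using subgroup.mem_carrier[OF sub x] by (simp only: inv_inv)
          then show "x \<in> m_inv ?H ` coord_subgroup T k i"
            using subgroup.m_inv_closed[OF sub x] by blast
        qed
      qed
      then show "(\<lambda>g. right_translation ?H (inv\<^bsub>?H\<^esub> g)) ` coord_subgroup T k i = factor T k i"
        unfolding factor_eq by (metis image_image)
    qed
    finally show ?thesis ..
  qed
  have trans: "transitive_action PG (factor T k ` {..<k})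
      (conj_action (BijGroup (carrier ?H)) (factor T k ` {..<k}))"
    unfolding factors
  proof (rule swap.A.conj_transitive_action)
    fix p assume "p \<in> carrier PG"
    then have "inv\<^bsub>PG\<^esub> p = inv\<^bsub>BijGroup (carrier ?H)\<^esub> p"
      using S.m_inv_consistent[OF subgroup_P] by simp
    then show "conj_action (BijGroup (carrier ?H)) {M. minimal_normal (subgrp PG B) M} p
        = (\<lambda>F\<in>{M. minimal_normal (subgrp PG B) M}. (\<lambda>n. p \<otimes>\<^bsub>PG\<^esub> n \<otimes>\<^bsub>PG\<^esub> inv\<^bsub>PG\<^esub> p) ` F)"
      unfolding conj_action_def by simp
  qed
  have minimal: "subgrp PG M \<cong> ?H" if "minimal_normal PG M" for M
  proof -
    have "M \<in> {left_translation ?H ` carrier ?H, B}"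
      unfolding minimal_normals[symmetric] using that by simp
    then show ?thesis
      using A_iso B_iso by fastforce
  qed
  have stab: "subgrp PG (stabilizer (subgrp PG (socle PG)) id \<alpha>) \<cong> ?H" if \<alpha>: "\<alpha> \<in> carrier ?H" for \<alpha>
    using group.iso_sym[OF PG.subgroup_imp_group[OF normal_imp_subgroup[OF normal_B]] socle_stabilizer_iso[OF \<alpha>]]
      B_iso by (rule iso_trans)
  have sub: "right_translation ?H ` carrier ?H <#>\<^bsub>BijGroup (carrier ?H)\<^esub> inner_auts ?H \<subseteq> P"
    using B_P inner_auts_P subgroup.m_closed[OF subgroup_P] unfolding B_eq set_mult_def by blast
  show ?thesis
    unfolding HC_on_def Let_def
  proof (intro conjI allI impI ballI T k primitive sub P_holomorph trans stab minimal)
    show "card {M. minimal_normal PG M} = 2"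
      unfolding minimal_normals using A_neq_B by (rule card_2_iff[THEN iffD2, OF exI, OF exI, OF conjI, OF refl])
  qed
qed

lemma simple_group_image_group:
  assumes T: "simple_group T" "\<not> comm_group T" and j: "inj_on j (carrier T)"
  shows "simple_group (image_group j T)" "\<not> comm_group (image_group j T)" "T \<cong> image_group j T"
proof -
  interpret T: simple_group T by (rule T)
  have iso: "j \<in> iso T (image_group j T)"
    using j by (rule inj_imp_image_group_iso)
  have grp: "group (image_group j T)"
    using j by (rule T.inj_imp_image_group_is_group)
  show "simple_group (image_group j T)"
    using T.iso_simple[OF grp iso] .
  show "T \<cong> image_group j T"
    using iso by (rule is_isoI)
  then show "\<not> comm_group (image_group j T)"
    using comm_group_iso[OF _ T.iso_sym T.group_axioms] T(2) by blast
qed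

text \<open>Since \<open>T\<close> embeds into \<open>\<Delta>\<close>, it has a copy on the element type of \<open>\<Delta>\<close>.\<close>

lemma (in regular_pair) type_HS_or_HC:
  assumes T: "simple_group T" "\<not> comm_group T" and l: "1 \<le> l"
    and iso: "perm_group \<Delta> A \<cong> power_group T l"
  shows "type_HS \<Delta> P \<or> type_HC \<Delta> P"
proof -
  interpret T: simple_group T by (rule T)
  obtain x where x: "x \<in> \<Delta>" using nonempty by blast
  obtain \<phi> where \<phi>: "\<phi> \<in> iso (power_group T l) (perm_group \<Delta> A)"
    using group.iso_sym[OF S.subgroup_imp_group[OF subgroup_A] iso] by (auto simp: is_iso_def)
  define e where "e = coord_embed T l 0"
  have e: "inj_on e (carrier T)" "e ` carrier T \<subseteq> carrier (power_group T l)"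
    using coord_embed_iso[OF T.group_axioms, of 0 l] l
    by (auto simp: e_def iso_def bij_betw_def coord_subgroup_def)
  \<comment> \<open>Coordinate 0 of the power, carried into \<open>A\<close> and evaluated at a
    point; injective because \<open>A\<close> is regular.\<close>
  define j where "j t = (\<phi> (e t)) x" for t
  have j: "inj_on j (carrier T)"
  proof (rule inj_onI)
    fix s t assume st: "s \<in> carrier T" "t \<in> carrier T" "j s = j t"
    have "\<phi> (e s) \<in> A" "\<phi> (e t) \<in> A"
      using \<phi> e(2) st(1,2) by (auto simp: iso_def hom_def)
    then have "\<phi> (e s) = \<phi> (e t)"
      using A_eqI[OF _ _ x] st(3) by (simp add: j_def)
    moreover have "inj_on \<phi> (carrier (power_group T l))"
      using \<phi> by (simp add: iso_def bij_betw_def)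
    ultimately have "e s = e t"
      using e(2) st(1,2) by (meson image_subset_iff inj_onD)
    then show "s = t"
      using e(1) st(1,2) by (simp add: inj_on_eq_iff)
  qed
  let ?T = "image_group j T"
  note simple = simple_group_image_group(1)[OF T j] and ncomm = simple_group_image_group(2)[OF T j]
    and jT = simple_group_image_group(3)[OF T j]
  have grp: "group ?T"
    using simple by (simp add: simple_group_def)
  have isol: "perm_group \<Delta> A \<cong> power_group ?T l"
    using iso iso_product_groupI[OF jT T.group_axioms grp] by (rule iso_trans)
  show ?thesis
  proof (cases "l = 1")
    case True
    have "perm_group \<Delta> A \<cong> ?T"
      using isol group.power_group_1[OF grp] unfolding True by (rule iso_trans)
    then obtain \<beta> where \<beta>: "bij_betw \<beta> \<Delta> (carrier ?T)"
      "regular_pair (carrier ?T) (transport_perms \<Delta> (carrier ?T) \<beta> P)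
        (left_translation ?T ` carrier ?T) (transport \<Delta> (carrier ?T) \<beta> ` B)"
      by (rule regular_pair_translations[OF grp])
    then have "HS_on ?T (transport_perms \<Delta> (carrier ?T) \<beta> P)"
      using translation_pair.HS_on[OF translation_pair.intro[OF grp \<beta>(2)] simple ncomm] by simp
    then have "type_HS \<Delta> P"
      unfolding type_HS_def using \<beta>(1) by blast
    then show ?thesis ..
  next
    case False
    let ?H = "power_group ?T l"
    have H: "group ?H" using grp by simp
    obtain \<beta> where \<beta>: "bij_betw \<beta> \<Delta> (carrier ?H)"
      "regular_pair (carrier ?H) (transport_perms \<Delta> (carrier ?H) \<beta> P)
        (left_translation ?H ` carrier ?H) (transport \<Delta> (carrier ?H) \<beta> ` B)"
      using regular_pair_translations[OF H isol] .
    have "HC_on ?T l (transport_perms \<Delta> (carrier ?H) \<beta> P)"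
      using HC_on[OF translation_pair.intro[OF H \<beta>(2)] simple ncomm] False l by simp
    then have "type_HC \<Delta> P"
      unfolding type_HC_def using \<beta>(1) by blast
    then show ?thesis ..
  qed
qed

section \<open>Semiprimitive groups\<close>

locale semiprimitive_group =
  fixes \<Omega> :: "'a set" and G :: "('a \<Rightarrow> 'a) set"
  assumes subgroup_G: "subgroup G (BijGroup \<Omega>)" and semiprimitive: "semiprimitive \<Omega> G"
begin

abbreviation mul (infixl "\<cdot>" 70) where "f \<cdot> g \<equiv> f \<otimes>\<^bsub>BijGroup \<Omega>\<^esub> g"
abbreviation binv where "binv f \<equiv> inv\<^bsub>BijGroup \<Omega>\<^esub> f"

sublocale S: group "BijGroup \<Omega>"
  by (rule group_BijGroup)

sublocale GG: group "perm_group \<Omega> G"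
  using subgroup_G by (rule S.subgroup_imp_group)

lemmas apply_simps = mult_BijGroup_apply inv_BijGroup_closed mult_BijGroup_closed
  inv_BijGroup_apply Bij_closed

lemma G_Bij: "g \<in> G \<Longrightarrow> g \<in> Bij \<Omega>"
  using subgroup_G by (rule subgroup_Bij)

lemma G_closed: "g \<in> G \<Longrightarrow> h \<in> G \<Longrightarrow> g \<cdot> h \<in> G" "g \<in> G \<Longrightarrow> binv g \<in> G"
  using subgroup.m_closed[OF subgroup_G] subgroup.m_inv_closed[OF subgroup_G] by auto

lemma normal_iff:
  "N \<lhd> perm_group \<Omega> G \<longleftrightarrow>
    subgroup N (BijGroup \<Omega>) \<and> N \<subseteq> G \<and> (\<forall>g\<in>G. \<forall>n\<in>N. g \<cdot> n \<cdot> binv g \<in> N)"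
  by (rule S.normal_subgrp_iff[OF subgroup_G])

lemma intransitive_semiregular: "N \<lhd> perm_group \<Omega> G \<Longrightarrow> \<not> transitive \<Omega> N \<Longrightarrow> semiregular \<Omega> N"
  using semiprimitive by (auto simp: semiprimitive_def)

end

locale intransitive_normal = semiprimitive_group +
  fixes N :: "('a \<Rightarrow> 'a) set"
  assumes normal_N: "N \<lhd> perm_group \<Omega> G" and intransitive: "\<not> transitive \<Omega> N"
begin

abbreviation "\<Delta> \<equiv> orbit_set \<Omega> N"

text \<open>Defined on elements rather than cosets, so that it is a homomorphism on \<open>G\<close>
  whose kernel can be examined; \<open>quotient_action\<close> takes the same value on the whole
  coset.\<close>

definition induced :: "('a \<Rightarrow> 'a) \<Rightarrow> 'a set \<Rightarrow> 'a set"
  where "induced g = (\<lambda>B\<in>\<Delta>. g ` B)"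

lemma subgroup_N: "subgroup N (BijGroup \<Omega>)" and N_G: "N \<subseteq> G"
  using normal_N by (simp_all add: normal_iff)

lemma orb_\<Delta>: "x \<in> \<Omega> \<Longrightarrow> orb N x \<in> \<Delta>"
  by (simp add: orbit_set_eq)

lemma \<Delta>E: "B \<in> \<Delta> \<Longrightarrow> (\<And>x. x \<in> \<Omega> \<Longrightarrow> B = orb N x \<Longrightarrow> thesis) \<Longrightarrow> thesis"
  by (auto simp: orbit_set_eq)

lemma \<Delta>_subset: "B \<in> \<Delta> \<Longrightarrow> B \<subseteq> \<Omega>"
  using orb_subset[OF subgroup_N] by (elim \<Delta>E) simp

lemma induced_orb: "g \<in> G \<Longrightarrow> x \<in> \<Omega> \<Longrightarrow> induced g (orb N x) = orb N (g x)"
  using orb_\<Delta> orb_image[OF subgroup_G normal_N] by (simp add: induced_def)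

lemma induced_mult:
  assumes g: "g \<in> G" "h \<in> G" and B: "B \<in> \<Delta>"
  shows "induced (g \<cdot> h) B = induced g (induced h B)"
proof -
  obtain x where x: "x \<in> \<Omega>" "B = orb N x" using B by (rule \<Delta>E)
  then show ?thesis
    using g G_Bij by (simp add: induced_orb G_closed apply_simps)
qed

lemma induced_one: "B \<in> \<Delta> \<Longrightarrow> induced \<one>\<^bsub>BijGroup \<Omega>\<^esub> B = B"
  by (elim \<Delta>E) (simp add: induced_orb subgroup.one_closed[OF subgroup_G])

lemma induced_closed: "g \<in> G \<Longrightarrow> B \<in> \<Delta> \<Longrightarrow> induced g B \<in> \<Delta>"
  by (elim \<Delta>E) (simp add: induced_orb orb_\<Delta> Bij_closed G_Bij)

lemma induced_inv:
  assumes "g \<in> G" "B \<in> \<Delta>"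
  shows "induced (binv g) (induced g B) = B" "induced g (induced (binv g) B) = B"
  using induced_mult[of "binv g" g B] induced_mult[of g "binv g" B] induced_one[of B] assms
    G_closed(2)[of g] G_Bij[of g] by simp_all

lemma induced_Bij: "g \<in> G \<Longrightarrow> induced g \<in> Bij \<Delta>"
proof -
  assume g: "g \<in> G"
  have "bij_betw (induced g) \<Delta> \<Delta>"
    by (rule bij_betw_byWitness[where f' = "induced (binv g)"])
      (use g in \<open>simp_all add: induced_inv image_subset_iff induced_closed G_closed\<close>)
  then show ?thesis
    by (simp add: Bij_def induced_def)
qed

lemma induced_hom: "induced \<in> hom (perm_group \<Omega> G) (BijGroup \<Delta>)"
proof (rule homI)
  show "induced (g \<otimes>\<^bsub>perm_group \<Omega> G\<^esub> h) = induced g \<otimes>\<^bsub>BijGroup \<Delta>\<^esub> induced h"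
    if gh: "g \<in> carrier (perm_group \<Omega> G)" "h \<in> carrier (perm_group \<Omega> G)" for g h
  proof (rule Bij_eqI[where S = \<Delta>])
    show "induced (g \<otimes>\<^bsub>perm_group \<Omega> G\<^esub> h) \<in> Bij \<Delta>" "induced g \<otimes>\<^bsub>BijGroup \<Delta>\<^esub> induced h \<in> Bij \<Delta>"
      using gh by (simp_all add: induced_Bij G_closed mult_BijGroup_closed)
    fix B assume "B \<in> \<Delta>"
    then show "induced (g \<otimes>\<^bsub>perm_group \<Omega> G\<^esub> h) B = (induced g \<otimes>\<^bsub>BijGroup \<Delta>\<^esub> induced h) B"
      using gh mult_BijGroup_apply[OF induced_Bij induced_Bij, of g h B] by (simp add: induced_mult)
  qed
qed (simp add: induced_Bij)

sublocale ind: group_hom "perm_group \<Omega> G" "BijGroup \<Delta>" induced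
  using induced_hom group_BijGroup GG.group_axioms
  by (simp add: group_hom_def group_hom_axioms_def)

lemma induced_eq_one_iff:
  assumes g: "g \<in> G"
  shows "induced g = \<one>\<^bsub>BijGroup \<Delta>\<^esub> \<longleftrightarrow> (\<forall>x\<in>\<Omega>. orb N (g x) = orb N x)"
proof
  assume eq: "induced g = \<one>\<^bsub>BijGroup \<Delta>\<^esub>"
  show "\<forall>x\<in>\<Omega>. orb N (g x) = orb N x"
  proof
    fix x assume x: "x \<in> \<Omega>"
    have "induced g (orb N x) = orb N x"
      unfolding eq by (rule one_BijGroup_apply[OF orb_\<Delta>[OF x]])
    then show "orb N (g x) = orb N x"
      using induced_orb[OF g x] by simp
  qed
next
  assume *: "\<forall>x\<in>\<Omega>. orb N (g x) = orb N x"
  show "induced g = \<one>\<^bsub>BijGroup \<Delta>\<^esub>"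
  proof (rule Bij_eqI[OF induced_Bij[OF g]])
    show "\<one>\<^bsub>BijGroup \<Delta>\<^esub> \<in> Bij \<Delta>"
      using ind.H.one_closed by (simp only: carrier_BijGroup)
    fix B assume B: "B \<in> \<Delta>"
    obtain x where "x \<in> \<Omega>" "B = orb N x" using B by (rule \<Delta>E)
    then have "induced g B = B"
      using * induced_orb[OF g] by simp
    then show "induced g B = \<one>\<^bsub>BijGroup \<Delta>\<^esub> B"
      using one_BijGroup_apply[OF B] by simp
  qed
qed

lemma nonempty: "\<exists>x. x \<in> \<Omega>"
  using intransitive subgroup_N by (auto simp: transitive_iff)

text \<open>The kernel contains \<open>N\<close> and is intransitive, hence semiregular. A kernel
  element agrees at a point with some element of \<open>N\<close>, and semiregularity makes the two
  equal.\<close>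

lemma induced_eq_one: "g \<in> G \<Longrightarrow> induced g = \<one>\<^bsub>BijGroup \<Delta>\<^esub> \<longleftrightarrow> g \<in> N"
proof -
  let ?K = "kernel (perm_group \<Omega> G) (BijGroup \<Delta>) induced"
  have K: "?K \<lhd> perm_group \<Omega> G" by (rule ind.normal_kernel)
  have K_iff: "g \<in> ?K \<longleftrightarrow> g \<in> G \<and> (\<forall>x\<in>\<Omega>. orb N (g x) = orb N x)" for g
    using induced_eq_one_iff by (auto simp: kernel_def)
  have NK: "N \<subseteq> ?K"
    using N_G orb_eq[OF subgroup_N] K_iff by blast
  \<comment> \<open>The kernel preserves every \<open>N\<close>-orbit, so its transitivity would
    force that of \<open>N\<close>.\<close>
  have "\<not> transitive \<Omega> ?K"
  proof
    assume tr: "transitive \<Omega> ?K"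
    have "\<exists>n\<in>N. n x = y" if xy: "x \<in> \<Omega>" "y \<in> \<Omega>" for x y
    proof -
      obtain k where k: "k \<in> ?K" "k x = y"
        using tr xy unfolding transitive_iff by blast
      then have "orb N y = orb N x"
        using K_iff[of k] xy by auto
      then show ?thesis
        using orb_self[OF subgroup_N xy(2)] by (auto simp: orb_def)
    qed
    then show False
      using intransitive subgroup_N by (simp add: transitive_iff)
  qed
  then have semireg: "semiregular \<Omega> ?K"
    using intransitive_semiregular[OF K] by blast
  have subK: "subgroup ?K (BijGroup \<Omega>)"
    using K by (simp add: normal_iff)
  obtain x where x: "x \<in> \<Omega>" using nonempty by blast
  have "g \<in> N" if g: "g \<in> ?K" for g
  proof -
    have "g \<in> G" and "orb N (g x) = orb N x"
      using K_iff[of g] g x by auto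
    then have "g x \<in> orb N x"
      using orb_self[OF subgroup_N, of "g x"] x G_Bij Bij_closed by metis
    then obtain n where "n \<in> N" "g x = n x"
      by (auto simp: orb_def)
    then show ?thesis
      using semiregular_eqI[OF semireg subK g _ x] NK by blast
  qed
  then have "?K = N"
    using NK by blast
  then show "g \<in> G \<Longrightarrow> induced g = \<one>\<^bsub>BijGroup \<Delta>\<^esub> \<longleftrightarrow> g \<in> N"
    by (auto simp: kernel_def)
qed

lemma induced_eq_iff:
  assumes g: "g \<in> G" "h \<in> G"
  shows "induced g = induced h \<longleftrightarrow> g \<cdot> binv h \<in> N"
proof -
  have gh: "g \<cdot> binv h \<in> G"
    using g by (simp add: G_closed)
  have Bij: "induced g \<in> Bij \<Delta>" "induced h \<in> Bij \<Delta>"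
    using g by (simp_all add: induced_Bij)
  have inv: "inv\<^bsub>perm_group \<Omega> G\<^esub> h = binv h"
    using S.m_inv_consistent[OF subgroup_G g(2)] .
  have "induced (g \<cdot> binv h) = induced g \<otimes>\<^bsub>BijGroup \<Delta>\<^esub> inv\<^bsub>BijGroup \<Delta>\<^esub> induced h"
    using ind.hom_mult[of g "binv h"] ind.hom_inv[of h] g G_closed(2)[OF g(2)] inv by simp
  moreover have "induced g \<otimes>\<^bsub>BijGroup \<Delta>\<^esub> inv\<^bsub>BijGroup \<Delta>\<^esub> induced h = \<one>\<^bsub>BijGroup \<Delta>\<^esub>
      \<longleftrightarrow> induced g = induced h"
    using ind.H.inv_solve_right'[of "\<one>\<^bsub>BijGroup \<Delta>\<^esub>" "induced g" "induced h"] Bij ind.H.one_closed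
    unfolding carrier_BijGroup by auto
  ultimately show ?thesis
    using induced_eq_one[OF gh] by (simp only:)
qed

lemma quotient_action_coset:
  assumes g: "g \<in> G"
  shows "quotient_action \<Omega> N (N #>\<^bsub>perm_group \<Omega> G\<^esub> g) = induced g"
proof -
  have "(\<Union>c\<in>N #>\<^bsub>perm_group \<Omega> G\<^esub> g. c ` B) = g ` B" if B: "B \<in> \<Delta>" for B
  proof -
    obtain x where x: "x \<in> \<Omega>" "B = orb N x" using B by (rule \<Delta>E)
    have "(n \<cdot> g) ` B = g ` B" if n: "n \<in> N" for n
    proof -
      have nG: "n \<in> G" using n N_G by blast
      have gx: "g x \<in> \<Omega>" using Bij_closed[OF G_Bij[OF g] x(1)] .
      have "(n \<cdot> g) ` B = orb N ((n \<cdot> g) x)"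
        using orb_image[OF subgroup_G normal_N G_closed(1)[OF nG g] x(1)] x(2) by simp
      also have "(n \<cdot> g) x = n (g x)"
        using G_Bij[OF nG] G_Bij[OF g] x by (simp add: apply_simps)
      also have "orb N (n (g x)) = g ` B"
        using orb_eq[OF subgroup_N n gx] orb_image[OF subgroup_G normal_N g x(1)] x(2) by simp
      finally show ?thesis .
    qed
    moreover have "N #>\<^bsub>perm_group \<Omega> G\<^esub> g = (\<lambda>n. n \<cdot> g) ` N"
      by (auto simp: r_coset_def)
    moreover have "N \<noteq> {}"
      using subgroup.one_closed[OF subgroup_N] by blast
    ultimately show ?thesis by simp
  qed
  then show ?thesis
    unfolding quotient_action_def induced_def by (intro restrict_ext)
qed

lemma quotient_perms_eq: "quotient_perms \<Omega> G N = induced ` G"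
  unfolding quotient_perms_def carrier_FactGroup image_image
  using quotient_action_coset by (intro image_cong) auto

lemma faithful: "faithful_action (perm_group \<Omega> G Mod N) \<Delta> (quotient_action \<Omega> N)"
proof -
  interpret normal N "perm_group \<Omega> G" by (rule normal_N)
  let ?Q = "perm_group \<Omega> G Mod N"
  have carrier: "\<exists>g\<in>G. C = N #>\<^bsub>perm_group \<Omega> G\<^esub> g" if "C \<in> carrier ?Q" for C
    using that unfolding carrier_FactGroup by auto
  have "quotient_action \<Omega> N \<in> hom ?Q (BijGroup \<Delta>)"
  proof (rule homI)
    show "quotient_action \<Omega> N C \<in> carrier (BijGroup \<Delta>)" if C: "C \<in> carrier ?Q" for C
      using carrier[OF C] quotient_action_coset induced_Bij by (auto simp only: carrier_BijGroup)
    fix C D assume "C \<in> carrier ?Q" "D \<in> carrier ?Q"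
    then obtain g h where gh: "g \<in> G" "C = N #>\<^bsub>perm_group \<Omega> G\<^esub> g" "h \<in> G" "D = N #>\<^bsub>perm_group \<Omega> G\<^esub> h"
      using carrier by blast
    have "C \<otimes>\<^bsub>?Q\<^esub> D = N #>\<^bsub>perm_group \<Omega> G\<^esub> (g \<otimes>\<^bsub>perm_group \<Omega> G\<^esub> h)"
      using rcos_sum[of g h] gh by simp
    also have "quotient_action \<Omega> N \<dots> = induced g \<otimes>\<^bsub>BijGroup \<Delta>\<^esub> induced h"
      using quotient_action_coset[of "g \<cdot> h"] ind.hom_mult[of g h] gh by (simp add: G_closed)
    finally show "quotient_action \<Omega> N (C \<otimes>\<^bsub>?Q\<^esub> D) =
        quotient_action \<Omega> N C \<otimes>\<^bsub>BijGroup \<Delta>\<^esub> quotient_action \<Omega> N D"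
      unfolding gh(2,4) quotient_action_coset[OF gh(1)] quotient_action_coset[OF gh(3)] .
  qed
  moreover have "inj_on (quotient_action \<Omega> N) (carrier ?Q)"
  proof (rule inj_onI)
    fix C D assume "C \<in> carrier ?Q" "D \<in> carrier ?Q" and eq: "quotient_action \<Omega> N C = quotient_action \<Omega> N D"
    then obtain g h where gh: "g \<in> G" "C = N #>\<^bsub>perm_group \<Omega> G\<^esub> g" "h \<in> G" "D = N #>\<^bsub>perm_group \<Omega> G\<^esub> h"
      using carrier by blast
    have "induced g = induced h"
      using eq unfolding gh(2,4) quotient_action_coset[OF gh(1)] quotient_action_coset[OF gh(3)] .
    then have "g \<cdot> binv h \<in> N"
      using induced_eq_iff gh by blast
    then have "g \<in> N #>\<^bsub>perm_group \<Omega> G\<^esub> h"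
      using rcos_module_rev[OF GG.group_axioms, of h g] gh S.m_inv_consistent[OF subgroup_G gh(3)] by simp
    then show "C = D"
      using GG.repr_independence[OF _ _ is_subgroup, of g h] gh by simp
  qed
  ultimately show ?thesis
    using factorgroup_is_group group_BijGroup
    by (simp add: faithful_action_def faithful_action_axioms_def group_action_def group_hom_def group_hom_axioms_def)
qed

lemma transitive_induced:
  assumes M: "transitive \<Omega> M" "M \<subseteq> G"
  shows "transitive \<Delta> (induced ` M)"
proof -
  have "subgroup M (perm_group \<Omega> G)"
    using M S.subgroup_incl[OF _ subgroup_G] by (simp add: transitive_iff)
  then have "subgroup (induced ` M) (BijGroup \<Delta>)"
    by (rule ind.subgroup_img_is_subgroup)
  then show ?thesis
    unfolding transitive_iff
  proof (intro conjI ballI)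
    fix B C assume BC: "B \<in> \<Delta>" "C \<in> \<Delta>"
    obtain x y where xy: "x \<in> \<Omega>" "B = orb N x" "y \<in> \<Omega>" "C = orb N y"
      using BC unfolding orbit_set_eq by blast
    obtain m where m: "m \<in> M" "m x = y"
      using M(1) xy unfolding transitive_iff by blast
    then have "induced m B = C"
      using induced_orb[of m x] xy M(2) by auto
    then show "\<exists>g\<in>induced ` M. g B = C" using m(1) by blast
  qed
qed

end

section \<open>Pairs of distinct plinths\<close>

locale plinth_pair = semiprimitive_group +
  fixes L R :: "('a \<Rightarrow> 'a) set"
  assumes plinth_L: "plinth \<Omega> G L" and plinth_R: "plinth \<Omega> G R" and distinct: "L \<noteq> R"
begin

lemma swapped: "plinth_pair \<Omega> G R L"
  by unfold_locales (use plinth_L plinth_R distinct in auto)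

lemma normal_L: "L \<lhd> perm_group \<Omega> G" and transitive_L: "transitive \<Omega> L"
  and normal_R: "R \<lhd> perm_group \<Omega> G" and transitive_R: "transitive \<Omega> R"
  using plinth_L plinth_R by (auto simp: plinth_def)

lemma L_G: "L \<subseteq> G" and R_G: "R \<subseteq> G"
  using normal_L normal_R by (auto simp: normal_iff)

lemma normal_Int: "L \<inter> R \<lhd> perm_group \<Omega> G"
  using GG.normal_subgroup_intersect[OF normal_L normal_R] .

text \<open>A transitive intersection, being normal in \<open>G\<close>, could not be proper in
  either plinth, and the plinths would coincide.\<close>

lemma intransitive_Int: "\<not> transitive \<Omega> (L \<inter> R)"
proof
  assume tr: "transitive \<Omega> (L \<inter> R)"
  have "L \<subseteq> R" "R \<subseteq> L"
    using plinth_L plinth_R tr normal_Int unfolding plinth_def by blast+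
  then show False using distinct by blast
qed

sublocale intransitive_normal \<Omega> G "L \<inter> R"
  by (rule intransitive_normal.intro[OF semiprimitive_group_axioms
        intransitive_normal_axioms.intro[OF normal_Int intransitive_Int]])

lemma induced_disjoint: "induced ` L \<inter> induced ` R = {\<one>\<^bsub>BijGroup \<Delta>\<^esub>}"
proof
  show "induced ` L \<inter> induced ` R \<subseteq> {\<one>\<^bsub>BijGroup \<Delta>\<^esub>}"
  proof
    fix p assume "p \<in> induced ` L \<inter> induced ` R"
    then obtain l r where lr: "l \<in> L" "r \<in> R" "p = induced l" "induced l = induced r" by auto
    then have lrG: "l \<in> G" "r \<in> G" using L_G R_G by auto
    then have "l \<cdot> binv r \<in> L \<inter> R"
      using induced_eq_iff lr(4) by blast
    then have "l \<cdot> binv r \<cdot> r \<in> R"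
      using lr(2) subgroup.m_closed[of R "BijGroup \<Omega>"] normal_R by (auto simp: normal_iff)
    then have "l \<in> R"
      using G_Bij[OF lrG(1)] G_Bij[OF lrG(2)] by (simp add: S.m_assoc inv_BijGroup_closed)
    then show "p \<in> {\<one>\<^bsub>BijGroup \<Delta>\<^esub>}"
      using induced_eq_one[OF lrG(1)] lr(1,3) by simp
  qed
  have "\<one>\<^bsub>BijGroup \<Omega>\<^esub> \<in> L" "\<one>\<^bsub>BijGroup \<Omega>\<^esub> \<in> R"
    using normal_L normal_R by (auto simp: normal_iff intro: subgroup.one_closed)
  moreover have "induced \<one>\<^bsub>BijGroup \<Omega>\<^esub> = \<one>\<^bsub>BijGroup \<Delta>\<^esub>"
    using ind.hom_one by simp
  ultimately show "{\<one>\<^bsub>BijGroup \<Delta>\<^esub>} \<subseteq> induced ` L \<inter> induced ` R"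
    by (metis IntI empty_subsetI imageI insert_subset)
qed

lemma induced_subgroup_G: "subgroup (induced ` G) (BijGroup \<Delta>)"
  using ind.subgroup_img_is_subgroup[OF GG.subgroup_self] by simp

lemma induced_normal:
  assumes "M \<lhd> perm_group \<Omega> G"
  shows "induced ` M \<lhd> perm_group \<Delta> (induced ` G)"
proof (rule normal.surj_hom_normal_subgroup[OF assms])
  have "group (perm_group \<Delta> (induced ` G))"
    using group.subgroup_imp_group[OF group_BijGroup induced_subgroup_G] .
  then show "group_hom (perm_group \<Omega> G) (perm_group \<Delta> (induced ` G)) induced"
    using induced_hom GG.group_axioms
    by (simp add: group_hom_def group_hom_axioms_def hom_def Pi_iff)
qed simp

text \<open>The images of \<open>L\<close> and \<open>R\<close> are normal and meet trivially. The
  relation is kept on elements of \<open>G\<close> because the primitivity argument works with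
  preimages.\<close>

lemma induced_commute:
  assumes "l \<in> L" "r \<in> R"
  shows "induced (l \<cdot> r) = induced (r \<cdot> l)"
proof -
  interpret P: group "perm_group \<Delta> (induced ` G)"
    using group.subgroup_imp_group[OF group_BijGroup induced_subgroup_G] .
  have "induced l \<otimes>\<^bsub>BijGroup \<Delta>\<^esub> induced r = induced r \<otimes>\<^bsub>BijGroup \<Delta>\<^esub> induced l"
    using P.normal_imp_commuting[OF induced_normal[OF normal_L] induced_normal[OF normal_R] _
        imageI[OF assms(1)] imageI[OF assms(2)]] induced_disjoint by simp
  moreover have "l \<in> G" "r \<in> G"
    using assms L_G R_G by auto
  ultimately show ?thesis
    using ind.hom_mult[of l r] ind.hom_mult[of r l] by simp
qed

text \<open>
  The kernel \<open>K\<close> of \<open>G\<close> on a block system is intransitive, hence semiregular. Two points in the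
  same block are related by some \<open>l \<in> L\<close> and some \<open>r \<in> R\<close>; as \<open>L\<close> and \<open>R\<close> commute modulo
  \<open>L \<inter> R\<close>, both lie in \<open>K\<close>, so \<open>l = r\<close>.
\<close>

lemma primitive_quotient: "primitive \<Delta> (induced ` G)"
  unfolding primitive_def
proof (intro conjI allI impI)
  show "transitive \<Delta> (induced ` G)"
    using transitive_induced[of G] semiprimitive by (simp add: semiprimitive_def)
  fix \<B> assume *: "partition_on \<Delta> \<B> \<and> (\<forall>p\<in>induced ` G. \<forall>B\<in>\<B>. p ` B \<in> \<B>)"
  then have part: "\<Union>\<B> = \<Delta>" "{} \<notin> \<B>"
    and block: "\<And>b c. b \<in> \<B> \<Longrightarrow> c \<in> \<B> \<Longrightarrow> b \<inter> c \<noteq> {} \<Longrightarrow> b = c"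
    and inv: "\<And>g b. g \<in> G \<Longrightarrow> b \<in> \<B> \<Longrightarrow> induced g ` b \<in> \<B>"
    by (auto simp: partition_on_def disjoint_def)
  have sub: "b \<subseteq> \<Delta>" if "b \<in> \<B>" for b using that part by blast
  have im_mult: "induced (g \<cdot> h) ` b = induced g ` induced h ` b"
    if "g \<in> G" "h \<in> G" "b \<in> \<B>" for g h b
    unfolding image_image
    by (rule image_cong[OF refl]) (rule induced_mult[OF that(1,2)], use sub[OF that(3)] in blast)
  have im_one: "induced \<one>\<^bsub>BijGroup \<Omega>\<^esub> ` b = b" if "b \<in> \<B>" for b
  proof -
    have "induced \<one>\<^bsub>BijGroup \<Omega>\<^esub> ` b = (\<lambda>B. B) ` b"
      by (rule image_cong[OF refl]) (rule induced_one, use sub[OF that] in blast)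
    then show ?thesis by simp
  qed
  have im_inv: "induced (binv g) ` induced g ` b = b" "induced g ` induced (binv g) ` b = b"
    if "g \<in> G" "b \<in> \<B>" for g b
    using im_mult[OF G_closed(2)[OF that(1)] that] im_mult[OF that(1) G_closed(2)[OF that(1)] that(2)]
      im_one[OF that(2)] G_Bij[OF that(1)] by simp_all
  define K where "K = {g \<in> G. \<forall>b\<in>\<B>. induced g ` b = b}"
  have "subgroup K (BijGroup \<Omega>)"
  proof (rule S.subgroupI)
    show "K \<subseteq> carrier (BijGroup \<Omega>)" using G_Bij by (auto simp: K_def)
    show "K \<noteq> {}"
      using im_one subgroup.one_closed[OF subgroup_G] unfolding K_def by blast
    show "binv g \<in> K" if "g \<in> K" for g
    proof -
      have "induced (binv g) ` b = b" if "b \<in> \<B>" for b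
        using im_inv(1)[of g b] \<open>g \<in> K\<close> that by (simp add: K_def)
      then show ?thesis using that G_closed by (simp add: K_def)
    qed
    show "g \<cdot> h \<in> K" if "g \<in> K" "h \<in> K" for g h
      using that im_mult by (simp add: K_def G_closed)
  qed
  moreover have "g \<cdot> k \<cdot> binv g \<in> K" if g: "g \<in> G" and k: "k \<in> K" for g k
  proof -
    have kG: "k \<in> G" using k by (simp add: K_def)
    have "induced (g \<cdot> k \<cdot> binv g) ` b = b" if b: "b \<in> \<B>" for b
    proof -
      have c: "induced (binv g) ` b \<in> \<B>" using inv[OF G_closed(2)[OF g] b] .
      have "induced (g \<cdot> k \<cdot> binv g) ` b = induced g ` induced k ` induced (binv g) ` b"
        using im_mult[OF G_closed(1)[OF g kG] G_closed(2)[OF g] b] im_mult[OF g kG c] by simp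
      also have "induced k ` induced (binv g) ` b = induced (binv g) ` b"
        using k c by (simp add: K_def)
      finally show ?thesis using im_inv(2)[OF g b] by simp
    qed
    then show ?thesis using g kG by (simp add: K_def G_closed)
  qed
  ultimately have K: "K \<lhd> perm_group \<Omega> G" "subgroup K (BijGroup \<Omega>)"
    by (auto simp: normal_iff K_def)
  show "\<B> = {\<Delta>} \<or> \<B> = (\<lambda>x. {x}) ` \<Delta>"
  proof (rule disjCI)
    assume no: "\<B> \<noteq> (\<lambda>x. {x}) ` \<Delta>"
    have "transitive \<Omega> K"
    proof (rule ccontr)
      assume "\<not> transitive \<Omega> K"
      then have semireg: "semiregular \<Omega> K"
        using intransitive_semiregular[OF K(1)] by blast
      \<comment> \<open>An element fixing one block fixes all of them if it commutes, modulo the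
        intersection, with a transitive group: move block \<open>b\<close> to block \<open>c\<close>
        by some \<open>v\<close> and exchange \<open>u\<close> with \<open>v\<close>.\<close>
      have in_K: "u \<in> K"
        if u: "u \<in> G" "b \<in> \<B>" "induced u ` b = b" and V: "transitive \<Omega> V" "V \<subseteq> G"
          and comm: "\<And>v. v \<in> V \<Longrightarrow> induced (u \<cdot> v) = induced (v \<cdot> u)" for u b V
      proof -
        have "induced u ` c = c" if c: "c \<in> \<B>" for c
        proof -
          obtain B C where BC: "B \<in> b" "C \<in> c" using part(2) u(2) c by fastforce
          then have "B \<in> \<Delta>" "C \<in> \<Delta>" using sub u(2) c by blast+
          then obtain v where v: "v \<in> V" "induced v B = C"
            using transitive_induced[OF V] unfolding transitive_iff by blast
          have vG: "v \<in> G" using v V by blast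
          have "C \<in> induced v ` b \<inter> c" using BC v(2) by blast
          then have bc: "induced v ` b = c"
            using block[OF inv[OF vG u(2)] c] by blast
          have "induced u ` c = induced (u \<cdot> v) ` b"
            using im_mult[OF u(1) vG u(2)] bc by simp
          also have "\<dots> = induced v ` induced u ` b"
            using im_mult[OF vG u(1,2)] comm[OF v(1)] by simp
          finally show ?thesis using u(3) bc by simp
        qed
        then show ?thesis using u(1) by (simp add: K_def)
      qed
      have single: "B = C" if b: "b \<in> \<B>" "B \<in> b" "C \<in> b" for b B C
      proof -
        have "B \<in> \<Delta>" "C \<in> \<Delta>" using sub b by blast+
        then obtain x y where xy: "x \<in> \<Omega>" "B = orb (L \<inter> R) x" "y \<in> \<Omega>" "C = orb (L \<inter> R) y"
          unfolding orbit_set_eq by blast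
        have fix_b: "induced u ` b = b" if "u \<in> G" "u x = y" for u
        proof -
          have "induced u B = C" using induced_orb[of u x] that xy by simp
          then have "C \<in> induced u ` b \<inter> b" using b by blast
          then show ?thesis using block[OF inv[OF that(1) b(1)] b(1)] by blast
        qed
        obtain l where l: "l \<in> L" "l x = y"
          using transitive_L xy unfolding transitive_iff by blast
        obtain r where r: "r \<in> R" "r x = y"
          using transitive_R xy unfolding transitive_iff by blast
        have G: "l \<in> G" "r \<in> G" using l r L_G R_G by auto
        \<comment> \<open>The transitive group that \<open>l\<close> commutes with is
          \<open>R\<close>; for \<open>r\<close> it is \<open>L\<close>.\<close>
        have "l \<in> K"
          using in_K[OF G(1) b(1) fix_b[OF G(1) l(2)] transitive_R R_G] induced_commute[OF l(1)] by blast
        moreover have "r \<in> K"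
          using in_K[OF G(2) b(1) fix_b[OF G(2) r(2)] transitive_L L_G] induced_commute[OF _ r(1)] by metis
        ultimately have "l = r"
          using semiregular_eqI[OF semireg K(2) _ _ xy(1)] l(2) r(2) by simp
        then have "y \<in> orb (L \<inter> R) x"
          using l r orbI[of l "L \<inter> R" x] by simp
        then show ?thesis
          using orb_eq_iff[OF subgroup_N xy(1,3)] xy by simp
      qed
      have "\<B> = (\<lambda>x. {x}) ` \<Delta>"
      proof
        show "\<B> \<subseteq> (\<lambda>x. {x}) ` \<Delta>"
        proof
          fix b assume b: "b \<in> \<B>"
          then obtain B where B: "B \<in> b" using part(2) by fastforce
          then have "b = {B}" using single[OF b] by blast
          then show "b \<in> (\<lambda>x. {x}) ` \<Delta>" using B sub[OF b] by blast
        qed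
        show "(\<lambda>x. {x}) ` \<Delta> \<subseteq> \<B>"
        proof clarify
          fix B assume "B \<in> \<Delta>"
          then obtain b where b: "b \<in> \<B>" "B \<in> b" using part(1) by blast
          then have "b = {B}" using single[OF b(1)] by blast
          then show "{B} \<in> \<B>" using b by simp
        qed
      qed
      then show False using no by simp
    qed
    then have tr: "\<exists>k\<in>K. k x = y" if "x \<in> \<Omega>" "y \<in> \<Omega>" for x y
      using that unfolding transitive_iff by blast
    \<comment> \<open>\<open>K\<close> is transitive and fixes \<open>b\<close> as a set, so it
      moves a member of \<open>b\<close> to every orbit without leaving \<open>b\<close>.\<close>
    have all: "b = \<Delta>" if b: "b \<in> \<B>" for b
    proof
      show "b \<subseteq> \<Delta>" using sub[OF b] .
      obtain B where B: "B \<in> b" using part(2) b by fastforce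
      then have "B \<in> \<Delta>" using sub[OF b] by blast
      then obtain x where x: "x \<in> \<Omega>" "B = orb (L \<inter> R) x" by (rule \<Delta>E)
      show "\<Delta> \<subseteq> b"
      proof
        fix C assume "C \<in> \<Delta>"
        then obtain y where y: "y \<in> \<Omega>" "C = orb (L \<inter> R) y" by (rule \<Delta>E)
        obtain k where k: "k \<in> K" "k x = y" using tr[OF x(1) y(1)] by blast
        have "induced k B = C" "induced k ` b = b"
          using k x y b induced_orb[of k x] by (simp_all add: K_def)
        then show "C \<in> b" using B by blast
      qed
    qed
    obtain x where "x \<in> \<Omega>" using nonempty by blast
    then have "\<B> \<noteq> {}" using orb_\<Delta> part(1) by blast
    then show "\<B> = {\<Delta>}" using all by blast
  qed
qed

lemma induced_nontrivial: "induced ` L \<noteq> {\<one>\<^bsub>BijGroup \<Delta>\<^esub>}"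
proof
  assume *: "induced ` L = {\<one>\<^bsub>BijGroup \<Delta>\<^esub>}"
  have "L \<subseteq> L \<inter> R"
  proof
    fix l assume l: "l \<in> L"
    then have "induced l = \<one>\<^bsub>BijGroup \<Delta>\<^esub>" using * by blast
    then show "l \<in> L \<inter> R" using induced_eq_one l L_G by blast
  qed
  then have "L \<inter> R = L" by blast
  then show False using intransitive transitive_L by simp
qed

sublocale Q: regular_pair \<Delta> "induced ` G" "induced ` L" "induced ` R"
  by (rule regular_pair.intro)
    (rule induced_subgroup_G primitive_quotient induced_normal normal_L normal_R
      transitive_induced transitive_L transitive_R L_G R_G induced_disjoint induced_nontrivial)+

lemma quotient_iso_L: "perm_group \<Omega> L Mod (L \<inter> R) \<cong> perm_group \<Delta> (induced ` L)"
proof -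
  have L: "subgroup L (perm_group \<Omega> G)"
    using normal_L by (rule normal_imp_subgroup)
  have "group (perm_group \<Delta> (induced ` L))"
    using group.subgroup_imp_group[OF group_BijGroup Q.subgroup_A] .
  then interpret h: group_hom "perm_group \<Omega> L" "perm_group \<Delta> (induced ` L)" induced
    using GG.subgroup_imp_group[OF L] induced_hom L_G
    by (auto simp: group_hom_def group_hom_axioms_def hom_def)
  have "kernel (perm_group \<Omega> L) (perm_group \<Delta> (induced ` L)) induced = L \<inter> R"
  proof -
    have "l \<in> R \<longleftrightarrow> induced l = \<one>\<^bsub>BijGroup \<Delta>\<^esub>" if "l \<in> L" for l
      using induced_eq_one[of l] that L_G by blast
    then show ?thesis
      unfolding kernel_def by auto
  qed
  then show ?thesis
    using h.FactGroup_iso by simp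
qed

lemma group_quotient_L: "group (perm_group \<Omega> L Mod (L \<inter> R))"
proof (rule normal.factorgroup_is_group)
  have "L \<inter> R \<lhd> subgrp (perm_group \<Omega> G) L"
    using GG.normal_restrict_supergroup[OF normal_imp_subgroup[OF normal_L] normal_N] by simp
  then show "L \<inter> R \<lhd> perm_group \<Omega> L" by simp
qed

lemma quotient_swap: "perm_group \<Omega> L Mod (L \<inter> R) \<cong> perm_group \<Omega> R Mod (L \<inter> R)"
proof -
  interpret swap: plinth_pair \<Omega> G R L by (rule swapped)
  have eq: "swap.induced = induced"
    unfolding swap.induced_def induced_def by (simp only: Int_commute)
  have R: "perm_group \<Omega> R Mod (L \<inter> R) \<cong> perm_group \<Delta> (induced ` R)"
    using swap.quotient_iso_L unfolding eq by (simp only: Int_commute)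
  have gR: "group (perm_group \<Omega> R Mod (L \<inter> R))"
    using swap.group_quotient_L by (simp only: Int_commute)
  have AB: "perm_group \<Delta> (induced ` L) \<cong> perm_group \<Delta> (induced ` R)"
    using Q.A_iso_B by simp
  show ?thesis
    using iso_trans[OF iso_trans[OF quotient_iso_L AB] group.iso_sym[OF gR R]] .
qed

lemma char_simple_quotient: "char_simple_group (perm_group \<Omega> L Mod (L \<inter> R))"
  using char_simple_group_iso[OF Q.char_simple_A quotient_iso_L group_quotient_L] .

text \<open>The image of \<open>M\<close> is normal in the induced group and lies in the minimal
  normal image of \<open>L\<close>; pulling back is safe because \<open>M\<close> contains the
  kernel. In other words, \<open>L\<close> modulo \<open>L \<inter> R\<close> is a chief factor of
  \<open>G\<close>.\<close>

lemma chief: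
  assumes M: "M \<lhd> perm_group \<Omega> G" "L \<inter> R \<subseteq> M" "M \<subseteq> L"
  shows "M = L \<inter> R \<or> M = L"
proof -
  have "induced ` M = {\<one>\<^bsub>BijGroup \<Delta>\<^esub>} \<or> induced ` M = induced ` L"
    using Q.minimal_A induced_normal[OF M(1)] image_mono[OF M(3), of induced]
    unfolding minimal_normal_def by simp
  then show ?thesis
  proof
    assume *: "induced ` M = {\<one>\<^bsub>BijGroup \<Delta>\<^esub>}"
    have "M \<subseteq> L \<inter> R"
    proof
      fix m assume m: "m \<in> M"
      then have "induced m = \<one>\<^bsub>BijGroup \<Delta>\<^esub>" using * by blast
      then show "m \<in> L \<inter> R" using induced_eq_one m M(3) L_G by blast
    qed
    then show ?thesis using M(2) by blast
  next
    assume *: "induced ` M = induced ` L"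
    have "L \<subseteq> M"
    proof
      fix l assume l: "l \<in> L"
      then have "induced l \<in> induced ` M" using * by blast
      then obtain m where m: "m \<in> M" "induced l = induced m" by blast
      have G: "l \<in> G" "m \<in> G" using l m M(3) L_G by auto
      then have "l \<cdot> binv m \<in> M"
        using induced_eq_iff m(2) M(2) by blast
      then have "l \<cdot> binv m \<cdot> m \<in> M"
        using m(1) M(1) subgroup.m_closed[of M "BijGroup \<Omega>"] by (simp add: normal_iff)
      then show "l \<in> M"
        using G_Bij[OF G(1)] G_Bij[OF G(2)] by (simp add: S.m_assoc inv_BijGroup_closed)
    qed
    then show ?thesis using M(3) by blast
  qed
qed

end

section \<open>Comparing the quotients that belong to different pairs of plinths\<close>

context semiprimitive_group
begin

lemma plinth_pairI: "plinth \<Omega> G L \<Longrightarrow> plinth \<Omega> G R \<Longrightarrow> L \<noteq> R \<Longrightarrow> plinth_pair \<Omega> G L R"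
  by (simp add: plinth_pair_def plinth_pair_axioms_def semiprimitive_group_axioms)

text \<open>The product is normal in \<open>G\<close> and lies between \<open>U \<inter> V\<close>
  and \<open>U\<close>, so by the chief factor property it is one of the two. If it were
  \<open>U \<inter> V\<close>, then \<open>U \<inter> W\<close> would lie in
  \<open>U \<inter> V\<close>, and the chief factor property for \<open>W\<close> would make these
  equal or give \<open>U \<inter> V = U\<close>; neither is possible.\<close>

lemma plinth_Int_mult:
  assumes "plinth \<Omega> G U" "plinth \<Omega> G V" "plinth \<Omega> G W" "U \<noteq> V" "U \<noteq> W" "U \<inter> V \<noteq> U \<inter> W"
  shows "(U \<inter> V) <#>\<^bsub>BijGroup \<Omega>\<^esub> (U \<inter> W) = U"
proof -
  interpret UV: plinth_pair \<Omega> G U V using assms by (intro plinth_pairI)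
  interpret UW: plinth_pair \<Omega> G U W using assms by (intro plinth_pairI)
  let ?M = "(U \<inter> V) <#>\<^bsub>BijGroup \<Omega>\<^esub> (U \<inter> W)"
  have "?M = (U \<inter> V) <#>\<^bsub>perm_group \<Omega> G\<^esub> (U \<inter> W)" by simp
  also have "\<dots> = generate (perm_group \<Omega> G) (U \<inter> V \<union> U \<inter> W)"
    using GG.set_mult_eq_generate[OF UV.normal_N normal_imp_subgroup[OF UW.normal_N]] .
  finally have gen: "?M = generate (perm_group \<Omega> G) (U \<inter> V \<union> U \<inter> W)" .
  have sub: "U \<inter> V \<subseteq> ?M" "U \<inter> W \<subseteq> ?M"
    unfolding gen by (auto intro: generate.incl)
  have MU: "?M \<subseteq> U"
    unfolding gen using normal_imp_subgroup[OF UV.normal_L] by (intro GG.generate_subgroup_incl) auto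
  have norm: "?M \<lhd> perm_group \<Omega> G"
    using GG.normal_subgroup_set_mult_closed[OF UV.normal_N UW.normal_N] by simp
  have "?M \<noteq> U \<inter> V"
  proof
    assume "?M = U \<inter> V"
    then have "U \<inter> W \<subseteq> U \<inter> V" using sub by simp
    then have "U \<inter> V = U \<inter> W \<or> U \<inter> V = U"
      using UW.chief[OF UV.normal_N] by blast
    then show False
      using assms(6) UV.intransitive UV.transitive_L by auto
  qed
  then show ?thesis
    using UV.chief[OF norm sub(1) MU] by blast
qed

text \<open>When the intersections differ, \<open>R = AC\<close> and \<open>S = BC\<close> for
  \<open>A\<close>, \<open>B\<close>, \<open>C\<close> as named in the proof, so \<open>R/A\<close>
  and \<open>S/B\<close> are both isomorphic to \<open>C/D\<close>. Exchanging the two plinths of a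
  pair replaces them by \<open>L/A\<close> and \<open>L/B\<close>.\<close>

lemma plinth_three_quotients:
  assumes plinth: "plinth \<Omega> G L" "plinth \<Omega> G R" "plinth \<Omega> G S" and ne: "L \<noteq> R" "L \<noteq> S"
  shows "perm_group \<Omega> L Mod (L \<inter> R) \<cong> perm_group \<Omega> L Mod (L \<inter> S)"
proof (cases "L \<inter> R = L \<inter> S")
  case False
  then have RS: "R \<noteq> S" by blast
  interpret LR: plinth_pair \<Omega> G L R using plinth ne by (intro plinth_pairI)
  interpret LS: plinth_pair \<Omega> G L S using plinth ne by (intro plinth_pairI)
  interpret RS: plinth_pair \<Omega> G R S using plinth RS by (intro plinth_pairI)
  interpret SL: plinth_pair \<Omega> G S L by (rule LS.swapped)
  let ?A = "L \<inter> R" and ?B = "L \<inter> S" and ?C = "R \<inter> S" and ?D = "L \<inter> R \<inter> S"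
  \<comment> \<open>Equality would put \<open>L \<inter> R\<close> inside
    \<open>L \<inter> S\<close>; the chief factor property then makes the two equal, which is
    excluded, or \<open>L \<inter> S\<close> equal to \<open>L\<close>, which is transitive.\<close>
  have AC: "?A \<noteq> ?C"
  proof
    assume "?A = ?C"
    then have "?A \<subseteq> ?B" by blast
    then have "?B = ?A \<or> ?B = L" using LR.chief[OF LS.normal_N] by blast
    then show False using False LS.intransitive LS.transitive_L by auto
  qed
  have BC: "?B \<noteq> ?C"
  proof
    assume "?B = ?C"
    then have "?B \<subseteq> ?A" by blast
    then have "?A = ?B \<or> ?A = L" using LS.chief[OF LR.normal_N] by blast
    then show False using False LR.intransitive LR.transitive_L by auto
  qed
  have R: "?A <#>\<^bsub>BijGroup \<Omega>\<^esub> ?C = R"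
    using plinth_Int_mult[OF plinth(2,1,3)] ne RS AC by (simp add: Int_commute)
  have S: "?B <#>\<^bsub>BijGroup \<Omega>\<^esub> ?C = S"
    using plinth_Int_mult[OF plinth(3,1,2)] ne RS BC by (simp add: Int_commute)
  have C: "subgroup ?C (perm_group \<Omega> G)"
    using RS.normal_N by (rule normal_imp_subgroup)
  have CR: "perm_group \<Omega> ?C Mod ?D \<cong> perm_group \<Omega> R Mod ?A"
    using GG.second_iso[OF LR.normal_N C] R by (simp add: Int_ac)
  have CS: "perm_group \<Omega> ?C Mod ?D \<cong> perm_group \<Omega> S Mod ?B"
  proof -
    have "?B \<inter> ?C = ?D" by blast
    then show ?thesis
      using GG.second_iso[OF LS.normal_N C] S by simp
  qed
  have gC: "group (perm_group \<Omega> ?C Mod ?D)"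
  proof (rule normal.factorgroup_is_group)
    have "?D \<lhd> perm_group \<Omega> G"
      using GG.normal_subgroup_intersect[OF LR.normal_N SL.normal_L] .
    then have "?D \<lhd> subgrp (perm_group \<Omega> G) ?C"
      by (rule GG.normal_restrict_supergroup[OF C]) blast
    then show "?D \<lhd> perm_group \<Omega> ?C" by simp
  qed
  have SL: "perm_group \<Omega> S Mod ?B \<cong> perm_group \<Omega> L Mod ?B"
    using SL.quotient_swap by (simp only: Int_commute)
  have "perm_group \<Omega> L Mod ?A \<cong> perm_group \<Omega> R Mod ?A"
    by (rule LR.quotient_swap)
  also have "\<dots> \<cong> perm_group \<Omega> ?C Mod ?D"
    using group.iso_sym[OF gC CR] .
  also have "\<dots> \<cong> perm_group \<Omega> S Mod ?B" by (rule CS)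
  also have "\<dots> \<cong> perm_group \<Omega> L Mod ?B" by (rule SL)
  finally show ?thesis .
qed simp

text \<open>The two pairs are linked through the pair of \<open>L\<close> and \<open>L'\<close>; if
  these coincide, only the second plinth has to be changed.\<close>

lemma plinth_quotients_iso:
  assumes pair: "plinth \<Omega> G L" "plinth \<Omega> G R" "L \<noteq> R" "plinth \<Omega> G L'" "plinth \<Omega> G R'" "L' \<noteq> R'"
  shows "perm_group \<Omega> L Mod (L \<inter> R) \<cong> perm_group \<Omega> L' Mod (L' \<inter> R')"
proof (cases "L = L'")
  case True
  then show ?thesis using plinth_three_quotients[of L R R'] pair by simp
next
  case False
  interpret LL': plinth_pair \<Omega> G L L' using pair False by (intro plinth_pairI)
  have "perm_group \<Omega> L Mod (L \<inter> R) \<cong> perm_group \<Omega> L Mod (L \<inter> L')"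
    using plinth_three_quotients[of L R L'] pair False by simp
  also have "\<dots> \<cong> perm_group \<Omega> L' Mod (L' \<inter> L)"
    using LL'.quotient_swap by (simp only: Int_commute)
  also have "\<dots> \<cong> perm_group \<Omega> L' Mod (L' \<inter> R')"
    using plinth_three_quotients[of L' L R'] pair False by simp
  finally show ?thesis .
qed

end

section \<open>Finite groups: types, socles and uniqueness of the simple group\<close>

lemma (in plinth_pair) plinth_quotient_type:
  assumes T: "simple_group T" "\<not> comm_group T" and l: "1 \<le> l"
    and iso: "perm_group \<Delta> (induced ` L) \<cong> power_group T l"
  shows "type_HS \<Delta> (quotient_perms \<Omega> G (L \<inter> R)) \<or> type_HC \<Delta> (quotient_perms \<Omega> G (L \<inter> R))"
    and "perm_group \<Delta> (socle (perm_group \<Delta> (quotient_perms \<Omega> G (L \<inter> R))))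
      \<cong> power_group T l \<times>\<times> power_group T l"
proof -
  show "type_HS \<Delta> (quotient_perms \<Omega> G (L \<inter> R)) \<or> type_HC \<Delta> (quotient_perms \<Omega> G (L \<inter> R))"
    unfolding quotient_perms_eq using Q.type_HS_or_HC[OF T l iso] .
  let ?A = "perm_group \<Delta> (induced ` L)" and ?B = "perm_group \<Delta> (induced ` R)"
  have A: "group ?A" and B: "group ?B"
    using group.subgroup_imp_group[OF group_BijGroup] Q.subgroup_A Q.subgroup_B by auto
  have BT: "?B \<cong> power_group T l"
    using iso_trans[OF group.iso_sym[OF A] iso] Q.A_iso_B by simp
  have "?A \<times>\<times> ?B \<cong> perm_group \<Delta> (socle (perm_group \<Delta> (induced ` G)))"
    using Q.socle_iso by simp
  then have "perm_group \<Delta> (socle (perm_group \<Delta> (induced ` G))) \<cong> ?A \<times>\<times> ?B"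
    by (rule group.iso_sym[OF DirProd_group[OF A B]])
  also have "\<dots> \<cong> power_group T l \<times>\<times> power_group T l"
    using group.DirProd_iso_trans[OF A iso BT] .
  finally show "perm_group \<Delta> (socle (perm_group \<Delta> (quotient_perms \<Omega> G (L \<inter> R))))
      \<cong> power_group T l \<times>\<times> power_group T l"
    unfolding quotient_perms_eq .
qed

text \<open>Both hypotheses describe the same socle, for this pair of plinths, so the powers of
  \<open>T\<close> and \<open>T'\<close> with exponents \<open>l + l\<close> and
  \<open>l' + l'\<close> are isomorphic.\<close>

lemma (in plinth_pair) plinth_quotients_unique:
  assumes T: "simple_group T" "\<not> comm_group T" and l: "1 \<le> l"
    and T': "simple_group T'" "\<not> comm_group T'"
    and q: "plinth_quotients_HS_HC \<Omega> G T l" and q': "plinth_quotients_HS_HC \<Omega> G T' l'"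
  shows "T' \<cong> T \<and> l' = l"
proof -
  interpret T: simple_group T by (rule T)
  interpret T': simple_group T' by (rule T')
  let ?S = "perm_group \<Delta> (socle (perm_group \<Delta> (quotient_perms \<Omega> G (L \<inter> R))))"
  have S: "?S \<cong> power_group T l \<times>\<times> power_group T l" "?S \<cong> power_group T' l' \<times>\<times> power_group T' l'"
    using q q' plinth_L plinth_R distinct unfolding plinth_quotients_HS_HC_def Let_def by blast+
  have "subgroup (socle (perm_group \<Delta> (induced ` G))) (perm_group \<Delta> (induced ` G))"
    using Q.PG.normal_subgroup_set_mult_closed[OF Q.normal_A Q.normal_B]
    unfolding Q.socle_eq by (simp add: normal_imp_subgroup)
  then have gS: "group ?S"
    using Q.PG.subgroup_imp_group unfolding quotient_perms_eq by fastforce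
  have "power_group T (l + l) \<cong> power_group T l \<times>\<times> power_group T l"
    by (rule T.power_group_add)
  also have "\<dots> \<cong> ?S"
    using group.iso_sym[OF gS S(1)] .
  also have "\<dots> \<cong> power_group T' l' \<times>\<times> power_group T' l'"
    by (rule S(2))
  also have "\<dots> \<cong> power_group T' (l' + l')"
    using group.iso_sym[OF T'.power_group_group T'.power_group_add] .
  finally have iso: "power_group T (l + l) \<cong> power_group T' (l' + l')" .
  have "l + l = l' + l'" "T \<cong> T'"
    using power_group_iso_unique[OF T T' iso] l by auto
  then show ?thesis
    using T.iso_sym by simp
qed

text \<open>\<open>L\<close> modulo \<open>L \<inter> R\<close> has the same isomorphism type for
  all pairs, so the power decomposition found for one pair serves them all.\<close>

lemma (in plinth_pair) finite_quotients:
  assumes "finite G"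
  shows "\<exists>(T :: ('a \<Rightarrow> 'a) set monoid) l. simple_group T \<and> \<not> comm_group T \<and> 1 \<le> l \<and>
    plinth_quotients_HS_HC \<Omega> G T l"
proof -
  let ?A = "perm_group \<Delta> (induced ` L)" and ?X = "perm_group \<Omega> L Mod (L \<inter> R)"
  have gA: "group ?A"
    using group.subgroup_imp_group[OF group_BijGroup Q.subgroup_A] .
  have "finite (induced ` L)"
    using assms L_G by (simp add: finite_subset)
  then obtain M l where M: "M \<subseteq> induced ` L" "simple_group (perm_group \<Delta> M)"
    "\<not> comm_group (perm_group \<Delta> M)" and l: "1 \<le> l"
    and iso: "?A \<cong> power_group (perm_group \<Delta> M) l"
    using Q.A.direct_power by auto
  obtain \<psi> where \<psi>: "\<psi> \<in> iso ?A ?X"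
    using group.iso_sym[OF group_quotient_L quotient_iso_L] by (auto simp: is_iso_def)
  \<comment> \<open>\<open>M\<close> consists of permutations of the orbit set. Its image under
    \<open>\<psi>\<close> consists of cosets of \<open>L \<inter> R\<close>, which are of the
    element type demanded for \<open>T\<close>.\<close>
  define T where "T = image_group \<psi> (perm_group \<Delta> M)"
  have "inj_on \<psi> (carrier (perm_group \<Delta> M))"
    using \<psi> M(1) by (auto simp: iso_def bij_betw_def intro: inj_on_subset)
  note T = simple_group_image_group[OF M(2,3) this, folded T_def]
  have gM: "group (perm_group \<Delta> M)" and gT: "group T"
    using M(2) T(1) by (auto simp: simple_group_def)
  have "power_group (perm_group \<Delta> M) l \<cong> power_group T l"
    by (rule iso_product_groupI) (use T(3) gM gT in auto)
  then have AT: "?A \<cong> power_group T l"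
    using iso iso_trans by blast
  have "plinth_quotients_HS_HC \<Omega> G T l"
    unfolding plinth_quotients_HS_HC_def Let_def
  proof (intro allI impI)
    fix L' R' assume "plinth \<Omega> G L' \<and> plinth \<Omega> G R' \<and> L' \<noteq> R'"
    then interpret LR: plinth_pair \<Omega> G L' R' by (intro plinth_pairI) auto
    have "perm_group LR.\<Delta> (LR.induced ` L') \<cong> perm_group \<Omega> L' Mod (L' \<inter> R')"
      using group.iso_sym[OF LR.group_quotient_L LR.quotient_iso_L] .
    also have "\<dots> \<cong> ?X"
      using plinth_quotients_iso[OF LR.plinth_L LR.plinth_R LR.distinct plinth_L plinth_R distinct] .
    also have "\<dots> \<cong> ?A" by (rule quotient_iso_L)
    also have "\<dots> \<cong> power_group T l" by (rule AT)
    finally have iso': "perm_group LR.\<Delta> (LR.induced ` L') \<cong> power_group T l" .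
    show "primitive LR.\<Delta> (quotient_perms \<Omega> G (L' \<inter> R')) \<and>
        (type_HS LR.\<Delta> (quotient_perms \<Omega> G (L' \<inter> R')) \<or> type_HC LR.\<Delta> (quotient_perms \<Omega> G (L' \<inter> R'))) \<and>
        perm_group LR.\<Delta> (socle (perm_group LR.\<Delta> (quotient_perms \<Omega> G (L' \<inter> R'))))
          \<cong> power_group T l \<times>\<times> power_group T l"
      using LR.plinth_quotient_type[OF T(1,2) l iso'] LR.primitive_quotient LR.quotient_perms_eq by simp
  qed
  then show ?thesis
    using T(1,2) l by blast
qed

theorem theorem3p10:
  fixes \<Omega> :: "'a set" and G :: "('a \<Rightarrow> 'a) set"
  assumes "subgroup G (BijGroup \<Omega>)"
    and "semiprimitive \<Omega> G"
    and "\<exists>L R. plinth \<Omega> G L \<and> plinth \<Omega> G R \<and> L \<noteq> R"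
  shows "(\<exists>X :: ('a \<Rightarrow> 'a) set monoid. char_simple_group X \<and>
      (\<forall>L R. plinth \<Omega> G L \<and> plinth \<Omega> G R \<and> L \<noteq> R \<longrightarrow>
        faithful_action (perm_group \<Omega> G Mod (L \<inter> R)) (orbit_set \<Omega> (L \<inter> R))
          (quotient_action \<Omega> (L \<inter> R)) \<and>
        primitive (orbit_set \<Omega> (L \<inter> R)) (quotient_perms \<Omega> G (L \<inter> R)) \<and>
        perm_group \<Omega> L Mod (L \<inter> R) \<cong> X \<and>
        X \<cong> perm_group \<Omega> R Mod (L \<inter> R)))
    \<and> (finite G \<longrightarrow>
      (\<exists>(T :: ('a \<Rightarrow> 'a) set monoid) (l :: nat).
        simple_group T \<and> \<not> comm_group T \<and> 1 \<le> l \<and> plinth_quotients_HS_HC \<Omega> G T l \<and>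
        (\<forall>(T' :: 't monoid) l'.
          simple_group T' \<and> \<not> comm_group T' \<and> plinth_quotients_HS_HC \<Omega> G T' l'
          \<longrightarrow> T' \<cong> T \<and> l' = l)))"
proof -
  interpret semiprimitive_group \<Omega> G
    using assms(1,2) by (rule semiprimitive_group.intro)
  obtain L0 R0 where "plinth \<Omega> G L0" "plinth \<Omega> G R0" "L0 \<noteq> R0"
    using assms(3) by blast
  then interpret LR0: plinth_pair \<Omega> G L0 R0
    by (rule plinth_pairI)
  \<comment> \<open>Any one pair may define \<open>X\<close>, as the quotients of all pairs are
    isomorphic.\<close>
  let ?X = "perm_group \<Omega> L0 Mod (L0 \<inter> R0)"
  have "\<exists>X :: ('a \<Rightarrow> 'a) set monoid. char_simple_group X \<and>
      (\<forall>L R. plinth \<Omega> G L \<and> plinth \<Omega> G R \<and> L \<noteq> R \<longrightarrow>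
        faithful_action (perm_group \<Omega> G Mod (L \<inter> R)) (orbit_set \<Omega> (L \<inter> R))
          (quotient_action \<Omega> (L \<inter> R)) \<and>
        primitive (orbit_set \<Omega> (L \<inter> R)) (quotient_perms \<Omega> G (L \<inter> R)) \<and>
        perm_group \<Omega> L Mod (L \<inter> R) \<cong> X \<and>
        X \<cong> perm_group \<Omega> R Mod (L \<inter> R))"
  proof (intro conjI impI exI[of _ ?X] allI)
    show "char_simple_group ?X"
      by (rule LR0.char_simple_quotient)
    fix L R assume "plinth \<Omega> G L \<and> plinth \<Omega> G R \<and> L \<noteq> R"
    then interpret LR: plinth_pair \<Omega> G L R by (intro plinth_pairI) auto
    show "faithful_action (perm_group \<Omega> G Mod (L \<inter> R)) (orbit_set \<Omega> (L \<inter> R))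
        (quotient_action \<Omega> (L \<inter> R))"
      by (rule LR.faithful)
    show "primitive (orbit_set \<Omega> (L \<inter> R)) (quotient_perms \<Omega> G (L \<inter> R))"
      unfolding LR.quotient_perms_eq by (rule LR.primitive_quotient)
    show iso: "perm_group \<Omega> L Mod (L \<inter> R) \<cong> ?X"
      using plinth_quotients_iso[OF LR.plinth_L LR.plinth_R LR.distinct
          LR0.plinth_L LR0.plinth_R LR0.distinct] .
    show "?X \<cong> perm_group \<Omega> R Mod (L \<inter> R)"
      using iso_trans[OF group.iso_sym[OF LR.group_quotient_L iso] LR.quotient_swap] .
  qed
  moreover have "\<exists>(T :: ('a \<Rightarrow> 'a) set monoid) (l :: nat).
        simple_group T \<and> \<not> comm_group T \<and> 1 \<le> l \<and> plinth_quotients_HS_HC \<Omega> G T l \<and>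
        (\<forall>(T' :: 't monoid) l'.
          simple_group T' \<and> \<not> comm_group T' \<and> plinth_quotients_HS_HC \<Omega> G T' l'
          \<longrightarrow> T' \<cong> T \<and> l' = l)" if fin: "finite G"
  proof -
    obtain T :: "('a \<Rightarrow> 'a) set monoid" and l where
      "simple_group T" "\<not> comm_group T" "1 \<le> l" "plinth_quotients_HS_HC \<Omega> G T l"
      using LR0.finite_quotients[OF fin] by blast
    then show ?thesis
      using LR0.plinth_quotients_unique by blast
  qed
  ultimately show ?thesis
    by blast
qed

end
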